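(* Let $q\in(2,\infty)$. There are numbers $\sigma_*,\sigma^*$ with $\sigma_{crit}<\sigma_*\le\sigma^*$ such that for every fixed $\sigma>\sigma_{crit}$ the following holds for the curve $[\lambda\mapsto u^\lambda_{in}]$ of solutions to the small aspect ratio model (SAR): (i) If $\sigma<\sigma_*$, then there exists $\delta>0$ such that $$u^{\overline\lambda}_{in}(z)>u^\lambda_{in}(z),\qquad 0\le\overline\lambda<\lambda<\delta,\quad z\in(-1,1).$$ (ii) If $\sigma>\sigma^*$, then there exists $\delta>0$ such that $u^{\overline\lambda}_{in}$ and $u^\lambda_{in}$ intersect exactly two times on $(-1,1)$ for $0\le\overline\lambda<\lambda<\delta$.
   Context: Function space: $W^2_{q,D}(-1,1)=\{f\in W^2_q(-1,1): f(\pm1)=0\}$, where $W^2_q$ is the Sobolev space over $L_q$ of order 2. Small aspect ratio model (SAR), for $\sigma>0$, $\lambda\ge0$: find $u\in W^2_{q,D}(-1,1)$ with $-1<u<1$ and $$-\sigma\,\partial_z\arctan(\sigma\partial_zu)=-\frac1{u+1}+\lambda g_{sar}(u)\ \text{on }(-1,1),\qquad u(\pm1)=0,$$ $$g_{sar}(u)=(1+\sigma^2(\partial_zu)^2)^{1/2}\,\frac{1}{(u+1)^2\ln^2\big(\frac{2}{u+1}\big)}.$$ Catenoids: let $c_{crit}>0$ be the solution of $c_{crit}\sinh(c_{crit})=\cosh(c_{crit})$ and $\sigma_{crit}=\cosh(c_{crit})/c_{crit}$. For $\sigma>\sigma_{crit}$ the equation $\sigma=\cosh(c)/c$, $c>0$,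 has exactly two solutions $c_{out}<c_{crit}<c_{in}$. The inner catenoid is $u_{in}(z)=\cosh(c_{in}z)/\cosh(c_{in})-1$, a solution of (SAR) for $\lambda=0$. Solution curve: for $\sigma>\sigma_{crit}$ there are $\delta_0>0$ and an analytic map $[\lambda\mapsto u^\lambda_{in}]:[0,\delta_0)\to W^2_{q,D}(-1,1)$ with $u^0_{in}=u_{in}$ such that $u^\lambda_{in}$ solves (SAR) for each $\lambda$; it is provided by the implicit function theorem at $(u_{in},0)$, so near $\lambda=0$ it is the unique continuous curve of solutions emanating from $u_{in}$. The $\delta$ in the claim is at most $\delta_0$. *)

theory Defs
  imports "HOL-Analysis.Analysis"
begin

section \<open>Sobolev spaces on the interval (-1,1)\<close>

abbreviation Om :: "real set" where
  "Om \<equiv> {-1<..<1}"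

definition test_function :: "(real \<Rightarrow> real) \<Rightarrow> bool" where
  "test_function \<phi> \<longleftrightarrow>
     (\<forall>n x. (deriv ^^ n) \<phi> differentiable (at x)) \<and> closure {x. \<phi> x \<noteq> 0} \<subseteq> Om"

definition locally_integrable :: "(real \<Rightarrow> real) \<Rightarrow> bool" where
  "locally_integrable f \<longleftrightarrow>
     (\<forall>K. compact K \<and> K \<subseteq> Om \<longrightarrow> integrable (lebesgue_on K) f)"

definition has_weak_deriv :: "(real \<Rightarrow> real) \<Rightarrow> (real \<Rightarrow> real) \<Rightarrow> bool" where
  "has_weak_deriv f g \<longleftrightarrow>
     locally_integrable f \<and> locally_integrable g \<and>
     (\<forall>\<phi>. test_function \<phi> \<longrightarrow>
        (LINT x|lebesgue_on Om. f x * deriv \<phi> x) = - (LINT x|lebesgue_on Om. g x * \<phi> x))"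

definition weakly_differentiable :: "(real \<Rightarrow> real) \<Rightarrow> bool" where
  "weakly_differentiable f \<longleftrightarrow> (\<exists>g. has_weak_deriv f g)"

text \<open>A weak derivative is determined only up to a null set. Below, \<open>wderiv f\<close> occurs only
  under integrals over \<open>Om\<close>, in further weak derivatives, and in statements holding almost
  everywhere, so that the choice of the representative is irrelevant.\<close>

definition wderiv :: "(real \<Rightarrow> real) \<Rightarrow> real \<Rightarrow> real" where
  "wderiv f = (SOME g. has_weak_deriv f g)"

definition Lq :: "real \<Rightarrow> (real \<Rightarrow> real) set" where
  "Lq q = {f. f \<in> borel_measurable (lebesgue_on Om) \<and>
              integrable (lebesgue_on Om) (\<lambda>x. \<bar>f x\<bar> powr q)}"

text \<open>An element of the Sobolev space is an equivalence class of functions modulo null sets. It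
  is represented here by its continuous representative on \<open>[-1,1]\<close> (there is exactly one,
  by the one-dimensional Sobolev embedding); this gives boundary values and pointwise
  comparisons their meaning. Values outside \<open>[-1,1]\<close> are irrelevant.\<close>

definition W2q :: "real \<Rightarrow> (real \<Rightarrow> real) set" where
  "W2q q = {f. continuous_on {-1..1} f \<and>
               weakly_differentiable f \<and> weakly_differentiable (wderiv f) \<and>
               f \<in> Lq q \<and> wderiv f \<in> Lq q \<and> wderiv (wderiv f) \<in> Lq q}"

definition W2qD :: "real \<Rightarrow> (real \<Rightarrow> real) set" where
  "W2qD q = {f \<in> W2q q. f (-1) = 0 \<and> f 1 = 0}"

definition W2q_norm :: "real \<Rightarrow> (real \<Rightarrow> real) \<Rightarrow> real" where
  "W2q_norm q f =
     ((LINT x|lebesgue_on Om. \<bar>f x\<bar> powr q)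
      + (LINT x|lebesgue_on Om. \<bar>wderiv f x\<bar> powr q)
      + (LINT x|lebesgue_on Om. \<bar>wderiv (wderiv f) x\<bar> powr q)) powr (1 / q)"

text \<open>Real analyticity of a \<open>W2qD q\<close>-valued map on \<open>J\<close>: around each point of \<open>J\<close> the map is
  given, on a relative neighbourhood, by a power series converging in the Sobolev norm. At an
  endpoint belonging to \<open>J\<close> this amounts to an analytic extension beyond that endpoint.\<close>

definition analytic_W2qD :: "real \<Rightarrow> real set \<Rightarrow> (real \<Rightarrow> real \<Rightarrow> real) \<Rightarrow> bool" where
  "analytic_W2qD q J u \<longleftrightarrow>
     (\<forall>l\<in>J. u l \<in> W2qD q) \<and>
     (\<forall>l0\<in>J. \<exists>r>0. \<exists>a :: nat \<Rightarrow> real \<Rightarrow> real. (\<forall>k. a k \<in> W2qD q) \<and>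
        (\<forall>l\<in>J. \<bar>l - l0\<bar> < r \<longrightarrow>
           (\<lambda>N. W2q_norm q (\<lambda>z. u l z - (\<Sum>k<N. (l - l0) ^ k * a k z))) \<longlonglongrightarrow> 0))"


section \<open>The small aspect ratio model\<close>

definition g_sar :: "real \<Rightarrow> (real \<Rightarrow> real) \<Rightarrow> real \<Rightarrow> real" where
  "g_sar \<sigma> u z =
     (1 + \<sigma>\<^sup>2 * (wderiv u z)\<^sup>2) powr (1/2)
       * (1 / ((u z + 1)\<^sup>2 * (ln (2 / (u z + 1)))\<^sup>2))"

definition solves_SAR :: "real \<Rightarrow> real \<Rightarrow> real \<Rightarrow> (real \<Rightarrow> real) \<Rightarrow> bool" where
  "solves_SAR q \<sigma> l u \<longleftrightarrow>
     u \<in> W2qD q \<and>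
     (\<forall>z\<in>Om. -1 < u z \<and> u z < 1) \<and>
     weakly_differentiable (\<lambda>z. arctan (\<sigma> * wderiv u z)) \<and>
     (AE z in lebesgue_on Om.
        - \<sigma> * wderiv (\<lambda>y. arctan (\<sigma> * wderiv u y)) z = - 1 / (u z + 1) + l * g_sar \<sigma> u z)"


section \<open>Catenoids and the solution curve\<close>

definition c_crit :: real where
  "c_crit = (THE c. 0 < c \<and> c * sinh c = cosh c)"

definition sigma_crit :: real where
  "sigma_crit = cosh c_crit / c_crit"

definition c_in :: "real \<Rightarrow> real" where
  "c_in \<sigma> = (THE c. c_crit < c \<and> \<sigma> = cosh c / c)"

definition u_in :: "real \<Rightarrow> real \<Rightarrow> real" where
  "u_in \<sigma> z = cosh (c_in \<sigma> * z) / cosh (c_in \<sigma>) - 1"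

text \<open>The properties of the curve emanating from the inner catenoid that the implicit function
  theorem provides; any two such curves agree near \<open>0\<close>.\<close>

definition inner_solution_curve :: "real \<Rightarrow> real \<Rightarrow> real \<Rightarrow> (real \<Rightarrow> real \<Rightarrow> real) \<Rightarrow> bool" where
  "inner_solution_curve q \<sigma> \<delta>\<^sub>0 u \<longleftrightarrow>
     analytic_W2qD q {0..<\<delta>\<^sub>0} u \<and>
     (\<forall>z\<in>{-1..1}. u 0 z = u_in \<sigma> z) \<and>
     (\<forall>l\<in>{0..<\<delta>\<^sub>0}. solves_SAR q \<sigma> l (u l))"

end

theory Submission
  imports Defs "HOL-Computational_Algebra.Polynomial"
begin

text \<open>The sign of \<open>u l' - u l\<close> for small parameters is the sign of \<open>- v\<close>, where \<open>v\<close> is the derivative of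
the curve at \<open>0\<close>: by analyticity \<open>u l - u l' = (l - l') * (v + o(1))\<close> in \<open>C\<^sup>1[-1,1]\<close>, uniformly in
\<open>0 \<le> l' < l\<close>, and functions \<open>C\<^sup>1\<close>-close to \<open>v\<close> that vanish at \<open>-1\<close> and \<open>1\<close> have the same sign pattern as
\<open>v\<close>, because the zeros of \<open>v\<close> are simple. So everything reduces to the sign pattern of \<open>v\<close>.

Write \<open>c\<close> for \<open>c_in \<sigma>\<close>. Differentiating (SAR) at the inner catenoid shows that
\<open>v z = cosh (c z) * Y (c z)\<close>, where \<open>Y\<close> solves
\<open>Y'' + 2 sech\<^sup>2(x) Y = - 1 / L\<^sup>2\<close>, \<open>Y (-c) = Y c = 0\<close>, \<open>L = ln (2 cosh c / cosh x)\<close>.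
The homogeneous equation has the explicit solutions \<open>tanh x\<close> and \<open>1 - x tanh x\<close>, and the Wronskians of \<open>Y\<close>
with them are primitives of the forcing times these solutions. Three facts follow.
\<^item> The Wronskian with \<open>tanh\<close> shows that \<open>Y\<close> is even, and that \<open>Y / tanh\<close> has a derivative which changes
  sign at most once on \<open>(0, c)\<close>, from plus to minus.
\<^item> The Wronskian with \<open>1 - x tanh x\<close> gives the sign of \<open>Y' c\<close>: it is the sign of
  \<open>J c = \<integral> (1 - x tanh x) / L\<^sup>2\<close> over \<open>(0, c)\<close>, since \<open>c tanh c > 1\<close> beyond the critical catenoid.
\<^item> The same Wronskian up to \<open>c_crit\<close>, the zero of \<open>1 - x tanh x\<close>, gives \<open>Y c_crit < 0\<close>.

If \<open>J c > 0\<close>, then \<open>Y / tanh\<close> increases to \<open>0\<close> and \<open>Y\<close> is negative inside. If \<open>J c < 0\<close>, then \<open>Y\<close> is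
positive next to \<open>c\<close> but negative at \<open>c_crit\<close>, and the monotonicity of \<open>Y / tanh\<close> leaves exactly one simple
zero on each half. Finally \<open>J c > 0\<close> for \<open>c\<close> slightly above \<open>c_crit\<close>, where the integrand is almost
nowhere negative, and \<open>J c < 0\<close> for large \<open>c\<close>, where the weight \<open>1 / L\<^sup>2\<close> concentrates at \<open>x = c\<close>; and
\<open>c_in\<close> increases to infinity with \<open>\<sigma>\<close>.

The passage from weak to classical derivatives is elementary: testing with smoothed step functions gives
the fundamental theorem of calculus (\<open>weak_deriv_increment\<close>), and testing with smoothed hat
functions shows that two weak derivatives imply \<open>C\<^sup>1\<close> (\<open>second_weak_deriv_imp_C1\<close>). The main lemmas are
\<open>analytic_curve_C1_expansion\<close>, \<open>linearized_equation\<close>, \<open>boundary_slope\<close>, \<open>negative_if_slope_pos\<close>,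
\<open>one_crossing_if_slope_neg\<close> and \<open>inner_curve_linearization\<close>.\<close>

section \<open>Smooth step functions\<close>

definition smooth :: "(real \<Rightarrow> real) \<Rightarrow> bool" where
  "smooth f \<longleftrightarrow> (\<forall>n x. (deriv ^^ n) f differentiable (at x))"

lemma smooth_iff: "smooth f \<longleftrightarrow> (\<forall>x. f differentiable (at x)) \<and> smooth (deriv f)"
proof
  assume f: "smooth f"
  have "(deriv ^^ n) (deriv f) differentiable (at x)" for n x
    using f unfolding smooth_def by (metis comp_apply funpow_Suc_right)
  moreover have "f differentiable (at x)" for x
    using f unfolding smooth_def by (metis eq_id_iff funpow_0)
  ultimately show "(\<forall>x. f differentiable (at x)) \<and> smooth (deriv f)"
    by (simp add: smooth_def)
next
  assume f: "(\<forall>x. f differentiable (at x)) \<and> smooth (deriv f)"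
  show "smooth f" unfolding smooth_def
  proof (intro allI)
    fix n x show "(deriv ^^ n) f differentiable (at x)"
      using f by (cases n) (auto simp: smooth_def funpow_Suc_right simp del: funpow.simps)
  qed
qed

lemma smoothI: "(\<And>x. (f has_real_derivative g x) (at x)) \<Longrightarrow> smooth g \<Longrightarrow> smooth f"
proof -
  assume d: "\<And>x. (f has_real_derivative g x) (at x)" and "smooth g"
  moreover have "deriv f = g" using d by (auto intro: DERIV_imp_deriv)
  ultimately show "smooth f"
    by (subst smooth_iff) (auto simp: real_differentiable_def)
qed

text \<open>A function is smooth as soon as it lies in some class that is closed under differentiation. This
replaces an induction on the order of differentiation by the choice of a class.\<close>

lemma smooth_closed_class:
  assumes "C f" "\<And>f. C f \<Longrightarrow> \<exists>g. C g \<and> (\<forall>x. (f has_real_derivative g x) (at x))"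
  shows "smooth f"
proof -
  have "C ((deriv ^^ n) f)" for n
  proof (induction n)
    case (Suc n)
    then obtain g where "C g" "\<forall>x. ((deriv ^^ n) f has_real_derivative g x) (at x)"
      using assms(2) by blast
    moreover from this have "deriv ((deriv ^^ n) f) = g" by (auto intro: DERIV_imp_deriv)
    ultimately show ?case by simp
  qed (use assms in simp)
  then show ?thesis unfolding smooth_def
    using assms(2) by (meson real_differentiable_def)
qed

lemma smooth_has_deriv: "smooth f \<Longrightarrow> (f has_real_derivative deriv f x) (at x)"
  by (metis DERIV_deriv_iff_real_differentiable smooth_iff)

lemma smooth_deriv: "smooth f \<Longrightarrow> smooth (deriv f)"
  by (metis smooth_iff)

lemma smooth_continuous: "smooth f \<Longrightarrow> continuous_on A f"
  by (meson DERIV_isCont continuous_at_imp_continuous_on smooth_has_deriv)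

lemma smooth_add: assumes "smooth f" "smooth g" shows "smooth (\<lambda>x. f x + g x)"
proof (rule smooth_closed_class[where C = "\<lambda>h. \<exists>f g. smooth f \<and> smooth g \<and> h = (\<lambda>x. f x + g x)"])
  fix h assume "\<exists>f g. smooth f \<and> smooth g \<and> h = (\<lambda>x. f x + g x)"
  then obtain f g where "smooth f" "smooth g" "h = (\<lambda>x. f x + g x)" by blast
  then show "\<exists>g. (\<exists>f ga. smooth f \<and> smooth ga \<and> g = (\<lambda>x. f x + ga x)) \<and> (\<forall>x. (h has_real_derivative g x) (at x))"
    by (intro exI[of _ "\<lambda>x. deriv f x + deriv g x"])
       (auto intro!: derivative_eq_intros smooth_has_deriv smooth_deriv)
qed (use assms in blast)

lemma smooth_affine: assumes "smooth f" shows "smooth (\<lambda>x. c * f (m * x + d))"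
proof (rule smooth_closed_class[where C = "\<lambda>h. \<exists>c f. smooth f \<and> h = (\<lambda>x. c * f (m * x + d))"])
  fix h assume "\<exists>c f. smooth f \<and> h = (\<lambda>x. c * f (m * x + d))"
  then obtain c f where "smooth f" "h = (\<lambda>x. c * f (m * x + d))" by blast
  then show "\<exists>g. (\<exists>c f. smooth f \<and> g = (\<lambda>x. c * f (m * x + d))) \<and> (\<forall>x. (h has_real_derivative g x) (at x))"
    by (intro exI[of _ "\<lambda>x. (c * m) * deriv f (m * x + d)"])
       (auto intro!: derivative_eq_intros DERIV_chain2[OF smooth_has_deriv] smooth_deriv exI[of _ "c * m"])
qed (use assms in blast)

text \<open>Differentiating \<open>P / s ^ k * exp (- 1 / s)\<close> with \<open>s = t (1 - t)\<close> gives an expression of the same form with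
another polynomial and a larger exponent. The parameters \<open>P\<close> and \<open>k\<close> are there to obtain a class closed
under differentiation; the function used later is \<open>bump 1 0\<close>.\<close>

definition bump :: "real poly \<Rightarrow> nat \<Rightarrow> real \<Rightarrow> real" where
  "bump P k t = (if 0 < t \<and> t < 1
     then poly P t / (t * (1 - t)) ^ k * exp (- 1 / (t * (1 - t))) else 0)"

text \<open>The exponential series gives \<open>exp (- 1 / s) \<le> (k + 2)! s ^ (k + 2)\<close>, which beats the pole of order
\<open>k\<close> and leaves a factor \<open>s\<^sup>2\<close>. A quadratic bound at \<open>0\<close> and at \<open>1\<close> makes the derivative vanish there.\<close>

lemma bump_quadratic_bound:
  obtains M where "0 \<le> M" "\<And>t. \<bar>bump P k t\<bar> \<le> M * t\<^sup>2" "\<And>t. \<bar>bump P k t\<bar> \<le> M * (t - 1)\<^sup>2"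
proof -
  have "compact (poly P ` {0..1})" by (intro compact_continuous_image continuous_intros) auto
  then obtain B where B: "\<And>t. t \<in> {0..1} \<Longrightarrow> \<bar>poly P t\<bar> \<le> B"
    by (fastforce dest!: compact_imp_bounded simp: bounded_iff)
  have B0: "0 \<le> B" using B[of 0] by simp
  have main: "\<bar>bump P k t\<bar> \<le> B * fact (k + 2) * (t * (1 - t))\<^sup>2" if t: "0 < t" "t < 1" for t
  proof -
    define s where "s = t * (1 - t)"
    have s: "0 < s" unfolding s_def using t by simp
    have "(1/s) ^ (k + 2) / fact (k + 2) \<le> exp (1/s)"
    proof -
      have "(1/s) ^ (k + 2) /\<^sub>R fact (k + 2) \<le> (\<Sum>n. (1/s) ^ n /\<^sub>R fact n)"
        using sum_le_suminf[OF summable_exp_generic, of "{k+2}" "1/s"] s by simp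
      then show ?thesis by (simp add: exp_def field_simps)
    qed
    then have e: "exp (- 1 / s) \<le> fact (k + 2) * s ^ (k + 2)"
      using s by (simp add: exp_minus field_simps del: fact_Suc)
    have "\<bar>bump P k t\<bar> = \<bar>poly P t\<bar> / s ^ k * exp (- 1 / s)"
      using t s by (simp add: bump_def s_def abs_mult)
    also have "\<dots> \<le> B / s ^ k * (fact (k + 2) * s ^ (k + 2))"
      using B[of t] t s e by (intro mult_mono divide_right_mono) (auto simp: B0)
    also have "\<dots> = B * fact (k + 2) * s\<^sup>2"
      using s by (simp add: field_simps power_add power2_eq_square del: fact_Suc)
    finally show ?thesis by (simp add: s_def)
  qed
  have sq: "(t * (1 - t))\<^sup>2 \<le> t\<^sup>2" "(t * (1 - t))\<^sup>2 \<le> (t - 1)\<^sup>2" if "0 < t" "t < 1" for t :: real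
  proof -
    have "t * (1 - t) \<le> t" "t * (1 - t) \<le> 1 - t" "0 \<le> t * (1 - t)"
      using that by (auto simp: mult_left_le mult_left_le_one_le)
    then show "(t * (1 - t))\<^sup>2 \<le> t\<^sup>2" "(t * (1 - t))\<^sup>2 \<le> (t - 1)\<^sup>2"
      using power_mono[of "t * (1 - t)" t 2] power_mono[of "t * (1 - t)" "1 - t" 2]
      by (auto simp: power2_commute[of t 1])
  qed
  have B0': "0 \<le> B * fact (k + 2)" using B0 by simp
  have "\<bar>bump P k t\<bar> \<le> B * fact (k + 2) * t\<^sup>2 \<and> \<bar>bump P k t\<bar> \<le> B * fact (k + 2) * (t - 1)\<^sup>2" for t
  proof (cases "0 < t \<and> t < 1")
    case True
    then show ?thesis using main[of t] mult_left_mono[OF sq(1) B0', of t] mult_left_mono[OF sq(2) B0', of t]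
      by linarith
  next
    case False
    then have "bump P k t = 0" by (auto simp: bump_def)
    then show ?thesis using B0' by simp
  qed
  then show ?thesis using that B0' by blast
qed

lemma deriv_zero_if_quadratic:
  fixes f :: "real \<Rightarrow> real"
  assumes "\<And>t. \<bar>f t\<bar> \<le> M * (t - a)\<^sup>2"
  shows "(f has_real_derivative 0) (at a)"
proof -
  have fa: "f a = 0" using assms[of a] by simp
  have b: "\<bar>(f x - f a) / (x - a)\<bar> \<le> M * \<bar>x - a\<bar>" if "x \<noteq> a" for x
    using assms[of x] that by (simp add: fa field_simps power2_eq_square abs_mult_self)
  have "((\<lambda>x. (f x - f a) / (x - a)) \<longlongrightarrow> 0) (at a)"
  proof (rule Lim_null_comparison)
    show "\<forall>\<^sub>F x in at a. norm ((f x - f a) / (x - a)) \<le> M * \<bar>x - a\<bar>"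
      using b by (auto simp: eventually_at_filter)
    show "((\<lambda>x. M * \<bar>x - a\<bar>) \<longlongrightarrow> 0) (at a)"
      by (auto intro!: tendsto_eq_intros)
  qed
  then show ?thesis by (simp add: has_field_derivative_iff)
qed

lemma bump_has_derivative:
  "\<exists>Q m. \<forall>t. (bump P k has_real_derivative bump Q m t) (at t)"
proof -
  define s where "s = [:0, 1, - 1 :: real:]"
  define Q where "Q = pderiv P * s\<^sup>2 - smult (real k) (P * pderiv s * s) + P * pderiv s"
  have "(bump P k has_real_derivative bump Q (k + 2) t) (at t)" for t
  proof -
    obtain M where M: "0 \<le> M" "\<And>t. \<bar>bump P k t\<bar> \<le> M * t\<^sup>2" "\<And>t. \<bar>bump P k t\<bar> \<le> M * (t - 1)\<^sup>2"
      using bump_quadratic_bound[of P k] by blast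
    consider "0 < t \<and> t < 1" | "t = 0" | "t = 1" | "t < 0" | "t > 1" by linarith
    then show ?thesis
    proof cases
      case 1
      have ps: "poly s t = t * (1 - t)" for t by (simp add: s_def algebra_simps)
      have nz: "poly s t \<noteq> 0" using 1 by (simp add: ps)
      have "((\<lambda>t. poly P t / poly s t ^ k * exp (- 1 / poly s t)) has_real_derivative bump Q (k + 2) t) (at t)"
        apply (cases k)
         apply (rule derivative_eq_intros poly_DERIV refl nz power_not_zero | simp add: nz)+
        subgoal using 1 nz by (simp add: bump_def ps[symmetric] Q_def field_simps power2_eq_square)
        apply (rule derivative_eq_intros poly_DERIV refl nz power_not_zero | simp add: nz)+
        using 1 nz by (simp add: bump_def ps[symmetric] Q_def field_simps power2_eq_square)
      moreover have "\<forall>\<^sub>F x in nhds t. poly P x / poly s x ^ k * exp (- 1 / poly s x) = bump P k x"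
        using eventually_nhds_in_open[of "{0<..<1}" t] 1
        by (auto elim!: eventually_mono simp: bump_def ps)
      ultimately show ?thesis by (subst (asm) DERIV_cong_ev[OF refl _ refl])
    next
      case 2
      then show ?thesis using deriv_zero_if_quadratic[of "bump P k" M 0] M(2) by (simp add: bump_def)
    next
      case 3
      then show ?thesis using deriv_zero_if_quadratic[of "bump P k" M 1] M(3) by (simp add: bump_def)
    next
      case 4
      have "\<forall>\<^sub>F x in nhds t. 0 = bump P k x"
        using eventually_nhds_in_open[of "{..<0}" t] 4 by (auto elim!: eventually_mono simp: bump_def)
      with 4 show ?thesis using DERIV_cong_ev[OF refl, of "\<lambda>_. 0" "bump P k" t 0 0] by (simp add: bump_def)
    next
      case 5
      have "\<forall>\<^sub>F x in nhds t. 0 = bump P k x"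
        using eventually_nhds_in_open[of "{1<..}" t] 5 by (auto elim!: eventually_mono simp: bump_def)
      with 5 show ?thesis using DERIV_cong_ev[OF refl, of "\<lambda>_. 0" "bump P k" t 0 0] by (simp add: bump_def)
    qed
  qed
  then show ?thesis by blast
qed

lemma smooth_bump: "smooth (bump P k)"
  by (rule smooth_closed_class[where C = "\<lambda>f. \<exists>P k. f = bump P k"]) (use bump_has_derivative in blast)+

text \<open>Integrating from \<open>-1\<close> rather than from \<open>0\<close> keeps the point \<open>0\<close> away from the end of the interval of
integration, so that no one-sided derivative has to be glued.\<close>

lemma antiderivative_from_zero:
  fixes f :: "real \<Rightarrow> real"
  assumes f: "continuous_on UNIV f" and f0: "\<And>t. t \<le> 0 \<Longrightarrow> f t = 0"
  obtains F where "\<And>t. (F has_real_derivative f t) (at t)" "\<And>t. t \<le> 0 \<Longrightarrow> F t = 0"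
proof -
  define F where "F t = integral {-1..t} f" for t
  have F0: "F t = 0" if "t \<le> 0" for t
    unfolding F_def using that integral_cong[of "{-1..t}" f "\<lambda>_. 0"] f0 by simp
  have "(F has_real_derivative f t) (at t)" for t
  proof (cases "t < 0")
    case True
    have "\<forall>\<^sub>F x in nhds t. 0 = F x"
      using eventually_nhds_in_open[of "{..<0}" t] True by (auto elim!: eventually_mono simp: F0)
    with True show ?thesis using DERIV_cong_ev[OF refl, of "\<lambda>_. 0" F t 0 0] by (simp add: f0)
  next
    case False
    have "((\<lambda>x. integral {-1..x} f) has_real_derivative f t) (at t within {-1..t+1})"
      using False by (intro integral_has_real_derivative continuous_on_subset[OF f]) auto
    then show ?thesis using False by (simp add: F_def[abs_def] at_within_Icc_at)
  qed
  with F0 that show ?thesis by blast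
qed

text \<open>After rescaling, \<open>\<eta>\<close> approximates the Dirac mass at \<open>0\<close>, \<open>S\<close> the Heaviside function and \<open>T\<close> the
positive part.\<close>

locale smooth_step =
  fixes T S \<eta> :: "real \<Rightarrow> real"
  assumes T_smooth: "smooth T"
    and T_deriv: "(T has_real_derivative S t) (at t)"
    and S_deriv: "(S has_real_derivative \<eta> t) (at t)"
    and eta_nonneg: "0 \<le> \<eta> t"
    and eta_zero: "t \<le> 0 \<or> 1 \<le> t \<Longrightarrow> \<eta> t = 0"
    and S_nonneg: "0 \<le> S t" and S_le_1: "S t \<le> 1"
    and S_0: "t \<le> 0 \<Longrightarrow> S t = 0" and S_1: "1 \<le> t \<Longrightarrow> S t = 1"
    and T_0: "t \<le> 0 \<Longrightarrow> T t = 0" and T_1: "1 \<le> t \<Longrightarrow> T t = t - 1 + T 1"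
    and T_bound: "\<bar>T t - max t 0\<bar> \<le> 1"

lemma smooth_step_exists:
  obtains T S \<eta> where "smooth_step T S \<eta>"
proof -
  define b where "b = bump 1 0"
  have smb: "smooth b" unfolding b_def by (rule smooth_bump)
  have b0: "0 \<le> b t" for t by (simp add: b_def bump_def)
  have bpos: "0 < b t" if "0 < t" "t < 1" for t using that by (simp add: b_def bump_def)
  have bz: "b t = 0" if "t \<le> 0 \<or> 1 \<le> t" for t using that by (auto simp: b_def bump_def)
  obtain F where F: "\<And>t. (F has_real_derivative b t) (at t)" and F0: "\<And>t. t \<le> 0 \<Longrightarrow> F t = 0"
    using antiderivative_from_zero[OF smooth_continuous[OF smb]] bz by metis
  have Fmono: "F s \<le> F t" if "s \<le> t" for s t
    using that b0 by (intro DERIV_nonneg_imp_nondecreasing[OF that]) (use F b0 in blast)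
  have Fc: "continuous_on A F" for A
    by (meson DERIV_isCont continuous_at_imp_continuous_on F)
  have F1: "0 < F 1"
    using DERIV_pos_imp_increasing_open[of 0 1 F, OF _ _ Fc] F bpos F0[of 0] by fastforce
  have Fge: "F t = F 1" if "1 \<le> t" for t
  proof (cases "t = 1")
    case False
    then have t: "1 < t" using that by simp
    have "(F has_real_derivative 0) (at x)" if "1 < x" for x using F[of x] bz[of x] that by simp
    then show ?thesis by (intro DERIV_isconst2[OF t Fc, of t]) (use t in auto)
  qed simp
  define S where "S t = F t / F 1" for t
  define \<eta> where "\<eta> t = b t / F 1" for t
  have S: "(S has_real_derivative \<eta> t) (at t)" for t
    unfolding S_def[abs_def] \<eta>_def by (rule DERIV_cdivide[OF F])
  have S0: "S t = 0" if "t \<le> 0" for t using that by (simp add: S_def F0)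
  have Sc: "continuous_on A S" for A
    by (meson DERIV_isCont continuous_at_imp_continuous_on S)
  obtain T where T: "\<And>t. (T has_real_derivative S t) (at t)" and T0: "\<And>t. t \<le> 0 \<Longrightarrow> T t = 0"
    using antiderivative_from_zero[OF Sc S0] by metis
  have sm: "smooth T"
    by (rule smoothI[OF T], rule smoothI[OF S])
       (use smooth_affine[OF smb, of "1 / F 1" 1 0] in \<open>simp add: \<eta>_def[abs_def]\<close>)
  have Snn: "0 \<le> S t" for t using F1 Fmono[of 0 t] F0[of 0] F0[of t] by (cases "t \<le> 0") (auto simp: S_def)
  have S1: "S t = 1" if "1 \<le> t" for t using Fge[OF that] F1 by (simp add: S_def)
  have Sle: "S t \<le> 1" for t using Fmono[of t 1] F1 S1[of t] by (cases "t \<le> 1") (auto simp: S_def)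
  have Tc: "continuous_on A T" for A
    by (meson DERIV_isCont continuous_at_imp_continuous_on T)
  have T1: "T t = t - 1 + T 1" if "1 \<le> t" for t
  proof (cases "t = 1")
    case False
    have "((\<lambda>t. T t - t) has_real_derivative S x - 1) (at x)" for x
      by (auto intro!: derivative_eq_intros T)
    then have d: "((\<lambda>t. T t - t) has_real_derivative 0) (at x)" if "1 < x" for x
      using S1[of x] that by (metis diff_self less_imp_le)
    have c: "continuous_on {1..t} (\<lambda>t. T t - t)" by (intro continuous_intros Tc)
    from False that have t: "1 < t" by simp
    have "T t - t = T 1 - 1"
      by (rule DERIV_isconst2[OF t c d, of t]) (use t in auto)
    then show ?thesis by simp
  qed simp
  have Tb: "0 \<le> T t \<and> T t \<le> t" if "0 \<le> t" for t
  proof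
    show "0 \<le> T t" using DERIV_nonneg_imp_nondecreasing[OF that, of T] T Snn T0[of 0] by force
    have "((\<lambda>t. t - T t) has_real_derivative 1 - S x) (at x)" for x
      by (auto intro!: derivative_eq_intros T)
    then show "T t \<le> t" using DERIV_nonneg_imp_nondecreasing[OF that, of "\<lambda>t. t - T t"] Sle T0[of 0]
      by (smt (verit, ccfv_threshold))
  qed
  have "\<bar>T t - max t 0\<bar> \<le> 1" for t
    using Tb[of t] Tb[of 1] T0[of t] T1[of t] by (cases "t \<le> 0"; cases "1 \<le> t") (auto simp: max_def)
  moreover have "0 \<le> \<eta> t" "t \<le> 0 \<or> 1 \<le> t \<Longrightarrow> \<eta> t = 0" for t
    using F1 b0[of t] bz[of t] by (auto simp: \<eta>_def)
  ultimately have "smooth_step T S \<eta>"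
    using sm T S Snn Sle S0 S1 T0 T1 by (intro smooth_step.intro)
  then show ?thesis by (rule that)
qed

section \<open>Weak derivatives on the interval\<close>

lemma borel_measurable_lebesgue_on:
  "f \<in> borel_measurable borel \<Longrightarrow> f \<in> borel_measurable (lebesgue_on S)"
  by (simp add: measurable_restrict_space1 measurable_completion)

lemma integrable_lebesgue_on_subset:
  fixes f :: "real \<Rightarrow> real"
  assumes "integrable (lebesgue_on B) f" "A \<subseteq> B" "A \<in> sets lebesgue" "B \<in> sets lebesgue"
  shows "integrable (lebesgue_on A) f"
proof -
  have "set_integrable lebesgue B f"
    unfolding set_integrable_def using assms integrable_restrict_space[of B lebesgue f] by simp
  then have "set_integrable lebesgue A f"
    by (rule set_integrable_subset) (use assms in auto)
  then show ?thesis
    unfolding set_integrable_def using assms integrable_restrict_space[of A lebesgue f] by simp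
qed

lemma locally_integrable_mult:
  assumes f: "locally_integrable f" and \<phi>: "continuous_on UNIV \<phi>"
    and z: "\<And>x. x \<notin> {a..b} \<Longrightarrow> \<phi> x = 0" and ab: "-1 < a" "b < 1"
  shows "integrable (lebesgue_on {a..b}) (\<lambda>x. f x * \<phi> x)"
    and "integrable (lebesgue_on Om) (\<lambda>x. f x * \<phi> x)"
    and "(LINT x|lebesgue_on Om. f x * \<phi> x) = (LINT x|lebesgue_on {a..b}. f x * \<phi> x)"
proof -
  have sub: "{a..b} \<subseteq> Om" using ab by auto
  have fi: "integrable (lebesgue_on {a..b}) f"
    using f sub by (simp add: locally_integrable_def)
  have m: "\<phi> \<in> borel_measurable (lebesgue_on {a..b})"
    by (intro continuous_imp_measurable_on_sets_lebesgue continuous_on_subset[OF \<phi>]) auto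
  have "compact (\<phi> ` {a..b})"
    by (intro compact_continuous_image continuous_on_subset[OF \<phi>]) auto
  then obtain B where B: "\<And>x. x \<in> {a..b} \<Longrightarrow> \<bar>\<phi> x\<bar> \<le> B"
    by (fastforce dest!: compact_imp_bounded simp: bounded_iff)
  show i: "integrable (lebesgue_on {a..b}) (\<lambda>x. f x * \<phi> x)"
  proof (rule Bochner_Integration.integrable_bound)
    show "integrable (lebesgue_on {a..b}) (\<lambda>x. B * f x)" using fi by simp
    show "(\<lambda>x. f x * \<phi> x) \<in> borel_measurable (lebesgue_on {a..b})"
      using m fi by (intro borel_measurable_times) auto
    have "\<bar>f x * \<phi> x\<bar> \<le> \<bar>B * f x\<bar>" if "x \<in> {a..b}" for x
    proof -
      have "\<bar>f x\<bar> * \<bar>\<phi> x\<bar> \<le> \<bar>f x\<bar> * \<bar>B\<bar>"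
        using B[OF that] by (intro mult_left_mono) auto
      then show ?thesis by (simp add: abs_mult mult.commute)
    qed
    then show "AE x in lebesgue_on {a..b}. norm (f x * \<phi> x) \<le> norm (B * f x)"
      by (intro AE_I2) auto
  qed
  have e: "(if x \<in> Om then f x * \<phi> x else 0) = (if x \<in> {a..b} then f x * \<phi> x else 0)" for x
    using z[of x] sub by auto
  have "integrable lebesgue (\<lambda>x. if x \<in> {a..b} then f x * \<phi> x else 0)"
    using i Lebesgue_Measure.integrable_restrict_UNIV[of "{a..b}" "\<lambda>x. f x * \<phi> x"] by simp
  then show "integrable (lebesgue_on Om) (\<lambda>x. f x * \<phi> x)"
    using Lebesgue_Measure.integrable_restrict_UNIV[of Om "\<lambda>x. f x * \<phi> x"] unfolding e by simp
  have "(LINT x|lebesgue_on Om. f x * \<phi> x) = (LINT x|lebesgue. (if x \<in> Om then f x * \<phi> x else 0))"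
    by (rule Lebesgue_Measure.integral_restrict_UNIV[symmetric]) auto
  also have "\<dots> = (LINT x|lebesgue. (if x \<in> {a..b} then f x * \<phi> x else 0))" unfolding e ..
  also have "\<dots> = (LINT x|lebesgue_on {a..b}. f x * \<phi> x)"
    by (rule Lebesgue_Measure.integral_restrict_UNIV) auto
  finally show "(LINT x|lebesgue_on Om. f x * \<phi> x) = (LINT x|lebesgue_on {a..b}. f x * \<phi> x)" .
qed

lemma locally_integrable_Icc:
  assumes "locally_integrable f" "-1 < a" "b < 1"
  shows "integrable (lebesgue_on {a..b}) f"
proof -
  have "{a..b} \<subseteq> Om" using assms by auto
  then show ?thesis using assms(1) by (simp add: locally_integrable_def)
qed

lemma locally_integrable_mult_limit:
  assumes f: "locally_integrable f" and ab: "-1 < a" "b < 1"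
    and \<phi>: "\<And>n. continuous_on UNIV (\<phi> n)" and B: "\<And>n t. t \<in> {a..b} \<Longrightarrow> \<bar>\<phi> n t\<bar> \<le> B"
    and lim: "\<And>t. (\<lambda>n. \<phi> n t) \<longlonglongrightarrow> \<psi> t"
  shows "(\<lambda>n. LINT t|lebesgue_on {a..b}. f t * \<phi> n t) \<longlonglongrightarrow> (LINT t|lebesgue_on {a..b}. f t * \<psi> t)"
proof (rule integral_dominated_convergence)
  have fi: "integrable (lebesgue_on {a..b}) f" by (rule locally_integrable_Icc[OF f ab])
  then show "integrable (lebesgue_on {a..b}) (\<lambda>t. B * \<bar>f t\<bar>)" by simp
  have m: "\<phi> n \<in> borel_measurable borel" for n by (rule borel_measurable_continuous_onI[OF \<phi>])
  then have "\<psi> \<in> borel_measurable borel" by (rule borel_measurable_LIMSEQ_real[OF lim])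
  then show "(\<lambda>t. f t * \<psi> t) \<in> borel_measurable (lebesgue_on {a..b})"
    "(\<lambda>t. f t * \<phi> n t) \<in> borel_measurable (lebesgue_on {a..b})" for n
    by (intro borel_measurable_times borel_measurable_integrable[OF fi] borel_measurable_lebesgue_on m; assumption)+
  show "AE t in lebesgue_on {a..b}. (\<lambda>n. f t * \<phi> n t) \<longlonglongrightarrow> f t * \<psi> t"
    by (intro AE_I2 tendsto_mult_left lim)
  have "\<bar>f t\<bar> * \<bar>\<phi> n t\<bar> \<le> \<bar>f t\<bar> * B" if "t \<in> {a..b}" for n t
    using B[OF that] by (intro mult_left_mono) auto
  then show "AE t in lebesgue_on {a..b}. norm (f t * \<phi> n t) \<le> B * \<bar>f t\<bar>" for n
    by (intro AE_I2) (simp add: abs_mult mult.commute)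
qed

lemma continuous_locally_integrable:
  assumes "continuous_on Om p" shows "locally_integrable p"
  unfolding locally_integrable_def
proof (intro allI impI)
  fix K :: "real set" assume K: "compact K \<and> K \<subseteq> Om"
  then have "set_integrable lborel K p"
    unfolding set_integrable_def
    by (intro borel_integrable_compact continuous_on_subset[OF assms]) auto
  then have "integrable lebesgue (\<lambda>x. indicator K x *\<^sub>R p x)"
    unfolding set_integrable_def by (subst integrable_completion) auto
  then show "integrable (lebesgue_on K) p"
    using K by (subst integrable_restrict_space) (auto intro!: borel_compact)
qed

lemma test_functionI:
  assumes "smooth \<phi>" "\<And>x. x \<notin> {a..b} \<Longrightarrow> \<phi> x = 0" "-1 < a" "b < 1"
  shows "test_function \<phi>"
proof -
  have "closure {x. \<phi> x \<noteq> 0} \<subseteq> {a..b}"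
    using assms(2) by (intro closure_minimal subsetI) (blast, simp)
  then show ?thesis using assms by (auto simp: test_function_def smooth_def)
qed

text \<open>Lebesgue's differentiation theorem recovers the values from the integrals. It is applied on the compact
intervals \<open>K n\<close>, which exhaust \<open>Om\<close>, since \<open>f\<close> and \<open>g\<close> may fail to be integrable near \<open>-1\<close> and \<open>1\<close>.\<close>

lemma AE_equal_if_equal_integrals:
  assumes f: "locally_integrable f" and g: "locally_integrable g"
    and eq: "\<And>a b. -1 < a \<Longrightarrow> a < b \<Longrightarrow> b < 1 \<Longrightarrow>
      (LINT x|lebesgue_on {a..b}. f x) = (LINT x|lebesgue_on {a..b}. g x)"
  shows "AE x in lebesgue_on Om. f x = g x"
proof -
  define K where "K n = {-1 + 1 / (real n + 2)..1 - 1 / (real n + 2)}" for n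
  define h where "h n x = (if x \<in> K n then f x - g x else 0)" for n x
  have K: "compact (K n)" "K n \<subseteq> Om" "K n \<in> sets lebesgue" for n
  proof -
    have "0 < 1 / (real n + 2)" by simp
    then show "K n \<subseteq> Om" unfolding K_def atLeastAtMost_iff greaterThanLessThan_iff subset_iff by linarith
  qed (auto simp: K_def)
  have hi: "h n integrable_on cbox a b" for n a b
  proof -
    have "integrable (lebesgue_on (K n)) (\<lambda>x. f x - g x)"
      using f g K by (simp add: locally_integrable_def)
    then have "integrable lebesgue (h n)"
      unfolding h_def[abs_def] using Lebesgue_Measure.integrable_restrict_UNIV[of "K n" "\<lambda>x. f x - g x"] K by simp
    then have "h n integrable_on UNIV"
      by (rule has_integral_integrable[OF has_integral_integral_lebesgue])
    then show ?thesis by (rule integrable_on_subcbox) simp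
  qed
  have "\<exists>N. negligible N \<and> (\<forall>x e. x \<notin> N \<longrightarrow> 0 < e \<longrightarrow> (\<exists>d>0. \<forall>s. 0 < s \<and> s < d \<longrightarrow>
      norm (integral (cbox x (x + s *\<^sub>R One)) (h n) /\<^sub>R s ^ DIM(real) - h n x) < e))" for n
    using integrable_ccontinuous_explicit[of "h n", OF hi] by metis
  then obtain N where N: "\<And>n. negligible (N n)"
    and lim: "\<And>n x e. x \<notin> N n \<Longrightarrow> 0 < e \<Longrightarrow> (\<exists>d>0. \<forall>s. 0 < s \<and> s < d \<longrightarrow>
      norm (integral (cbox x (x + s *\<^sub>R One)) (h n) /\<^sub>R s ^ DIM(real) - h n x) < e)"
    by metis
  have zero: "f x = g x" if x: "x \<in> Om" "x \<notin> (\<Union>n. N n)" for x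
  proof (rule ccontr)
    assume ne: "f x \<noteq> g x"
    obtain n where n: "1 / (real n + 2) < min (1 - x) (1 + x)"
    proof -
      have "0 < min (1 - x) (1 + x)" using x by auto
      then obtain n where "1 / real (Suc n) < min (1 - x) (1 + x)"
        using nat_approx_posE by blast
      moreover have "1 / (real n + 2) \<le> 1 / real (Suc n)" by (simp add: field_simps)
      ultimately have "1 / (real n + 2) < min (1 - x) (1 + x)" by linarith
      then show ?thesis by (rule that)
    qed
    then have xK: "x \<in> K n" by (auto simp: K_def)
    define e where "e = \<bar>f x - g x\<bar>"
    have "0 < e" using ne by (simp add: e_def)
    then obtain d where d: "0 < d" "\<And>s. 0 < s \<Longrightarrow> s < d \<Longrightarrow>
        norm (integral (cbox x (x + s *\<^sub>R One)) (h n) /\<^sub>R s ^ DIM(real) - h n x) < e"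
      using lim[of x n e] x by blast
    define s where "s = min (d / 2) (1 - 1 / (real n + 2) - x)"
    have s: "0 < s" "s < d" "x + s \<le> 1 - 1 / (real n + 2)" using d n by (auto simp: s_def)
    have sub: "{x..x+s} \<subseteq> K n" using xK s by (auto simp: K_def)
    have "0 < 1 / (real n + 2)" by simp
    then have x1: "-1 < x" "x + s < 1" using x(1) s(3) by (simp, linarith)
    have fi: "integrable (lebesgue_on {x..x+s}) f" "integrable (lebesgue_on {x..x+s}) g"
      using x1 f g by (auto intro: locally_integrable_Icc)
    have "((\<lambda>y. f y - g y) has_integral (LINT y|lebesgue_on {x..x+s}. f y - g y)) {x..x+s}"
      using fi by (intro has_integral_integral_lebesgue_on) auto
    moreover have "(LINT y|lebesgue_on {x..x+s}. f y - g y) = 0"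
      using fi eq[of x "x + s"] x1 s by simp
    ultimately have "(h n has_integral 0) {x..x+s}"
      by (intro has_integral_eq[of "{x..x+s}" "\<lambda>y. f y - g y" "h n" 0]) (use sub in \<open>auto simp: h_def\<close>)
    then have "integral {x..x+s} (h n) = 0" by (rule integral_unique)
    then show False using d(2)[of s] s xK by (simp add: h_def e_def)
  qed
  have "negligible (\<Union>n. N n)" using N by (rule negligible_Union_nat)
  then have "AE x in lebesgue. x \<notin> (\<Union>n. N n)"
    unfolding negligible_iff_null_sets by (rule AE_not_in)
  then show ?thesis
    by (subst AE_restrict_space_iff) (auto elim!: eventually_mono simp: zero)
qed

context smooth_step
begin

lemma deriv_T: "deriv T = S" and deriv_S: "deriv S = \<eta>"
  using T_deriv S_deriv by (auto intro: DERIV_imp_deriv)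

lemma S_smooth: "smooth S" and eta_smooth: "smooth \<eta>"
  using smooth_deriv[OF T_smooth] smooth_deriv[of S] by (auto simp: deriv_T deriv_S)

lemma eta_continuous: "continuous_on A (\<lambda>t. \<eta> ((t - a) / e) / e)"
  using smooth_continuous[OF smooth_affine[OF eta_smooth, of "1/e" "1/e" "- a / e"], of A]
  by (simp add: diff_divide_distrib)

lemma mollify:
  assumes p: "continuous_on Om p" and a: "-1 < a" and r: "0 < r" "a + r < 1"
  shows "(\<lambda>n. LINT t|lebesgue_on Om. p t * (\<eta> ((t - a) / (r / Suc n)) / (r / Suc n))) \<longlonglongrightarrow> p a"
proof (rule LIMSEQ_I)
  fix \<epsilon> :: real assume \<epsilon>: "0 < \<epsilon>"
  have "isCont p a" using p a r by (simp add: continuous_on_eq_continuous_at)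
  then obtain d where d: "0 < d" "\<And>t. \<bar>t - a\<bar> < d \<Longrightarrow> \<bar>p t - p a\<bar> < \<epsilon> / 2"
    using \<epsilon> unfolding continuous_at_eps_delta dist_real_def
    by (metis half_gt_zero)
  obtain n0 where n0: "r / d < real n0" using reals_Archimedean2 by blast
  have "\<bar>(LINT t|lebesgue_on Om. p t * (\<eta> ((t - a) / (r / Suc n)) / (r / Suc n))) - p a\<bar> < \<epsilon>"
    if n: "n0 \<le> n" for n
  proof -
    define e where "e = r / Suc n"
    have e0: "0 < e" using r by (simp add: e_def)
    have "r < real (Suc n) * d" using n0 n d(1) r by (simp add: field_simps) (smt (verit, best) mult_left_mono of_nat_le_iff)
    then have ed: "e < d" by (simp add: e_def field_simps)
    have er: "e \<le> r" using r by (simp add: e_def field_simps)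
    define w where "w t = \<eta> ((t - a) / e) / e" for t
    have wc: "continuous_on A w" for A unfolding w_def by (rule eta_continuous)
    have w0: "w t = 0" if "t \<notin> {a..a+e}" for t
      unfolding w_def using that e0 eta_zero[of "(t - a) / e"] by (force simp: field_simps)
    have wi: "(w has_integral 1) {a..a+e}"
    proof -
      have "((\<lambda>t. S ((t - a) / e)) has_real_derivative w t) (at t within {a..a+e})" for t
        unfolding w_def by (rule DERIV_cong[OF DERIV_chain2[OF S_deriv]], (rule derivative_eq_intros refl | use e0 in simp)+)
      then have "(w has_integral S ((a + e - a) / e) - S ((a - a) / e)) {a..a+e}"
        using e0 by (intro fundamental_theorem_of_calculus)
          (auto simp: has_real_derivative_iff_has_vector_derivative)
      then show ?thesis using e0 by (simp add: S_0 S_1)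
    qed
    have wint: "integrable (lebesgue_on {a..a+e}) w"
      by (intro continuous_imp_integrable_real wc)
    have w1: "(LINT t|lebesgue_on {a..a+e}. w t) = 1"
      by (rule has_integral_unique[OF has_integral_integral_lebesgue_on[OF wint] wi]) auto
    have ae1: "a + e < 1" using er r by simp
    note pw = locally_integrable_mult[OF continuous_locally_integrable[OF p] wc w0 a ae1]
    have "(LINT t|lebesgue_on Om. p t * w t) - p a = (LINT t|lebesgue_on {a..a+e}. p t * w t - p a * w t)"
      using pw w1 wint by simp
    also have "\<bar>\<dots>\<bar> \<le> (LINT t|lebesgue_on {a..a+e}. \<epsilon> / 2 * w t)"
    proof (rule integral_abs_bound_integral)
      show "integrable (lebesgue_on {a..a+e}) (\<lambda>t. p t * w t - p a * w t)"
        using pw wint by simp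
      show "integrable (lebesgue_on {a..a+e}) (\<lambda>t. \<epsilon> / 2 * w t)" using wint by simp
      fix t assume "t \<in> space (lebesgue_on {a..a+e})"
      then have "\<bar>p t - p a\<bar> \<le> \<epsilon> / 2" using d(2)[of t] ed by auto
      moreover have "0 \<le> w t" unfolding w_def using e0 eta_nonneg by simp
      ultimately have "\<bar>p t - p a\<bar> * \<bar>w t\<bar> \<le> \<epsilon> / 2 * w t"
        by (metis abs_of_nonneg mult_right_mono)
      then show "\<bar>p t * w t - p a * w t\<bar> \<le> \<epsilon> / 2 * w t"
        by (simp add: abs_mult[symmetric] algebra_simps)
    qed
    also have "\<dots> = \<epsilon> / 2" using w1 by simp
    finally show ?thesis using \<epsilon> by (simp add: e_def w_def)
  qed
  then show "\<exists>n0. \<forall>n\<ge>n0. norm ((LINT t|lebesgue_on Om. p t * (\<eta> ((t - a) / (r / Suc n)) / (r / Suc n))) - p a) < \<epsilon>"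
    by (auto simp: real_norm_def)
qed

lemma S_rescaled_limit:
  assumes "0 < r"
  shows "(\<lambda>n. S (s / (r / Suc n))) \<longlonglongrightarrow> (if 0 < s then 1 else 0)"
proof (cases "0 < s")
  case True
  obtain n0 where n0: "r / s < real n0" using reals_Archimedean2 by blast
  have "S (s / (r / Suc n)) = 1" if "n0 \<le> n" for n
  proof (rule S_1)
    have "r < s * real (Suc n)" using n0 that True
      by (simp add: field_simps) (smt (verit, best) mult_left_mono of_nat_le_iff)
    then show "1 \<le> s / (r / Suc n)" using assms by (simp add: field_simps)
  qed
  then show ?thesis using True by (intro tendsto_eventually) (auto simp: eventually_sequentially)
next
  case False
  have "S (s / (r / Suc n)) = 0" for n
    using False assms by (intro S_0 divide_nonpos_pos) auto
  then show ?thesis using False by (simp only: if_False tendsto_const)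
qed

lemma T_rescaled_limit:
  assumes "0 < r"
  shows "(\<lambda>n. (r / Suc n) * T (s / (r / Suc n))) \<longlonglongrightarrow> max s 0"
proof -
  have b: "\<bar>(r / Suc n) * T (s / (r / Suc n)) - max s 0\<bar> \<le> r / Suc n" for n
  proof -
    have e: "0 < r / Suc n" using assms by simp
    have "max s 0 = (r / Suc n) * max (s / (r / Suc n)) 0"
    proof (cases "0 \<le> s")
      case True
      then have "0 \<le> s / (r / Suc n)" using e by (intro divide_nonneg_pos)
      then show ?thesis using True assms by (simp add: max.absorb1 del: of_nat_Suc)
    next
      case False
      then have "s / (r / Suc n) \<le> 0" using e by (intro divide_nonpos_pos) auto
      then show ?thesis using False by (simp add: max.absorb2 del: of_nat_Suc)
    qed
    then have "\<bar>(r / Suc n) * T (s / (r / Suc n)) - max s 0\<bar> =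
        \<bar>(r / Suc n) * (T (s / (r / Suc n)) - max (s / (r / Suc n)) 0)\<bar>"
      by (simp only: right_diff_distrib)
    also have "\<dots> = (r / Suc n) * \<bar>T (s / (r / Suc n)) - max (s / (r / Suc n)) 0\<bar>"
      unfolding abs_mult using e by (simp only: abs_of_pos)
    also have "\<dots> \<le> (r / Suc n) * 1" using e T_bound by (intro mult_left_mono) auto
    finally show ?thesis by simp
  qed
  have "(\<lambda>n. r / Suc n) \<longlonglongrightarrow> 0" using tendsto_mult_right_zero[OF LIMSEQ_inverse_real_of_nat, of r]
    by (simp add: divide_inverse)
  then have "(\<lambda>n. (r / Suc n) * T (s / (r / Suc n)) - max s 0) \<longlonglongrightarrow> 0"
    by (rule Lim_null_comparison[rotated]) (unfold real_norm_def, intro always_eventually allI b)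
  then show ?thesis by (simp add: LIM_zero_iff)
qed

text \<open>The test functions \<open>\<phi> n\<close> are smoothed indicator functions of \<open>{a..b}\<close>. Their derivatives are approximate
Dirac masses at \<open>a\<close> and \<open>b\<close>, so the two sides of the definition of the weak derivative converge to
\<open>p a - p b\<close> and to minus the integral.\<close>

lemma step_increment:
  assumes w: "has_weak_deriv f g" and ae: "AE x in lebesgue_on Om. f x = p x"
    and p: "continuous_on Om p" and ab: "-1 < a" "a < b" "b < 1"
  shows "p b - p a = (LINT x|lebesgue_on {a..b}. g x)"
proof -
  define r where "r = (1 - b) / 2"
  have r: "0 < r" "b + r < 1" using ab by (auto simp: r_def field_simps)
  define e where "e n = r / real (Suc n)" for n
  have e: "0 < e n" "e n \<le> r" for n using r by (auto simp: e_def field_simps)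
  define \<phi> where "\<phi> n t = S ((t - a) / e n) - S ((t - b) / e n)" for n t
  have f: "locally_integrable f" and g: "locally_integrable g" using w by (auto simp: has_weak_deriv_def)
  let ?w = "\<lambda>n a t. \<eta> ((t - a) / e n) / e n"
  have sm: "smooth (\<phi> n)" for n
    using smooth_add[OF smooth_affine[OF S_smooth, of 1 "1 / e n" "- a / e n"]
        smooth_affine[OF S_smooth, of "-1" "1 / e n" "- b / e n"]]
    by (simp add: \<phi>_def[abs_def] diff_divide_distrib)
  have \<phi>0: "\<phi> n t = 0" if "t \<notin> {a..b+r}" for n t
  proof -
    have "t < a \<or> b + e n < t" using that e[of n] by auto
    then show ?thesis unfolding \<phi>_def using ab e[of n]
      by (auto simp: S_0 S_1 field_simps)
  qed
  have tf: "test_function (\<phi> n)" for n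
    using test_functionI[OF sm \<phi>0] ab r by auto
  have d: "(\<phi> n has_real_derivative ?w n a t - ?w n b t) (at t)" for n t
    unfolding \<phi>_def using e[of n]
    by (auto intro!: derivative_eq_intros DERIV_chain2[OF S_deriv])
  have dd: "deriv (\<phi> n) = (\<lambda>t. ?w n a t - ?w n b t)" for n using d by (auto intro: DERIV_imp_deriv)
  have w0: "?w n a t = 0" "?w n b t = 0" if "t \<notin> {a..b+r}" for n t
    using that e[of n] ab eta_zero[of "(t - a) / e n"] eta_zero[of "(t - b) / e n"]
    by (force simp: field_simps)+
  note pl = continuous_locally_integrable[OF p]
  have pw: "integrable (lebesgue_on Om) (\<lambda>t. p t * ?w n a t)" "integrable (lebesgue_on Om) (\<lambda>t. p t * ?w n b t)" for n
    using locally_integrable_mult(2)[OF pl eta_continuous w0(1)] locally_integrable_mult(2)[OF pl eta_continuous w0(2)] ab r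
    by auto
  have fw: "integrable (lebesgue_on Om) (\<lambda>t. f t * (?w n a t - ?w n b t))" for n
  proof (rule locally_integrable_mult(2)[OF f])
    show "continuous_on UNIV (\<lambda>t. ?w n a t - ?w n b t)" by (intro continuous_on_diff eta_continuous)
    show "?w n a t - ?w n b t = 0" if "t \<notin> {a..b+r}" for t using w0[OF that, of n] by (simp only: diff_self)
  qed (use ab r in auto)
  have "(LINT t|lebesgue_on Om. f t * deriv (\<phi> n) t) =
      (LINT t|lebesgue_on Om. p t * ?w n a t) - (LINT t|lebesgue_on Om. p t * ?w n b t)" for n
  proof -
    have "(LINT t|lebesgue_on Om. f t * deriv (\<phi> n) t) = (LINT t|lebesgue_on Om. p t * ?w n a t - p t * ?w n b t)"
      unfolding dd using ae pw[of n] fw[of n]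
      by (intro integral_cong_AE) (auto elim!: eventually_mono simp: algebra_simps)
    then show ?thesis using pw[of n] by simp
  qed
  moreover have "(\<lambda>n. LINT t|lebesgue_on Om. p t * ?w n a t) \<longlonglongrightarrow> p a"
    unfolding e_def using ab r by (intro mollify[OF p]) auto
  moreover have "(\<lambda>n. LINT t|lebesgue_on Om. p t * ?w n b t) \<longlonglongrightarrow> p b"
    unfolding e_def using ab r by (intro mollify[OF p]) auto
  ultimately have L: "(\<lambda>n. LINT t|lebesgue_on Om. f t * deriv (\<phi> n) t) \<longlonglongrightarrow> p a - p b"
    by (simp add: tendsto_diff)
  have "(\<lambda>n. LINT t|lebesgue_on {a..b+r}. g t * \<phi> n t) \<longlonglongrightarrow>
      (LINT t|lebesgue_on {a..b+r}. g t * ((if 0 < t - a then 1 else 0) - (if 0 < t - b then 1 else 0)))"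
  proof (rule locally_integrable_mult_limit[OF g])
    show "-1 < a" "b + r < 1" by (rule ab r)+
    show "\<bar>\<phi> n t\<bar> \<le> 1" for n t
      unfolding \<phi>_def using S_nonneg S_le_1 by (smt (verit, best))
    show "(\<lambda>n. \<phi> n t) \<longlonglongrightarrow> (if 0 < t - a then 1 else 0) - (if 0 < t - b then 1 else 0)" for t
      unfolding \<phi>_def e_def by (intro tendsto_diff S_rescaled_limit r)
  qed (rule smooth_continuous[OF sm])
  also have "(\<lambda>n. LINT t|lebesgue_on {a..b+r}. g t * \<phi> n t) = (\<lambda>n. - (LINT t|lebesgue_on Om. f t * deriv (\<phi> n) t))"
  proof
    fix n
    have "(LINT t|lebesgue_on {a..b+r}. g t * \<phi> n t) = (LINT t|lebesgue_on Om. g t * \<phi> n t)"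
      using locally_integrable_mult(3)[OF g smooth_continuous[OF sm] \<phi>0] ab r by simp
    also have "\<dots> = - (LINT t|lebesgue_on Om. f t * deriv (\<phi> n) t)"
      using w tf[of n] by (simp add: has_weak_deriv_def)
    finally show "(LINT t|lebesgue_on {a..b+r}. g t * \<phi> n t) = - (LINT t|lebesgue_on Om. f t * deriv (\<phi> n) t)" .
  qed
  finally have "- (p a - p b) = (LINT t|lebesgue_on {a..b+r}. g t * ((if 0 < t - a then 1 else 0) - (if 0 < t - b then 1 else 0)))"
    using LIMSEQ_unique[OF tendsto_minus[OF L]] by blast
  also have "\<dots> = (LINT t|lebesgue_on {a..b+r}. (if t \<in> {a<..b} then g t else 0))"
    using ab by (intro Bochner_Integration.integral_cong) auto
  also have "\<dots> = (LINT t|lebesgue_on {a<..b}. g t)"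
    using ab r by (intro integral_restrict) auto
  also have "\<dots> = (LINT t|lebesgue_on {a..b}. g t)"
  proof -
    have gab: "integrable (lebesgue_on {a..b}) g"
      using ab by (intro locally_integrable_Icc[OF g]) auto
    then have "integrable (lebesgue_on {a<..b}) g"
      by (rule integrable_lebesgue_on_subset) auto
    then have "(LINT t|lebesgue_on {a<..b}. g t) = integral {a<..b} g" "(LINT t|lebesgue_on {a..b}. g t) = integral {a..b} g"
      using gab by (auto intro: lebesgue_integral_eq_integral)
    moreover have "integral {a<..b} g = integral {a..b} g"
      by (rule integral_spike_set) (auto intro: negligible_subset[of "{a}"])
    ultimately show ?thesis by simp
  qed
  finally show ?thesis by simp
qed

text \<open>The same idea at second order. The test functions \<open>\<phi> n\<close> smooth the hat function with kinks at \<open>a\<close>,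
\<open>x\<close>, \<open>b\<close>; their second derivatives are approximately \<open>\<alpha>\<close>, \<open>-1\<close> and \<open>\<beta>\<close> times Dirac masses at these points.
The two conditions on \<open>\<alpha>\<close> and \<open>\<beta>\<close> say that the hat vanishes to the right of \<open>b\<close>.\<close>

lemma hat_formula:
  assumes f: "continuous_on Om f" and fg: "has_weak_deriv f g" and gh: "has_weak_deriv g h"
    and ax: "-1 < a" "a < x" "x < b" and r: "0 < r" "b + r < 1"
    and \<alpha>\<beta>: "\<alpha> + \<beta> = 1" "\<alpha> * a + \<beta> * b = x"
  shows "\<alpha> * f a - f x + \<beta> * f b =
    (LINT t|lebesgue_on {a..b+r}. h t * (\<alpha> * max (t - a) 0 - max (t - x) 0 + \<beta> * max (t - b) 0))"
proof -
  define e where "e n = r / real (Suc n)" for n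
  have e: "0 < e n" "e n \<le> r" for n using r by (auto simp: e_def field_simps)
  have e_le: "y + e n < 1" if "y \<le> b" for y n using that e[of n] r by linarith
  define w where "w n y t = \<eta> ((t - y) / e n) / e n" for n y t
  define \<phi> where "\<phi> n t = \<alpha> * (e n * T ((t - a) / e n)) - e n * T ((t - x) / e n) + \<beta> * (e n * T ((t - b) / e n))" for n t
  define \<phi>1 where "\<phi>1 n t = \<alpha> * S ((t - a) / e n) - S ((t - x) / e n) + \<beta> * S ((t - b) / e n)" for n t
  have g: "locally_integrable g" and h: "locally_integrable h" using gh by (auto simp: has_weak_deriv_def)
  note fl = continuous_locally_integrable[OF f]
  have ar: "-1 < a" "b + r < 1" using ax r by auto
  have d: "(\<phi> n has_real_derivative \<phi>1 n t) (at t)" for n t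
    unfolding \<phi>_def \<phi>1_def using e[of n]
    by (auto intro!: derivative_eq_intros DERIV_chain2[OF T_deriv])
  have d1: "(\<phi>1 n has_real_derivative \<alpha> * w n a t - w n x t + \<beta> * w n b t) (at t)" for n t
    unfolding \<phi>1_def w_def using e[of n]
    by (auto intro!: derivative_eq_intros DERIV_chain2[OF S_deriv] simp: mult.commute)
  have dd: "deriv (\<phi> n) = \<phi>1 n" "deriv (\<phi>1 n) = (\<lambda>t. \<alpha> * w n a t - w n x t + \<beta> * w n b t)" for n
    by (intro ext DERIV_imp_deriv d d1)+
  have sm1: "smooth (\<phi>1 n)" for n
    using smooth_add[OF smooth_add[OF smooth_affine[OF S_smooth, of \<alpha> "1 / e n" "- a / e n"]
        smooth_affine[OF S_smooth, of "-1" "1 / e n" "- x / e n"]] smooth_affine[OF S_smooth, of \<beta> "1 / e n" "- b / e n"]]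
    by (simp add: \<phi>1_def[abs_def] diff_divide_distrib)
  have sm: "smooth (\<phi> n)" for n using d sm1 by (rule smoothI)
  have outside: "t < a \<or> b + e n < t" if "t \<notin> {a..b+r}" for n t
    using that e[of n] by auto
  have \<phi>0: "\<phi> n t = 0" if t: "t \<notin> {a..b+r}" for n t
    using outside[OF t, of n]
  proof
    assume "t < a"
    then have "(t - y) / e n \<le> 0" if "a \<le> y" for y
      using e[of n] that by (intro divide_nonpos_pos) auto
    then show ?thesis using ax by (simp add: \<phi>_def T_0)
  next
    assume t: "b + e n < t"
    have "e n * T ((t - y) / e n) = t - y + e n * (T 1 - 1)" if "y \<le> b" for y
    proof -
      have "1 \<le> (t - y) / e n" using t that e[of n] by (simp add: field_simps)
      from T_1[OF this] show ?thesis using e[of n] by (simp add: field_simps)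
    qed
    then have "\<phi> n t = \<alpha> * (t - a + e n * (T 1 - 1)) - (t - x + e n * (T 1 - 1)) + \<beta> * (t - b + e n * (T 1 - 1))"
      using ax by (simp add: \<phi>_def)
    also have "\<dots> = (\<alpha> + \<beta> - 1) * (t + e n * (T 1 - 1)) - (\<alpha> * a + \<beta> * b - x)"
      by (simp add: algebra_simps)
    finally show ?thesis using \<alpha>\<beta> by simp
  qed
  have \<phi>10: "\<phi>1 n t = 0" if t: "t \<notin> {a..b+r}" for n t
    using outside[OF t, of n]
  proof
    assume "t < a"
    then have "(t - y) / e n \<le> 0" if "a \<le> y" for y
      using e[of n] that by (intro divide_nonpos_pos) auto
    then show ?thesis using ax by (simp add: \<phi>1_def S_0)
  next
    assume t: "b + e n < t"
    have "1 \<le> (t - y) / e n" if "y \<le> b" for y using t that e[of n] by (simp add: field_simps)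
    then show ?thesis using ax \<alpha>\<beta>(1) by (simp add: \<phi>1_def S_1)
  qed
  have w0: "w n y t = 0" if t: "t \<notin> {a..b+r}" and y: "a \<le> y" "y \<le> b" for n t y
    using outside[OF t, of n]
  proof
    assume "t < a"
    then have "(t - y) / e n \<le> 0" using e[of n] y by (intro divide_nonpos_pos) auto
    then show ?thesis by (simp add: w_def eta_zero)
  next
    assume t: "b + e n < t"
    have "1 \<le> (t - y) / e n" using t y e[of n] by (simp add: field_simps)
    then show ?thesis by (simp add: w_def eta_zero)
  qed
  have tf: "test_function (\<phi> n)" "test_function (\<phi>1 n)" for n
    using test_functionI[OF sm \<phi>0 ar] test_functionI[OF sm1 \<phi>10 ar] by auto
  have wc: "continuous_on UNIV (w n y)" for n y unfolding w_def by (rule eta_continuous)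
  have fw: "integrable (lebesgue_on Om) (\<lambda>t. f t * w n y t)" if "a \<le> y" "y \<le> b" for n y
    using locally_integrable_mult(2)[OF fl wc w0 ar] that by auto
  have "(LINT t|lebesgue_on {a..b+r}. h t * \<phi> n t) = \<alpha> * (LINT t|lebesgue_on Om. f t * w n a t)
      - (LINT t|lebesgue_on Om. f t * w n x t) + \<beta> * (LINT t|lebesgue_on Om. f t * w n b t)" for n
  proof -
    have "(LINT t|lebesgue_on {a..b+r}. h t * \<phi> n t) = (LINT t|lebesgue_on Om. h t * \<phi> n t)"
      by (rule locally_integrable_mult(3)[OF h smooth_continuous[OF sm] \<phi>0 ar, symmetric])
    also have "\<dots> = - (LINT t|lebesgue_on Om. g t * \<phi>1 n t)"
      using gh tf[of n] unfolding has_weak_deriv_def dd(1)[symmetric] by simp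
    also have "\<dots> = (LINT t|lebesgue_on Om. f t * deriv (\<phi>1 n) t)"
      using fg tf[of n] by (simp add: has_weak_deriv_def)
    also have "\<dots> = (LINT t|lebesgue_on Om. \<alpha> * (f t * w n a t) - f t * w n x t + \<beta> * (f t * w n b t))"
      unfolding dd by (intro Bochner_Integration.integral_cong) (auto simp: algebra_simps)
    also have "\<dots> = \<alpha> * (LINT t|lebesgue_on Om. f t * w n a t)
      - (LINT t|lebesgue_on Om. f t * w n x t) + \<beta> * (LINT t|lebesgue_on Om. f t * w n b t)"
      using fw[of a n] fw[of x n] fw[of b n] ax by simp
    finally show ?thesis .
  qed
  moreover have lim: "(\<lambda>n. LINT t|lebesgue_on Om. f t * w n y t) \<longlonglongrightarrow> f y" if "a \<le> y" "y \<le> b" for y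
    unfolding w_def e_def using that ax r by (intro mollify[OF f]) auto
  ultimately have L: "(\<lambda>n. LINT t|lebesgue_on {a..b+r}. h t * \<phi> n t) \<longlonglongrightarrow> \<alpha> * f a - f x + \<beta> * f b"
    using ax by (auto intro!: tendsto_intros lim)
  define B where "B = (\<bar>\<alpha>\<bar> + 1 + \<bar>\<beta>\<bar>) * 4"
  have "(\<lambda>n. LINT t|lebesgue_on {a..b+r}. h t * \<phi> n t) \<longlonglongrightarrow>
    (LINT t|lebesgue_on {a..b+r}. h t * (\<alpha> * max (t - a) 0 - max (t - x) 0 + \<beta> * max (t - b) 0))"
  proof (rule locally_integrable_mult_limit[OF h ar])
    show "(\<lambda>n. \<phi> n t) \<longlonglongrightarrow> \<alpha> * max (t - a) 0 - max (t - x) 0 + \<beta> * max (t - b) 0" for t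
      unfolding \<phi>_def e_def
      by (intro tendsto_mult tendsto_add tendsto_diff tendsto_const T_rescaled_limit r)
    have Tb: "\<bar>e n * T ((t - y) / e n)\<bar> \<le> 4" if "a \<le> y" "y \<le> b" "t \<in> {a..b+r}" for n t y
    proof -
      have en: "0 < e n" "e n \<le> 2" using e[of n] ax r by auto
      have "e n * max ((t - y) / e n) 0 \<le> 2"
      proof (cases "0 \<le> t - y")
        case True
        then have "0 \<le> (t - y) / e n" using en by (intro divide_nonneg_pos) auto
        then show ?thesis using that ax r en by (simp add: max.absorb1)
      next
        case False
        then have "(t - y) / e n \<le> 0" using en by (intro divide_nonpos_pos) auto
        then show ?thesis by (simp add: max.absorb2)
      qed
      moreover have "0 \<le> e n * max ((t - y) / e n) 0" using en by (intro mult_nonneg_nonneg) auto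
      moreover have "\<bar>e n * (T ((t - y) / e n) - max ((t - y) / e n) 0)\<bar> \<le> 2 * 1"
        unfolding abs_mult using en T_bound by (intro mult_mono) auto
      ultimately show ?thesis unfolding right_diff_distrib by linarith
    qed
    show "\<bar>\<phi> n t\<bar> \<le> B" if "t \<in> {a..b+r}" for n t
    proof -
      have "\<bar>\<phi> n t\<bar> \<le> \<bar>\<alpha>\<bar> * \<bar>e n * T ((t - a) / e n)\<bar> + \<bar>e n * T ((t - x) / e n)\<bar> + \<bar>\<beta>\<bar> * \<bar>e n * T ((t - b) / e n)\<bar>"
        unfolding \<phi>_def abs_mult[symmetric] by linarith
      also have "\<dots> \<le> \<bar>\<alpha>\<bar> * 4 + 4 + \<bar>\<beta>\<bar> * 4"
        using that ax by (intro add_mono mult_left_mono Tb) auto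
      finally show ?thesis by (simp add: B_def algebra_simps)
    qed
  qed (rule smooth_continuous[OF sm])
  with L show ?thesis by (rule LIMSEQ_unique)
qed

end

text \<open>The fundamental theorem of calculus for weak derivatives. The function \<open>f\<close> may differ from its continuous
representative \<open>p\<close> on a null set; this matters when \<open>f\<close> is itself a weak derivative.\<close>

lemma weak_deriv_increment:
  assumes "has_weak_deriv f g" "AE x in lebesgue_on Om. f x = p x"
    and "continuous_on Om p" "-1 < a" "a < b" "b < 1"
  shows "p b - p a = (LINT x|lebesgue_on {a..b}. g x)"
proof -
  obtain T S \<eta> where "smooth_step T S \<eta>" by (rule smooth_step_exists)
  then interpret smooth_step T S \<eta> .
  show ?thesis using assms by (rule step_increment)
qed

lemma AE_neq_point: "AE t in lebesgue_on S. t \<noteq> (x::real)" if "S \<in> sets lebesgue"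
proof -
  have "AE t in lebesgue. t \<noteq> x" by (intro AE_completion AE_lborel_singleton)
  then show ?thesis using that by (subst AE_restrict_space_iff) (auto elim: eventually_mono)
qed

lemma tail_integral_isCont:
  fixes h :: "real \<Rightarrow> real"
  assumes h: "integrable (lebesgue_on {a..b}) h"
  shows "isCont (\<lambda>x. LINT t|lebesgue_on {a..b}. h t * (if x < t then 1 else 0)) x"
  unfolding isCont_def tendsto_at_iff_sequentially comp_def
proof (intro allI impI)
  fix X :: "nat \<Rightarrow> real" assume X: "X \<longlonglongrightarrow> x"
  show "(\<lambda>n. LINT t|lebesgue_on {a..b}. h t * (if X n < t then 1 else 0)) \<longlonglongrightarrow>
     (LINT t|lebesgue_on {a..b}. h t * (if x < t then 1 else 0))"
  proof (rule integral_dominated_convergence)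
    show "integrable (lebesgue_on {a..b}) (\<lambda>t. \<bar>h t\<bar>)" using h by simp
    have m: "(\<lambda>t. h t * (if y < t then 1 else 0)) \<in> borel_measurable (lebesgue_on {a..b})" for y
      by (intro borel_measurable_times borel_measurable_integrable[OF h] borel_measurable_lebesgue_on) measurable
    show "(\<lambda>t. h t * (if x < t then 1 else 0)) \<in> borel_measurable (lebesgue_on {a..b})"
      "(\<lambda>t. h t * (if X n < t then 1 else 0)) \<in> borel_measurable (lebesgue_on {a..b})" for n
      by (rule m)+
    have "(\<lambda>n. h t * (if X n < t then 1 else 0)) \<longlonglongrightarrow> h t * (if x < t then 1 else 0)" if "t \<noteq> x" for t
    proof (rule tendsto_eventually)
      show "\<forall>\<^sub>F n in sequentially. h t * (if X n < t then 1 else 0) = h t * (if x < t then 1 else 0)"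
      proof (cases "x < t")
        case True
        then show ?thesis using order_tendstoD(2)[OF X True] by (auto elim!: eventually_mono)
      next
        case False
        then have "t < x" using that by simp
        from order_tendstoD(1)[OF X this] show ?thesis by (rule eventually_mono) (use False in auto)
      qed
    qed
    note lim = this
    have aene: "AE t in lebesgue_on {a..b}. t \<noteq> x" by (rule AE_neq_point) simp
    show "AE t in lebesgue_on {a..b}. (\<lambda>n. h t * (if X n < t then 1 else 0)) \<longlonglongrightarrow> h t * (if x < t then 1 else 0)"
      using aene by (rule eventually_mono) (rule lim)
    show "AE t in lebesgue_on {a..b}. norm (h t * (if X n < t then 1 else 0)) \<le> \<bar>h t\<bar>" for n by auto
  qed
qed

lemma truncated_moment_integrable:
  fixes h :: "real \<Rightarrow> real"
  assumes h: "integrable (lebesgue_on {a..b}) h"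
  shows "integrable (lebesgue_on {a..b}) (\<lambda>t. h t * max (t - x) 0)"
proof (rule Bochner_Integration.integrable_bound)
  define B where "B = \<bar>a\<bar> + \<bar>b\<bar> + \<bar>x\<bar>"
  show "integrable (lebesgue_on {a..b}) (\<lambda>t. B * h t)" using h by simp
  show "(\<lambda>t. h t * max (t - x) 0) \<in> borel_measurable (lebesgue_on {a..b})"
    by (intro borel_measurable_times borel_measurable_integrable[OF h] borel_measurable_lebesgue_on) measurable
  have "\<bar>h t * max (t - x) 0\<bar> \<le> \<bar>B * h t\<bar>" if "t \<in> {a..b}" for t
  proof -
    have "\<bar>max (t - x) 0\<bar> \<le> \<bar>B\<bar>" using that by (auto simp: B_def)
    then have "\<bar>h t\<bar> * \<bar>max (t - x) 0\<bar> \<le> \<bar>h t\<bar> * \<bar>B\<bar>" by (intro mult_left_mono) auto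
    then show ?thesis unfolding abs_mult by (simp only: mult.commute)
  qed
  then show "AE t in lebesgue_on {a..b}. norm (h t * max (t - x) 0) \<le> norm (B * h t)"
    by (intro AE_I2) auto
qed

text \<open>The difference quotients of \<open>max (t - x) 0\<close> in \<open>x\<close> are bounded by \<open>1\<close> and converge except at \<open>t = x\<close>, so
dominated convergence differentiates under the integral although \<open>h\<close> is merely integrable.\<close>

lemma truncated_moment_deriv:
  fixes h :: "real \<Rightarrow> real"
  assumes h: "integrable (lebesgue_on {a..b}) h"
  shows "((\<lambda>x. LINT t|lebesgue_on {a..b}. h t * max (t - x) 0) has_real_derivative
    - (LINT t|lebesgue_on {a..b}. h t * (if x < t then 1 else 0))) (at x)"
  unfolding has_field_derivative_iff tendsto_at_iff_sequentially comp_def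
proof (intro allI impI)
  fix X :: "nat \<Rightarrow> real" assume Xne: "\<forall>i. X i \<in> UNIV - {x}" and X: "X \<longlonglongrightarrow> x"
  let ?q = "\<lambda>n t. (max (t - X n) 0 - max (t - x) 0) / (X n - x)"
  have ne: "X n - x \<noteq> 0" for n using Xne by auto
  have eq: "((LINT t|lebesgue_on {a..b}. h t * max (t - X n) 0) - (LINT t|lebesgue_on {a..b}. h t * max (t - x) 0)) / (X n - x)
     = (LINT t|lebesgue_on {a..b}. h t * ?q n t)" for n
  proof -
    have "(LINT t|lebesgue_on {a..b}. h t * ?q n t) =
        (LINT t|lebesgue_on {a..b}. (h t * max (t - X n) 0 - h t * max (t - x) 0) / (X n - x))"
      by (intro Bochner_Integration.integral_cong) (auto simp: right_diff_distrib)
    also have "\<dots> = (LINT t|lebesgue_on {a..b}. h t * max (t - X n) 0 - h t * max (t - x) 0) / (X n - x)"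
      by (rule integral_divide_zero)
    also have "(LINT t|lebesgue_on {a..b}. h t * max (t - X n) 0 - h t * max (t - x) 0) =
        (LINT t|lebesgue_on {a..b}. h t * max (t - X n) 0) - (LINT t|lebesgue_on {a..b}. h t * max (t - x) 0)"
      by (intro Bochner_Integration.integral_diff truncated_moment_integrable h)
    finally show ?thesis ..
  qed
  have "(\<lambda>n. LINT t|lebesgue_on {a..b}. h t * ?q n t) \<longlonglongrightarrow> (LINT t|lebesgue_on {a..b}. - (h t * (if x < t then 1 else 0)))"
  proof (rule integral_dominated_convergence)
    show "integrable (lebesgue_on {a..b}) (\<lambda>t. \<bar>h t\<bar>)" using h by simp
    show "(\<lambda>t. - (h t * (if x < t then 1 else 0))) \<in> borel_measurable (lebesgue_on {a..b})"
      by (intro borel_measurable_uminus borel_measurable_times borel_measurable_integrable[OF h] borel_measurable_lebesgue_on) measurable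
    show "(\<lambda>t. h t * ?q n t) \<in> borel_measurable (lebesgue_on {a..b})" for n
      by (intro borel_measurable_times borel_measurable_integrable[OF h] borel_measurable_lebesgue_on) measurable
    have "(\<lambda>n. h t * ?q n t) \<longlonglongrightarrow> - (h t * (if x < t then 1 else 0))" if "t \<noteq> x" for t
    proof (rule tendsto_eventually)
      show "\<forall>\<^sub>F n in sequentially. h t * ?q n t = - (h t * (if x < t then 1 else 0))"
      proof (cases "x < t")
        case True
        have q: "h t * ?q n t = - (h t * (if x < t then 1 else 0))" if "X n < t" for n
        proof -
          have "?q n t = - (X n - x) / (X n - x)" using that True by (simp add: max.absorb1)
          then show ?thesis using True ne[of n] by (simp del: minus_diff_eq)
        qed
        from order_tendstoD(2)[OF X True] show ?thesis by (rule eventually_mono) (rule q)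
      next
        case False
        then have "t < x" using that by simp
        from order_tendstoD(1)[OF X this] show ?thesis by (rule eventually_mono) (use False in \<open>auto simp: max.absorb2\<close>)
      qed
    qed
    note lim = this
    have aene: "AE t in lebesgue_on {a..b}. t \<noteq> x" by (rule AE_neq_point) simp
    show "AE t in lebesgue_on {a..b}. (\<lambda>n. h t * ?q n t) \<longlonglongrightarrow> - (h t * (if x < t then 1 else 0))"
      using aene by (rule eventually_mono) (rule lim)
    have "\<bar>?q n t\<bar> \<le> 1" for n t
    proof -
      have "\<bar>max (t - X n) 0 - max (t - x) 0\<bar> \<le> \<bar>X n - x\<bar>" by (auto simp: max_def)
      then show ?thesis using ne[of n] by (simp add: field_simps)
    qed
    then show "AE t in lebesgue_on {a..b}. norm (h t * ?q n t) \<le> \<bar>h t\<bar>" for n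
      unfolding real_norm_def abs_mult by (intro AE_I2 mult_left_le) auto
  qed
  then show "(\<lambda>n. ((LINT t|lebesgue_on {a..b}. h t * max (t - X n) 0) - (LINT t|lebesgue_on {a..b}. h t * max (t - x) 0)) / (X n - x)) \<longlonglongrightarrow>
    - (LINT t|lebesgue_on {a..b}. h t * (if x < t then 1 else 0))"
    unfolding eq by simp
qed

text \<open>Solved for the middle value, the hat formula displays \<open>f\<close> near \<open>x\<close> as an affine function plus the
truncated moment of \<open>h\<close>, and the latter is continuously differentiable.\<close>

lemma second_weak_deriv_imp_C1:
  assumes f: "continuous_on Om f" and fg: "has_weak_deriv f g" and gh: "has_weak_deriv g h" and x: "x \<in> Om"
  shows "(f has_real_derivative deriv f x) (at x)" "isCont (deriv f) x"
proof -
  obtain T S \<eta> where st: "smooth_step T S \<eta>"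
    by (rule smooth_step_exists)
  define a where "a = (x - 1) / 2"
  define b where "b = (x + 1) / 2"
  define r where "r = (1 - b) / 2"
  have ab: "-1 < a" "a < x" "x < b" "b + r < 1" "0 < r" using x by (auto simp: a_def b_def r_def field_simps)
  have hi: "integrable (lebesgue_on {a..b+r}) h"
    using gh ab by (intro locally_integrable_Icc) (auto simp: has_weak_deriv_def)
  define M where "M y = (LINT t|lebesgue_on {a..b+r}. h t * max (t - y) 0)" for y
  define N where "N y = (LINT t|lebesgue_on {a..b+r}. h t * (if y < t then 1 else 0))" for y
  define A where "A = (f a - M a) / (b - a)"
  define B where "B = (f b - M b) / (b - a)"
  have eq: "f y = A * (b - y) + B * (y - a) + M y" if y: "a < y" "y < b" for y
  proof -
    define \<alpha> where "\<alpha> = (b - y) / (b - a)"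
    define \<beta> where "\<beta> = (y - a) / (b - a)"
    have \<alpha>\<beta>: "\<alpha> + \<beta> = 1" "\<alpha> * a + \<beta> * b = y"
    proof -
      have ba: "b - a \<noteq> 0" using ab by simp
      have "\<alpha> + \<beta> = (b - a) / (b - a)" by (simp add: \<alpha>_def \<beta>_def add_divide_distrib[symmetric])
      then show "\<alpha> + \<beta> = 1" using ba by simp
      have "\<alpha> * a + \<beta> * b = y * (b - a) / (b - a)"
        by (simp add: \<alpha>_def \<beta>_def add_divide_distrib[symmetric] algebra_simps)
      then show "\<alpha> * a + \<beta> * b = y" using ba by simp
    qed
    have "\<alpha> * f a - f y + \<beta> * f b =
      (LINT t|lebesgue_on {a..b+r}. h t * (\<alpha> * max (t - a) 0 - max (t - y) 0 + \<beta> * max (t - b) 0))"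
      by (rule smooth_step.hat_formula[OF st f fg gh]) (use ab y \<alpha>\<beta> in auto)
    also have "\<dots> = (LINT t|lebesgue_on {a..b+r}. \<alpha> * (h t * max (t - a) 0) - h t * max (t - y) 0 + \<beta> * (h t * max (t - b) 0))"
      by (intro Bochner_Integration.integral_cong) (auto simp: algebra_simps)
    also have "\<dots> = \<alpha> * M a - M y + \<beta> * M b"
      using truncated_moment_integrable[OF hi] by (simp add: M_def)
    finally have "f y = \<alpha> * (f a - M a) + \<beta> * (f b - M b) + M y" by (simp add: algebra_simps)
    then show ?thesis by (simp add: A_def B_def \<alpha>_def \<beta>_def mult.commute)
  qed
  have d: "(f has_real_derivative B - A - N y) (at y)" if y: "a < y" "y < b" for y
  proof -
    have "(M has_real_derivative - N y) (at y)"
      using truncated_moment_deriv[OF hi] by (simp add: M_def[abs_def] N_def)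
    then have "((\<lambda>y. A * (b - y) + B * (y - a) + M y) has_real_derivative B - A - N y) (at y)"
      by (auto intro!: derivative_eq_intros)
    moreover have "\<forall>\<^sub>F y in nhds y. A * (b - y) + B * (y - a) + M y = f y"
      using eventually_nhds_in_open[of "{a<..<b}" y] y by (auto elim!: eventually_mono simp: eq)
    ultimately show ?thesis by (subst (asm) DERIV_cong_ev[OF refl _ refl])
  qed
  then have df: "deriv f y = B - A - N y" if "a < y" "y < b" for y
    using that by (intro DERIV_imp_deriv) auto
  show "(f has_real_derivative deriv f x) (at x)" using d[of x] df[of x] ab by simp
  have "isCont N x" using tail_integral_isCont[OF hi] by (simp add: N_def[abs_def])
  then have "isCont (\<lambda>y. B - A - N y) x" by (intro continuous_intros)
  moreover have "\<forall>\<^sub>F y in nhds x. B - A - N y = deriv f y"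
    using eventually_nhds_in_open[of "{a<..<b}" x] ab by (auto elim!: eventually_mono simp: df)
  ultimately show "isCont (deriv f) x" by (subst (asm) isCont_cong)
qed

text \<open>The support is compact, so it keeps a positive distance from \<open>-1\<close> and \<open>1\<close>. This is what makes the
products with locally integrable functions integrable over \<open>Om\<close>.\<close>

lemma test_function_support:
  assumes "test_function \<phi>"
  obtains a b where "-1 < a" "a \<le> b" "b < 1" "\<And>x. x \<notin> {a..b} \<Longrightarrow> \<phi> x = 0"
proof (cases "{x. \<phi> x \<noteq> 0} = {}")
  case True
  then show ?thesis using that[of 0 0] by force
next
  case False
  define K where "K = closure {x. \<phi> x \<noteq> 0}"
  have sub: "K \<subseteq> Om" using assms by (simp add: test_function_def K_def)
  have "bounded K" using sub bounded_subset bounded_Ioo by blast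
  then have K: "compact K" "K \<noteq> {}" using False by (auto simp: K_def compact_eq_bounded_closed)
  obtain a where a: "a \<in> K" "\<And>x. x \<in> K \<Longrightarrow> a \<le> x" using compact_attains_inf[OF K] by blast
  obtain b where b: "b \<in> K" "\<And>x. x \<in> K \<Longrightarrow> x \<le> b" using compact_attains_sup[OF K] by blast
  have z: "\<phi> x = 0" if "x \<notin> {a..b}" for x
  proof (rule ccontr)
    assume "\<phi> x \<noteq> 0"
    then have "x \<in> K" unfolding K_def by (intro closure_subset[THEN subsetD]) simp
    then show False using that a(2) b(2) by (meson atLeastAtMost_iff)
  qed
  have "-1 < a" "b < 1" "a \<le> b" using a b sub by (auto simp: subset_iff)
  then show ?thesis using that z by blast
qed

lemma test_function_integrable:
  assumes f: "locally_integrable f" and \<phi>: "test_function \<phi>"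
  shows "integrable (lebesgue_on Om) (\<lambda>x. f x * \<phi> x)" "integrable (lebesgue_on Om) (\<lambda>x. f x * deriv \<phi> x)"
proof -
  obtain a b where ab: "-1 < a" "b < 1" and z: "\<And>x. x \<notin> {a..b} \<Longrightarrow> \<phi> x = 0"
    using test_function_support[OF \<phi>] by metis
  have sm: "smooth \<phi>" using \<phi> by (simp add: test_function_def smooth_def)
  show "integrable (lebesgue_on Om) (\<lambda>x. f x * \<phi> x)"
    by (rule locally_integrable_mult(2)[OF f smooth_continuous[OF sm] z ab])
  have z': "deriv \<phi> x = 0" if x: "x \<notin> {a..b}" for x
  proof -
    have "\<forall>\<^sub>F y in nhds x. y \<in> - {a..b}"
      using x by (intro eventually_nhds_in_open open_Compl closed_atLeastAtMost) auto
    then have "\<forall>\<^sub>F y in nhds x. 0 = \<phi> y" by (rule eventually_mono) (use z in auto)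
    then have "(\<phi> has_real_derivative 0) (at x)"
      using DERIV_cong_ev[OF refl, of "\<lambda>_. 0" \<phi> x 0 0] by simp
    then show ?thesis by (rule DERIV_imp_deriv)
  qed
  show "integrable (lebesgue_on Om) (\<lambda>x. f x * deriv \<phi> x)"
    by (rule locally_integrable_mult(2)[OF f smooth_continuous[OF smooth_deriv[OF sm]] z' ab])
qed

lemma has_weak_deriv_linear:
  assumes f: "has_weak_deriv f f'" and g: "has_weak_deriv g g'"
  shows "has_weak_deriv (\<lambda>x. a * f x + b * g x) (\<lambda>x. a * f' x + b * g' x)"
proof -
  have li: "locally_integrable f" "locally_integrable f'" "locally_integrable g" "locally_integrable g'"
    using f g by (auto simp: has_weak_deriv_def)
  have "(LINT x|lebesgue_on Om. (a * f x + b * g x) * deriv \<phi> x) = - (LINT x|lebesgue_on Om. (a * f' x + b * g' x) * \<phi> x)"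
    if \<phi>: "test_function \<phi>" for \<phi>
  proof -
    note i = test_function_integrable[OF _ \<phi>]
    have "(LINT x|lebesgue_on Om. (a * f x + b * g x) * deriv \<phi> x) =
        (LINT x|lebesgue_on Om. a * (f x * deriv \<phi> x) + b * (g x * deriv \<phi> x))"
      by (simp add: algebra_simps)
    also have "\<dots> = a * (LINT x|lebesgue_on Om. f x * deriv \<phi> x) + b * (LINT x|lebesgue_on Om. g x * deriv \<phi> x)"
      using i(2)[OF li(1)] i(2)[OF li(3)] by simp
    also have "\<dots> = - (a * (LINT x|lebesgue_on Om. f' x * \<phi> x) + b * (LINT x|lebesgue_on Om. g' x * \<phi> x))"
      using f g \<phi> by (simp add: has_weak_deriv_def)
    also have "a * (LINT x|lebesgue_on Om. f' x * \<phi> x) + b * (LINT x|lebesgue_on Om. g' x * \<phi> x) =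
        (LINT x|lebesgue_on Om. a * (f' x * \<phi> x) + b * (g' x * \<phi> x))"
      using i(1)[OF li(2)] i(1)[OF li(4)] by simp
    also have "\<dots> = (LINT x|lebesgue_on Om. (a * f' x + b * g' x) * \<phi> x)"
      by (simp add: algebra_simps)
    finally show ?thesis .
  qed
  moreover have "locally_integrable (\<lambda>x. a * f x + b * g x)" "locally_integrable (\<lambda>x. a * f' x + b * g' x)"
    using li by (auto simp: locally_integrable_def)
  ultimately show ?thesis by (simp add: has_weak_deriv_def)
qed

text \<open>The difference \<open>g - h\<close> is a weak derivative of \<open>0\<close>, so its integrals over subintervals are the
increments of \<open>0\<close>.\<close>

lemma weak_deriv_unique:
  assumes g: "has_weak_deriv f g" and h: "has_weak_deriv f h"
  shows "AE x in lebesgue_on Om. g x = h x"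
proof -
  have z: "has_weak_deriv (\<lambda>_. 0) (\<lambda>x. g x - h x)"
    using has_weak_deriv_linear[OF g h, of 1 "-1"] by simp
  have li: "locally_integrable g" "locally_integrable h" using g h by (auto simp: has_weak_deriv_def)
  show ?thesis
  proof (rule AE_equal_if_equal_integrals[OF li])
    fix a b :: real assume ab: "-1 < a" "a < b" "b < 1"
    have "(LINT x|lebesgue_on {a..b}. g x - h x) = 0"
      using weak_deriv_increment[OF z _ _ ab, of "\<lambda>_. 0"] by simp
    then show "(LINT x|lebesgue_on {a..b}. g x) = (LINT x|lebesgue_on {a..b}. h x)"
      using locally_integrable_Icc[OF li(1) ab(1,3)] locally_integrable_Icc[OF li(2) ab(1,3)] by simp
  qed
qed

text \<open>Needed for second derivatives of sums: \<open>wderiv\<close> of a sum is some representative of the sum of the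
weak derivatives, and has to inherit the weak derivative of that sum.\<close>

lemma has_weak_deriv_cong:
  assumes w: "has_weak_deriv f g" and f': "locally_integrable f'" and ae: "AE x in lebesgue_on Om. f x = f' x"
  shows "has_weak_deriv f' g"
proof -
  have f: "locally_integrable f" using w by (simp add: has_weak_deriv_def)
  have "(LINT x|lebesgue_on Om. f' x * deriv \<phi> x) = (LINT x|lebesgue_on Om. f x * deriv \<phi> x)"
    if \<phi>: "test_function \<phi>" for \<phi>
    using ae borel_measurable_integrable[OF test_function_integrable(2)[OF f \<phi>]]
      borel_measurable_integrable[OF test_function_integrable(2)[OF f' \<phi>]]
    by (intro integral_cong_AE) (auto elim!: eventually_mono)
  then show ?thesis using w f' by (simp add: has_weak_deriv_def)
qed

lemma has_weak_deriv_wderiv: "weakly_differentiable f \<Longrightarrow> has_weak_deriv f (wderiv f)"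
  unfolding weakly_differentiable_def wderiv_def by (erule someI_ex)

lemma has_weak_deriv_imp_wderiv:
  assumes "has_weak_deriv f g"
  shows "weakly_differentiable f" "AE x in lebesgue_on Om. wderiv f x = g x"
proof -
  show w: "weakly_differentiable f" using assms by (auto simp: weakly_differentiable_def)
  show "AE x in lebesgue_on Om. wderiv f x = g x"
    by (rule weak_deriv_unique[OF has_weak_deriv_wderiv[OF w] assms])
qed

section \<open>Sobolev functions are continuously differentiable\<close>

text \<open>A crude substitute for Minkowski's inequality, sufficient to see that the \<open>L\<^sub>q\<close> functions form a vector
space.\<close>

lemma powr_abs_combination_le:
  fixes x y a b q :: real
  assumes "0 < q"
  shows "\<bar>a * x + b * y\<bar> powr q \<le> 2 powr q * (\<bar>a\<bar> powr q * \<bar>x\<bar> powr q + \<bar>b\<bar> powr q * \<bar>y\<bar> powr q)"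
proof -
  define m where "m = max \<bar>a * x\<bar> \<bar>b * y\<bar>"
  have "\<bar>a * x + b * y\<bar> \<le> 2 * m" by (auto simp: m_def)
  then have "\<bar>a * x + b * y\<bar> powr q \<le> (2 * m) powr q"
    using assms by (intro powr_mono2) auto
  also have "\<dots> = 2 powr q * m powr q" by (simp add: powr_mult m_def)
  also have "m powr q \<le> \<bar>a * x\<bar> powr q + \<bar>b * y\<bar> powr q" by (auto simp: m_def max_def)
  finally show ?thesis by (simp add: abs_mult powr_mult mult_left_mono)
qed

lemma Lq_linear:
  assumes q: "0 < q" and f: "f \<in> Lq q" and g: "g \<in> Lq q"
  shows "(\<lambda>x. a * f x + b * g x) \<in> Lq q"
proof -
  have m: "f \<in> borel_measurable (lebesgue_on Om)" "g \<in> borel_measurable (lebesgue_on Om)"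
    and i: "integrable (lebesgue_on Om) (\<lambda>x. \<bar>f x\<bar> powr q)" "integrable (lebesgue_on Om) (\<lambda>x. \<bar>g x\<bar> powr q)"
    using f g by (auto simp: Lq_def)
  have m': "(\<lambda>x. a * f x + b * g x) \<in> borel_measurable (lebesgue_on Om)"
    using m by (intro borel_measurable_add borel_measurable_times) auto
  have "integrable (lebesgue_on Om) (\<lambda>x. \<bar>a * f x + b * g x\<bar> powr q)"
  proof (rule Bochner_Integration.integrable_bound)
    show "integrable (lebesgue_on Om) (\<lambda>x. 2 powr q * (\<bar>a\<bar> powr q * \<bar>f x\<bar> powr q + \<bar>b\<bar> powr q * \<bar>g x\<bar> powr q))"
      using i by (intro integrable_mult_right Bochner_Integration.integrable_add) auto
    show "(\<lambda>x. \<bar>a * f x + b * g x\<bar> powr q) \<in> borel_measurable (lebesgue_on Om)"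
      using m' by measurable
    show "AE x in lebesgue_on Om. norm (\<bar>a * f x + b * g x\<bar> powr q)
        \<le> norm (2 powr q * (\<bar>a\<bar> powr q * \<bar>f x\<bar> powr q + \<bar>b\<bar> powr q * \<bar>g x\<bar> powr q))"
      using powr_abs_combination_le[OF q]
      by (intro AE_I2) (simp add: abs_mult)
  qed
  with m' show ?thesis by (simp add: Lq_def)
qed

lemma Lq_cong_AE:
  assumes f: "f \<in> Lq q" and ae: "AE x in lebesgue_on Om. f x = g x"
  shows "g \<in> Lq q"
proof -
  let ?e = "\<lambda>f x. if x \<in> Om then f x else (0::real)"
  have fm: "f \<in> borel_measurable (lebesgue_on Om)" using f by (simp add: Lq_def)
  have "?e f \<in> borel_measurable lebesgue"
    by (rule borel_measurable_if_I[OF fm]) simp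
  moreover have "AE x in lebesgue. ?e f x = ?e g x"
    using ae by (subst (asm) AE_restrict_space_iff) (auto elim!: eventually_mono)
  ultimately have "?e g \<in> borel_measurable lebesgue" by (rule borel_measurable_AE)
  then have gm: "g \<in> borel_measurable (lebesgue_on Om)" by (rule borel_measurable_if_D)
  have "integrable (lebesgue_on Om) (\<lambda>x. \<bar>f x\<bar> powr q)" using f by (simp add: Lq_def)
  moreover have "(\<lambda>x. \<bar>f x\<bar> powr q) \<in> borel_measurable (lebesgue_on Om)" "(\<lambda>x. \<bar>g x\<bar> powr q) \<in> borel_measurable (lebesgue_on Om)"
    using fm gm by measurable
  moreover have "AE x in lebesgue_on Om. \<bar>f x\<bar> powr q = \<bar>g x\<bar> powr q"
    using ae by (auto elim!: eventually_mono)
  ultimately have "integrable (lebesgue_on Om) (\<lambda>x. \<bar>g x\<bar> powr q)"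
    using integrable_cong_AE by blast
  with gm show ?thesis by (simp add: Lq_def)
qed

lemma Om_measure: "integrable (lebesgue_on Om) (\<lambda>_. c::real)" "(LINT x|lebesgue_on Om. (c::real)) = 2 * c"
proof -
  show "integrable (lebesgue_on Om) (\<lambda>_. c::real)"
    by (rule integrable_lebesgue_on_subset[OF continuous_imp_integrable_real[of "-1" 1 "\<lambda>_. c"]]) auto
qed (simp add: measure_restrict_space)

text \<open>Splitting at height \<open>N\<close> gives \<open>\<bar>f\<bar> \<le> N + N powr (1 - q) * \<bar>f\<bar> powr q\<close> pointwise. The constant \<open>3\<close> is
the length \<open>2\<close> of \<open>Om\<close> from the first term and \<open>1\<close> from the second.\<close>

lemma L1_bound_by_Lq:
  assumes q: "1 \<le> q" and f: "f \<in> Lq q" and N: "0 < N" "(LINT x|lebesgue_on Om. \<bar>f x\<bar> powr q) \<le> N powr q"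
  shows "integrable (lebesgue_on Om) f" "(LINT x|lebesgue_on Om. \<bar>f x\<bar>) \<le> 3 * N"
proof -
  have i: "integrable (lebesgue_on Om) (\<lambda>x. \<bar>f x\<bar> powr q)" and m: "f \<in> borel_measurable (lebesgue_on Om)"
    using f by (auto simp: Lq_def)
  have b: "\<bar>f x\<bar> \<le> N + N powr (1 - q) * \<bar>f x\<bar> powr q" for x
  proof (cases "\<bar>f x\<bar> \<le> N")
    case False
    then have "\<bar>f x\<bar> = \<bar>f x\<bar> powr (1 - q) * \<bar>f x\<bar> powr q"
      using N by (simp add: powr_add[symmetric])
    also have "\<dots> \<le> N powr (1 - q) * \<bar>f x\<bar> powr q"
      using False N q by (intro mult_right_mono powr_mono2') auto
    finally show ?thesis using N by simp
  qed (simp add: add_increasing2)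
  have i2: "integrable (lebesgue_on Om) (\<lambda>x. N + N powr (1 - q) * \<bar>f x\<bar> powr q)"
    using i Om_measure(1) by (intro Bochner_Integration.integrable_add integrable_mult_right) auto
  show fi: "integrable (lebesgue_on Om) f"
    by (rule Bochner_Integration.integrable_bound[OF i2 m]) (use b N in \<open>auto intro!: AE_I2 order_trans[OF b]\<close>)
  have "(LINT x|lebesgue_on Om. \<bar>f x\<bar>) \<le> (LINT x|lebesgue_on Om. N + N powr (1 - q) * \<bar>f x\<bar> powr q)"
    using fi i2 b by (intro integral_mono) auto
  also have "\<dots> = 2 * N + N powr (1 - q) * (LINT x|lebesgue_on Om. \<bar>f x\<bar> powr q)"
    using i Om_measure by (subst Bochner_Integration.integral_add) auto
  also have "\<dots> \<le> 2 * N + N powr (1 - q) * N powr q"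
    using N by (intro add_left_mono mult_left_mono) auto
  also have "N powr (1 - q) * N powr q = N" using N by (simp add: powr_add[symmetric])
  finally show "(LINT x|lebesgue_on Om. \<bar>f x\<bar>) \<le> 3 * N" by simp
qed

lemma W2q_second_deriv_L1:
  assumes q: "1 \<le> q" and f: "f \<in> W2q q"
  shows "integrable (lebesgue_on Om) (wderiv (wderiv f))"
    "(LINT x|lebesgue_on Om. \<bar>wderiv (wderiv f) x\<bar>) \<le> 3 * W2q_norm q f"
proof -
  let ?h = "wderiv (wderiv f)"
  have h: "?h \<in> Lq q" using f by (simp add: W2q_def)
  have b: "integrable (lebesgue_on Om) ?h \<and> (LINT x|lebesgue_on Om. \<bar>?h x\<bar>) \<le> 3 * N" if "W2q_norm q f \<le> N" "0 < N" for N
  proof -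
    let ?A = "LINT x|lebesgue_on Om. \<bar>f x\<bar> powr q" and ?B = "LINT x|lebesgue_on Om. \<bar>wderiv f x\<bar> powr q"
      and ?C = "LINT x|lebesgue_on Om. \<bar>?h x\<bar> powr q"
    have nn: "0 \<le> ?A" "0 \<le> ?B" "0 \<le> ?C" by (auto intro!: integral_nonneg_AE)
    then have "?C \<le> ?A + ?B + ?C" by simp
    also have "\<dots> = W2q_norm q f powr q" using q nn by (simp add: W2q_norm_def powr_powr)
    also have "\<dots> \<le> N powr q" using that q by (intro powr_mono2) (auto simp: W2q_norm_def)
    finally show ?thesis using L1_bound_by_Lq[OF q h] that by blast
  qed
  have n0: "0 \<le> W2q_norm q f" by (simp add: W2q_norm_def)
  show "integrable (lebesgue_on Om) ?h" using b[of "W2q_norm q f + 1"] n0 by simp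
  show "(LINT x|lebesgue_on Om. \<bar>?h x\<bar>) \<le> 3 * W2q_norm q f"
  proof (rule field_le_epsilon)
    fix e :: real assume "0 < e"
    then show "(LINT x|lebesgue_on Om. \<bar>?h x\<bar>) \<le> 3 * W2q_norm q f + e"
      using b[of "W2q_norm q f + e / 3"] n0 by simp
  qed
qed

lemma W2q_weak_derivs:
  assumes "f \<in> W2q q"
  shows "has_weak_deriv f (wderiv f)" "has_weak_deriv (wderiv f) (wderiv (wderiv f))"
  using assms by (auto simp: W2q_def intro: has_weak_deriv_wderiv)

lemma W2q_linear:
  assumes q: "0 < q" and f: "f \<in> W2q q" and g: "g \<in> W2q q"
  shows "(\<lambda>x. a * f x + b * g x) \<in> W2q q"
proof -
  define k where "k = (\<lambda>x. a * f x + b * g x)"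
  define s where "s = (\<lambda>x. a * wderiv f x + b * wderiv g x)"
  define s2 where "s2 = (\<lambda>x. a * wderiv (wderiv f) x + b * wderiv (wderiv g) x)"
  have 1: "has_weak_deriv k s" unfolding k_def s_def
    by (intro has_weak_deriv_linear W2q_weak_derivs[OF f] W2q_weak_derivs[OF g])
  have 2: "has_weak_deriv s s2" unfolding s_def s2_def
    by (intro has_weak_deriv_linear W2q_weak_derivs[OF f] W2q_weak_derivs[OF g])
  note k = has_weak_deriv_imp_wderiv[OF 1]
  have sk: "AE x in lebesgue_on Om. s x = wderiv k x" using k(2) by (auto elim!: eventually_mono)
  have "locally_integrable (wderiv k)" using has_weak_deriv_wderiv[OF k(1)] by (simp add: has_weak_deriv_def)
  then have "has_weak_deriv (wderiv k) s2" by (intro has_weak_deriv_cong[OF 2 _ sk])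
  note k2 = has_weak_deriv_imp_wderiv[OF this]
  have sk2: "AE x in lebesgue_on Om. s2 x = wderiv (wderiv k) x" using k2(2) by (auto elim!: eventually_mono)
  have "k \<in> Lq q" "s \<in> Lq q" "s2 \<in> Lq q" unfolding k_def s_def s2_def
    using f g by (auto simp: W2q_def intro!: Lq_linear[OF q])
  then have "k \<in> Lq q" "wderiv k \<in> Lq q" "wderiv (wderiv k) \<in> Lq q"
    using Lq_cong_AE sk sk2 by blast+
  moreover have "continuous_on {-1..1} k" unfolding k_def using f g by (auto simp: W2q_def intro!: continuous_intros)
  ultimately have "k \<in> W2q q" using k(1) k2(1) by (simp add: W2q_def)
  then show ?thesis by (simp add: k_def)
qed

lemma W2qD_linear:
  "0 < q \<Longrightarrow> f \<in> W2qD q \<Longrightarrow> g \<in> W2qD q \<Longrightarrow> (\<lambda>x. a * f x + b * g x) \<in> W2qD q"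
  unfolding W2qD_def using W2q_linear by auto

text \<open>One-sided derivatives at \<open>-1\<close> and \<open>1\<close> are included: the sign of a function near these points is read
off its boundary slope later.\<close>

definition C1_deriv :: "(real \<Rightarrow> real) \<Rightarrow> (real \<Rightarrow> real) \<Rightarrow> bool" where
  "C1_deriv f p \<longleftrightarrow> continuous_on {-1..1} p \<and>
     (\<forall>x\<in>{-1..1}. (f has_real_derivative p x) (at x within {-1..1}))"

lemma C1_deriv_interior:
  "C1_deriv f p \<Longrightarrow> x \<in> Om \<Longrightarrow> (f has_real_derivative p x) (at x)"
  unfolding C1_deriv_def by (metis at_within_Icc_at greaterThanLessThan_iff atLeastAtMost_iff less_imp_le)

lemma C1_deriv_continuous: "C1_deriv f p \<Longrightarrow> continuous_on {-1..1} f"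
  unfolding C1_deriv_def by (meson DERIV_continuous continuous_on_eq_continuous_within)

lemma C1_deriv_unique:
  assumes "C1_deriv f p" "C1_deriv f p'" "x \<in> {-1..1}"
  shows "p x = p' x"
proof -
  have "at x within {-1..1} \<noteq> bot"
    using assms(3) by (simp add: trivial_limit_within islimpt_Icc)
  then show ?thesis
    using assms unfolding C1_deriv_def has_real_derivative_iff_has_vector_derivative
    by (metis vector_derivative_unique_within)
qed

lemma C1_deriv_linear:
  "C1_deriv f p \<Longrightarrow> C1_deriv g r \<Longrightarrow> C1_deriv (\<lambda>x. a * f x + b * g x) (\<lambda>x. a * p x + b * r x)"
  unfolding C1_deriv_def by (auto intro!: continuous_intros derivative_eq_intros)

lemma C1_deriv_mirror:
  assumes f: "C1_deriv f f'"
  shows "C1_deriv (\<lambda>x. f (- x)) (\<lambda>x. - f' (- x))"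
  unfolding C1_deriv_def
proof (intro conjI ballI)
  have im: "uminus ` {-1..1::real} = {-1..1}" by simp
  have "continuous_on {-1..1} f'" using f by (simp add: C1_deriv_def)
  then have "continuous_on {-1..1} (\<lambda>x. f' (- x))"
    by (rule continuous_on_compose2) (auto intro!: continuous_intros)
  then show "continuous_on {-1..1} (\<lambda>x. - f' (- x))" by (rule continuous_on_minus)
  fix x :: real assume "x \<in> {-1..1}"
  then have "- x \<in> {-1..1}" by simp
  then have "(f has_real_derivative f' (- x)) (at (- x) within uminus ` {-1..1})"
    using f unfolding C1_deriv_def im by blast
  then have "((\<lambda>x. f (- x)) has_real_derivative f' (- x) * (- 1)) (at x within {-1..1})"
    by (rule DERIV_image_chain[unfolded comp_def]) (auto intro!: derivative_eq_intros)
  then show "((\<lambda>x. f (- x)) has_real_derivative - f' (- x)) (at x within {-1..1})" by simp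
qed

lemma C1_deriv_cong:
  assumes f: "C1_deriv f f'" and eq: "\<And>x. x \<in> {-1..1} \<Longrightarrow> f x = g x"
  shows "C1_deriv g f'"
  unfolding C1_deriv_def
proof (intro conjI ballI)
  show "continuous_on {-1..1} f'" using f by (simp add: C1_deriv_def)
  fix x :: real assume x: "x \<in> {-1..1}"
  then have "(f has_real_derivative f' x) (at x within {-1..1})" using f by (simp add: C1_deriv_def)
  then show "(g has_real_derivative f' x) (at x within {-1..1})"
    by (rule has_field_derivative_transform_within[OF _ zero_less_one x]) (rule eq)
qed

text \<open>Inside the interval \<open>f\<close> is \<open>C\<^sup>1\<close> and \<open>deriv f\<close> has the increments of a primitive of the integrable function
\<open>wderiv (wderiv f)\<close>. The primitive \<open>P\<close> is continuous up to the boundary, and integrating it once more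
shows that it is the derivative of \<open>f\<close> there as well.\<close>

lemma W2q_imp_C1:
  assumes q: "1 \<le> q" and f: "f \<in> W2q q"
  obtains p where "C1_deriv f p" "AE x in lebesgue_on Om. wderiv f x = p x"
    "\<And>x y. x \<in> {-1..1} \<Longrightarrow> y \<in> {-1..1} \<Longrightarrow> \<bar>p x - p y\<bar> \<le> 3 * W2q_norm q f"
proof -
  define g where "g = wderiv f"
  define h where "h = wderiv g"
  have fg: "has_weak_deriv f g" and gh: "has_weak_deriv g h"
    using W2q_weak_derivs[OF f] by (auto simp: g_def h_def)
  have fc: "continuous_on {-1..1} f" using f by (simp add: W2q_def)
  then have fc': "continuous_on Om f" by (rule continuous_on_subset) auto
  have hi: "integrable (lebesgue_on Om) h" and hb: "(LINT x|lebesgue_on Om. \<bar>h x\<bar>) \<le> 3 * W2q_norm q f"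
    using W2q_second_deriv_L1[OF q f] by (auto simp: g_def h_def)
  note d = second_weak_deriv_imp_C1[OF fc' fg gh]
  have dc: "continuous_on Om (deriv f)" using d(2) by (simp add: continuous_at_imp_continuous_on)
  have gl: "locally_integrable g" using fg by (simp add: has_weak_deriv_def)
  have ae: "AE x in lebesgue_on Om. g x = deriv f x"
  proof (rule AE_equal_if_equal_integrals[OF gl continuous_locally_integrable[OF dc]])
    fix a b :: real assume ab: "-1 < a" "a < b" "b < 1"
    have "(LINT x|lebesgue_on {a..b}. g x) = f b - f a"
      by (rule weak_deriv_increment[OF fg _ fc' ab, symmetric]) simp
    also have "\<dots> = integral {a..b} (deriv f)"
    proof (rule integral_unique[symmetric], rule fundamental_theorem_of_calculus)
      show "(f has_vector_derivative deriv f x) (at x within {a..b})" if "x \<in> {a..b}" for x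
        unfolding has_real_derivative_iff_has_vector_derivative[symmetric]
        by (rule has_field_derivative_at_within[OF d(1)]) (use that ab in auto)
    qed (use ab in simp)
    also have "\<dots> = (LINT x|lebesgue_on {a..b}. deriv f x)"
      by (rule lebesgue_integral_eq_integral[symmetric])
         (use ab in \<open>auto intro!: locally_integrable_Icc continuous_locally_integrable dc\<close>)
    finally show "(LINT x|lebesgue_on {a..b}. g x) = (LINT x|lebesgue_on {a..b}. deriv f x)" .
  qed
  have inc: "deriv f b - deriv f a = integral {a..b} h" if ab: "-1 < a" "a < b" "b < 1" for a b
  proof -
    have "integrable (lebesgue_on {a..b}) h"
      by (rule integrable_lebesgue_on_subset[OF hi]) (use ab in auto)
    then show ?thesis
      using weak_deriv_increment[OF gh ae dc ab] by (simp add: lebesgue_integral_eq_integral)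
  qed
  have hI: "h integrable_on {-1..1}" "(\<lambda>x. \<bar>h x\<bar>) integrable_on {-1..1}"
    using integrable_on_lebesgue_on[OF hi] integrable_on_lebesgue_on[OF integrable_abs[OF hi]]
    by (auto simp: integrable_on_open_interval_real)
  define H where "H x = integral {-1..x} h" for x
  define P where "P x = deriv f 0 + (H x - H 0)" for x
  have Hdiff: "H y - H x = integral {x..y} h" if "-1 \<le> x" "x \<le> y" "y \<le> 1" for x y
    using Henstock_Kurzweil_Integration.integral_combine[of "-1" x y h] that integrable_subinterval_real[OF hI(1), of "-1" y]
    by (simp add: H_def)
  have Pd: "P x = deriv f x" if "x \<in> Om" for x
    using inc[of 0 x] inc[of x 0] Hdiff[of 0 x] Hdiff[of x 0] that
    by (cases "x = 0"; cases "0 < x") (auto simp: P_def)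
  have Pc: "continuous_on {-1..1} P"
    unfolding P_def H_def by (intro continuous_intros indefinite_integral_continuous_1 hI)
  have fP: "f x = f (-1) + integral {-1..x} P" if x: "x \<in> {-1..1}" for x
  proof -
    have "(P has_integral f x - f (-1)) {-1..x}"
    proof (rule fundamental_theorem_of_calculus_interior)
      show "continuous_on {-1..x} f" by (rule continuous_on_subset[OF fc]) (use x in auto)
      show "(f has_vector_derivative P y) (at y)" if "y \<in> {-1<..<x}" for y
        using d(1)[of y] Pd[of y] that x by (simp add: has_real_derivative_iff_has_vector_derivative)
    qed (use x in simp)
    then show ?thesis by (simp add: integral_unique)
  qed
  have "(f has_real_derivative P x) (at x within {-1..1})" if x: "x \<in> {-1..1}" for x
  proof -
    have "((\<lambda>y. f (-1) + integral {-1..y} P) has_real_derivative P x) (at x within {-1..1})"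
      using integral_has_real_derivative[OF Pc x] by (auto intro!: derivative_eq_intros)
    then show ?thesis
      by (rule has_field_derivative_transform_within[OF _ zero_less_one x]) (simp add: fP[symmetric])
  qed
  then have C: "C1_deriv f P" using Pc by (simp add: C1_deriv_def)
  have le: "\<bar>P y - P x\<bar> \<le> 3 * W2q_norm q f" if "-1 \<le> x" "x \<le> y" "y \<le> 1" for x y
  proof -
    have "\<bar>P y - P x\<bar> = \<bar>integral {x..y} h\<bar>" using Hdiff[OF that] by (simp add: P_def)
    also have "\<dots> \<le> integral {x..y} (\<lambda>x. \<bar>h x\<bar>)"
      unfolding real_norm_def[symmetric] using that
      by (intro Henstock_Kurzweil_Integration.integral_norm_bound_integral
          integrable_subinterval_real[OF hI(1)] integrable_subinterval_real[OF hI(2)[folded real_norm_def]]) auto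
    also have "\<dots> \<le> integral {-1..1} (\<lambda>x. \<bar>h x\<bar>)"
      using that by (intro integral_subset_le hI integrable_subinterval_real[OF hI(2)]) auto
    also have "\<dots> = integral Om (\<lambda>x. \<bar>h x\<bar>)" by (simp add: integral_open_interval_real)
    also have "\<dots> = (LINT x|lebesgue_on Om. \<bar>h x\<bar>)"
      by (rule lebesgue_integral_eq_integral[symmetric]) (use hi in auto)
    finally show ?thesis using hb by simp
  qed
  show ?thesis
  proof (rule that[OF C])
    show "AE x in lebesgue_on Om. wderiv f x = P x"
      using ae by (rule lebesgue_on_mono) (simp add: g_def Pd)
    show "\<bar>P x - P y\<bar> \<le> 3 * W2q_norm q f" if "x \<in> {-1..1}" "y \<in> {-1..1}" for x y
      using le[of x y] le[of y x] that by (cases "x \<le> y") (auto simp: abs_minus_commute)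
  qed
qed

text \<open>By Rolle's theorem the derivative has a zero, so the bound for its oscillation bounds its size. Thus
convergence in the Sobolev norm implies convergence in \<open>C\<^sup>1\<close>.\<close>

lemma W2qD_C1_bound:
  assumes q: "1 \<le> q" and f: "f \<in> W2qD q" and p: "C1_deriv f p" and x: "x \<in> {-1..1}"
  shows "\<bar>p x\<bar> \<le> 3 * W2q_norm q f"
proof -
  have fW: "f \<in> W2q q" and f0: "f (-1) = f 1" using f by (auto simp: W2qD_def)
  obtain r where r: "C1_deriv f r"
    and b: "\<And>x y. x \<in> {-1..1} \<Longrightarrow> y \<in> {-1..1} \<Longrightarrow> \<bar>r x - r y\<bar> \<le> 3 * W2q_norm q f"
    using W2q_imp_C1[OF q fW] by metis
  have "\<exists>y>-1. y < 1 \<and> (\<lambda>v. r y * v) = (\<lambda>v. 0)"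
    by (rule Rolle_deriv[OF _ f0 C1_deriv_continuous[OF p]])
       (use C1_deriv_interior[OF r] in \<open>auto simp: has_field_derivative_def\<close>)
  then obtain y where y: "y \<in> Om" "r y = 0" by (auto simp: fun_eq_iff)
  then have "\<bar>r x\<bar> \<le> 3 * W2q_norm q f" using b[OF x, of y] by auto
  then show ?thesis using C1_deriv_unique[OF p r x] by simp
qed

section \<open>Analytic curves in the space of continuously differentiable functions\<close>

lemma power_diff_le:
  fixes l l' :: real
  assumes "0 \<le> l'" "l' \<le> l"
  shows "l ^ Suc n - l' ^ Suc n \<le> real (Suc n) * l ^ n * (l - l')"
proof (induction n)
  case (Suc n)
  have "l ^ Suc (Suc n) - l' ^ Suc (Suc n) = l * (l ^ Suc n - l' ^ Suc n) + l' ^ Suc n * (l - l')"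
    by (simp add: algebra_simps)
  also have "\<dots> \<le> l * (real (Suc n) * l ^ n * (l - l')) + l ^ Suc n * (l - l')"
    using assms by (intro add_mono mult_left_mono[OF Suc] mult_right_mono power_mono) auto
  also have "\<dots> = real (Suc (Suc n)) * l ^ Suc n * (l - l')" by (simp add: algebra_simps)
  finally show ?case .
qed simp

text \<open>The terms of order two and higher contribute at most
\<open>(M / R\<^sup>2) * l * (l - l') * (\<Sum>k. (k + 2) / 2 ^ k)\<close>, and \<open>k + 2 \<le> 2 (k + 1)\<close> together with
\<open>(\<Sum>k. (k + 1) / 2 ^ k) = 4\<close> gives the constant \<open>8\<close>.\<close>

lemma power_series_increment:
  fixes c :: "nat \<Rightarrow> real"
  assumes R: "0 < R" and c: "\<And>k. \<bar>c k\<bar> * R ^ k \<le> M" and l: "0 \<le> l'" "l' \<le> l" "l \<le> R / 2"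
    and s: "(\<lambda>k. l ^ k * c k) sums s" and s': "(\<lambda>k. l' ^ k * c k) sums s'"
  shows "\<bar>s - s' - (l - l') * c 1\<bar> \<le> 8 * M / R\<^sup>2 * l * (l - l')"
proof -
  let ?d = "\<lambda>k. (l ^ (k + 2) - l' ^ (k + 2)) * c (k + 2)"
  let ?b = "\<lambda>k. 2 * M / R\<^sup>2 * l * (l - l') * (real (Suc k) * (1/2) ^ k)"
  have "(\<lambda>k. (l ^ k - l' ^ k) * c k) sums (s - s')"
    using sums_diff[OF s s'] by (simp add: left_diff_distrib)
  then have d: "?d sums (s - s' - (l - l') * c 1)"
    using sums_iff_shift[of "\<lambda>k. (l ^ k - l' ^ k) * c k" 2 "s - s' - (l - l') * c 1"]
    by (simp add: numeral_2_eq_2)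
  have "(\<lambda>k. real (Suc k) * (1/2) ^ k) sums 4"
    using geometric_deriv_sums[of "1/2 :: real"] by (simp add: power2_eq_square)
  then have b: "?b sums (2 * M / R\<^sup>2 * l * (l - l') * 4)" by (rule sums_mult)
  have le: "\<bar>?d k\<bar> \<le> ?b k" for k
  proof -
    have "\<bar>c (k + 2)\<bar> * R ^ (k + 2) \<le> M" by (rule c)
    then have cb: "\<bar>c (k + 2)\<bar> \<le> M / R ^ (k + 2)" using R by (simp add: field_simps)
    have M: "0 \<le> M" using c[of 0] abs_ge_zero[of "c 0"] by simp
    have mono: "l' ^ (k + 2) \<le> l ^ (k + 2)" using l by (intro power_mono) auto
    have "l ^ (k + 2) - l' ^ (k + 2) \<le> real (k + 2) * l ^ (k + 1) * (l - l')"
      using power_diff_le[OF l(1,2), of "k + 1"] by simp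
    also have "\<dots> = real (k + 2) * l ^ k * (l * (l - l'))" by simp
    also have "\<dots> \<le> (2 * real (Suc k)) * (R / 2) ^ k * (l * (l - l'))"
      using l R by (intro mult_right_mono mult_mono power_mono) auto
    finally have "\<bar>?d k\<bar> \<le> ((2 * real (Suc k)) * (R / 2) ^ k * (l * (l - l'))) * (M / R ^ (k + 2))"
      unfolding abs_mult using cb mono l R M by (intro mult_mono) auto
    also have "\<dots> = ?b k" using R by (simp add: field_simps power_add power2_eq_square)
    finally show ?thesis .
  qed
  have sb: "summable ?b" using b by (rule sums_summable)
  have "\<bar>suminf ?d\<bar> \<le> suminf ?b"
    using norm_suminf_le[OF _ sb, of ?d] le by auto
  then have "\<bar>s - s' - (l - l') * c 1\<bar> \<le> 2 * M / R\<^sup>2 * l * (l - l') * 4"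
    unfolding sums_unique[OF d, symmetric] sums_unique[OF b, symmetric] .
  also have "\<dots> = 8 * M / R\<^sup>2 * l * (l - l')" by simp
  finally show ?thesis .
qed

lemma C1_deriv_mean_value:
  assumes p: "C1_deriv f p" and f: "f (-1) = 0" and B: "\<And>x. x \<in> {-1..1} \<Longrightarrow> \<bar>p x\<bar> \<le> B" and x: "x \<in> {-1..1}"
  shows "\<bar>f x\<bar> \<le> 2 * B"
proof -
  have B0: "0 \<le> B" using B[of 0] by simp
  have "norm (f x - f (-1)) \<le> B * norm (x - (-1))"
  proof (rule field_differentiable_bound)
    show "(f has_real_derivative p y) (at y within {-1..1})" if "y \<in> {-1..1}" for y
      using p that by (simp add: C1_deriv_def)
    show "norm (p y) \<le> B" if "y \<in> {-1..1}" for y using B[OF that] by simp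
    show "x \<in> {-1..1}" "(-1::real) \<in> {-1..1}" using x by simp_all
  qed (rule convex_real_interval)
  also have "\<dots> \<le> B * 2"
  proof (rule mult_left_mono[OF _ B0])
    show "norm (x - (-1)) \<le> 2" using x by (simp add: abs_le_iff)
  qed
  finally show ?thesis using f by simp
qed

text \<open>Convergence of the Sobolev-valued power series at one parameter \<open>R > 0\<close> bounds \<open>R ^ k\<close> times the
derivatives of its coefficients uniformly on \<open>[-1,1]\<close>; for \<open>l < R / 2\<close> the scalar estimate applies at each
point \<open>x\<close> with the same constants. The estimate compares two arbitrary parameters, which is stronger
than differentiability at \<open>0\<close> and is what comparing \<open>u l'\<close> with \<open>u l\<close> requires.\<close>

lemma analytic_curve_C1_expansion:
  assumes q: "1 \<le> q" and \<delta>0: "0 < \<delta>0" and an: "analytic_W2qD q {0..<\<delta>0} u"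
  obtains P v v' C \<delta> where "0 < \<delta>" "\<delta> \<le> \<delta>0" "0 \<le> C"
    "\<And>l. 0 \<le> l \<Longrightarrow> l < \<delta> \<Longrightarrow> C1_deriv (u l) (P l)"
    "C1_deriv v v'" "v (-1) = 0" "v 1 = 0"
    "\<And>l l' x. 0 \<le> l' \<Longrightarrow> l' < l \<Longrightarrow> l < \<delta> \<Longrightarrow> x \<in> {-1..1} \<Longrightarrow>
       \<bar>u l x - u l' x - (l - l') * v x\<bar> \<le> C * l * (l - l')"
    "\<And>l l' x. 0 \<le> l' \<Longrightarrow> l' < l \<Longrightarrow> l < \<delta> \<Longrightarrow> x \<in> {-1..1} \<Longrightarrow>
       \<bar>P l x - P l' x - (l - l') * v' x\<bar> \<le> C * l * (l - l')"
proof -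
  have q0: "0 < q" using q by simp
  have "0 \<in> {0..<\<delta>0}" using \<delta>0 by simp
  with an have "\<exists>r>0. \<exists>a. (\<forall>k. a k \<in> W2qD q) \<and> (\<forall>l\<in>{0..<\<delta>0}. \<bar>l - 0\<bar> < r \<longrightarrow>
      (\<lambda>N. W2q_norm q (\<lambda>z. u l z - (\<Sum>k<N. (l - 0) ^ k * a k z))) \<longlonglongrightarrow> 0)"
    unfolding analytic_W2qD_def by blast
  then obtain r a where r: "0 < r" and a: "\<And>k. a k \<in> W2qD q"
    and conv: "\<And>l. l \<in> {0..<\<delta>0} \<Longrightarrow> \<bar>l\<bar> < r \<Longrightarrow>
        (\<lambda>N. W2q_norm q (\<lambda>z. u l z - (\<Sum>k<N. l ^ k * a k z))) \<longlonglongrightarrow> 0"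
    unfolding diff_zero by blast
  have uD: "u l \<in> W2qD q" if "l \<in> {0..<\<delta>0}" for l using an that by (auto simp: analytic_W2qD_def)
  have ex: "\<exists>p. C1_deriv f p" if "f \<in> W2qD q" for f
  proof -
    have "f \<in> W2q q" using that by (simp add: W2qD_def)
    then show ?thesis by (metis W2q_imp_C1[OF q])
  qed
  obtain b where b: "\<And>k. C1_deriv (a k) (b k)" using ex[OF a] by metis
  obtain P where P: "\<And>l. l \<in> {0..<\<delta>0} \<Longrightarrow> C1_deriv (u l) (P l)" using ex[OF uD] by metis
  define F where "F l N = (\<lambda>z. u l z - (\<Sum>k<N. l ^ k * a k z))" for l N
  have F: "F l N \<in> W2qD q \<and> C1_deriv (F l N) (\<lambda>z. P l z - (\<Sum>k<N. l ^ k * b k z))"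
    if l: "l \<in> {0..<\<delta>0}" for l N
  proof (induction N)
    case 0
    then show ?case using uD[OF l] P[OF l] by (simp add: F_def)
  next
    case (Suc N)
    have eqF: "F l (Suc N) = (\<lambda>z. 1 * F l N z + (- (l ^ N)) * a N z)" by (auto simp: F_def)
    have eqP: "(\<lambda>z. P l z - (\<Sum>k<Suc N. l ^ k * b k z)) =
        (\<lambda>z. 1 * (P l z - (\<Sum>k<N. l ^ k * b k z)) + (- (l ^ N)) * b N z)" by auto
    from W2qD_linear[OF q0 conjunct1[OF Suc] a, of 1 "- (l ^ N)" N]
      C1_deriv_linear[OF conjunct2[OF Suc] b, of 1 "- (l ^ N)" N]
    show ?case unfolding eqF eqP by (rule conjI)
  qed
  have remainder: "\<bar>P l x - (\<Sum>k<N. l ^ k * b k x)\<bar> \<le> 3 * W2q_norm q (F l N)"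
    if "l \<in> {0..<\<delta>0}" "x \<in> {-1..1}" for l N x
    using W2qD_C1_bound[OF q, of "F l N"] F[OF that(1), of N] that(2) by blast
  (* half of the admissible radius, so that the series is known to converge at R itself *)
  define R where "R = min r \<delta>0 / 2"
  have R: "0 < R" "R \<in> {0..<\<delta>0}" "\<bar>R\<bar> < r" using r \<delta>0 by (auto simp: R_def min_def)
  have "Bseq (\<lambda>N. W2q_norm q (F R N))"
    using conv[OF R(2,3)] unfolding F_def by (intro convergent_imp_Bseq convergentI)
  then obtain B where B: "\<And>N. \<bar>W2q_norm q (F R N)\<bar> \<le> B" by (auto simp: Bseq_def)
  have bb: "\<bar>b k x\<bar> * R ^ k \<le> 6 * B" if "x \<in> {-1..1}" for k x
  proof -
    have "\<bar>P R x - (\<Sum>k<N. R ^ k * b k x)\<bar> \<le> 3 * B" for N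
      using remainder[OF R(2) that, of N] B[of N] by linarith
    from this[of k] this[of "Suc k"] have "\<bar>R ^ k * b k x\<bar> \<le> 6 * B" by simp
    then show ?thesis using R by (simp add: abs_mult mult.commute)
  qed
  have sums: "(\<lambda>k. l ^ k * b k x) sums P l x" if l: "0 \<le> l" "l \<le> R" and x: "x \<in> {-1..1}" for l x
  proof -
    have lJ: "l \<in> {0..<\<delta>0}" "\<bar>l\<bar> < r" using l R by auto
    have "(\<lambda>N. 3 * W2q_norm q (F l N)) \<longlonglongrightarrow> 0"
      using tendsto_mult_right_zero[OF conv[OF lJ], of 3] by (simp add: F_def)
    then have "(\<lambda>N. P l x - (\<Sum>k<N. l ^ k * b k x)) \<longlonglongrightarrow> 0"
      by (rule Lim_null_comparison[rotated]) (use remainder[OF lJ(1) x] in auto)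
    from tendsto_diff[OF tendsto_const[of "P l x"] this] show ?thesis
      by (simp add: sums_def)
  qed
  define K where "K = 8 * (6 * B) / R\<^sup>2"
  have K: "\<bar>P l x - P l' x - (l - l') * b 1 x\<bar> \<le> K * l * (l - l')"
    if l: "0 \<le> l'" "l' < l" "l < R / 2" and x: "x \<in> {-1..1}" for l l' x
    unfolding K_def using l R x
    by (intro power_series_increment[where c = "\<lambda>k. b k x"] bb sums) auto
  have B0: "0 \<le> B" using B[of 0] by linarith
  have K0: "0 \<le> K" using B0 by (simp add: K_def)
  have a1: "a 1 (-1) = 0" "a 1 1 = 0" using a[of 1] by (auto simp: W2qD_def)
  show ?thesis
  proof (rule that[of "R / 2" "2 * K" P "a 1" "b 1"])
    show "0 < R / 2" "R / 2 \<le> \<delta>0" "0 \<le> 2 * K" using R K0 by auto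
    show "C1_deriv (a 1) (b 1)" "a 1 (-1) = 0" "a 1 1 = 0" using b a1 by auto
    show PC: "C1_deriv (u l) (P l)" if "0 \<le> l" "l < R / 2" for l using P that R by auto
    fix l l' x :: real assume l: "0 \<le> l'" "l' < l" "l < R / 2" and x: "x \<in> {-1..1}"
    have C: "C1_deriv (\<lambda>x. 1 * (1 * u l x + (-1) * u l' x) + (- (l - l')) * a 1 x)
       (\<lambda>x. 1 * (1 * P l x + (-1) * P l' x) + (- (l - l')) * b 1 x)"
      using l by (intro C1_deriv_linear PC b) auto
    have u0: "u l (-1) = 0" "u l' (-1) = 0" using uD[of l] uD[of l'] l R by (auto simp: W2qD_def)
    have "\<bar>1 * (1 * u l x + (-1) * u l' x) + (- (l - l')) * a 1 x\<bar> \<le> 2 * (K * l * (l - l'))"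
      by (rule C1_deriv_mean_value[OF C _ _ x]) (use K[OF l] u0 a1 in \<open>auto simp: algebra_simps\<close>)
    then show "\<bar>u l x - u l' x - (l - l') * a 1 x\<bar> \<le> 2 * K * l * (l - l')"
      by (simp add: algebra_simps)
    have "0 \<le> K * l * (l - l')" using K0 l by simp
    then show "\<bar>P l x - P l' x - (l - l') * b 1 x\<bar> \<le> 2 * K * l * (l - l')"
      using K[OF l x] by linarith
  qed
qed

section \<open>Solutions in integrated form\<close>

text \<open>The expression \<open>g_sar\<close> as a function of the values of \<open>u\<close> and of its classical derivative.\<close>

definition G_sar :: "real \<Rightarrow> real \<Rightarrow> real \<Rightarrow> real" where
  "G_sar \<sigma> s p = (1 + \<sigma>\<^sup>2 * p\<^sup>2) powr (1/2) * (1 / ((s + 1)\<^sup>2 * (ln (2 / (s + 1)))\<^sup>2))"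

lemma G_sar_continuous:
  assumes "continuous_on A u" "continuous_on A p" "\<And>x. x \<in> A \<Longrightarrow> -1 < u x \<and> u x < 1"
  shows "continuous_on A (\<lambda>x. G_sar \<sigma> (u x) (p x))"
proof -
  have 1: "1 + \<sigma>\<^sup>2 * (p x)\<^sup>2 \<noteq> 0" for x
    using zero_le_mult_iff[of "\<sigma>\<^sup>2" "(p x)\<^sup>2"] by (smt (verit) zero_le_power2)
  have 2: "u x + 1 \<noteq> 0" "0 < ln (2 / (u x + 1))" "0 < 2 / (u x + 1)" if "x \<in> A" for x
    using assms(3)[OF that] by auto
  show ?thesis unfolding G_sar_def
    by (intro continuous_intros assms(1,2)) (use 1 2 in \<open>force+\<close>)
qed

text \<open>The equation prescribes the weak derivative of \<open>arctan (\<sigma> * wderiv u)\<close>, and this function has the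
continuous representative \<open>arctan (\<sigma> * p)\<close>.\<close>

lemma SAR_integral_form:
  assumes q: "1 \<le> q" and \<sigma>: "0 < \<sigma>" and sol: "solves_SAR q \<sigma> l u" and p: "C1_deriv u p"
    and ab: "-1 < a" "a < b" "b < 1"
  shows "arctan (\<sigma> * p b) - arctan (\<sigma> * p a) = integral {a..b} (\<lambda>z. (1 / (u z + 1) - l * G_sar \<sigma> (u z) (p z)) / \<sigma>)"
    and "continuous_on {a..b} (\<lambda>z. (1 / (u z + 1) - l * G_sar \<sigma> (u z) (p z)) / \<sigma>)"
proof -
  let ?K = "\<lambda>z. (1 / (u z + 1) - l * G_sar \<sigma> (u z) (p z)) / \<sigma>"
  define k where "k = wderiv (\<lambda>y. arctan (\<sigma> * wderiv u y))"
  have uW: "u \<in> W2q q" and bd: "\<And>z. z \<in> Om \<Longrightarrow> -1 < u z \<and> u z < 1"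
    and wd: "weakly_differentiable (\<lambda>z. arctan (\<sigma> * wderiv u z))"
    and eq: "AE z in lebesgue_on Om. - \<sigma> * k z = - 1 / (u z + 1) + l * g_sar \<sigma> u z"
    using sol by (auto simp: solves_SAR_def W2qD_def k_def)
  obtain p' where p': "C1_deriv u p'" "AE x in lebesgue_on Om. wderiv u x = p' x"
    using W2q_imp_C1[OF q uW] by metis
  have up: "AE x in lebesgue_on Om. wderiv u x = p x"
    using p'(2) by (rule lebesgue_on_mono) (use C1_deriv_unique[OF p'(1) p] in auto)
  have pc: "continuous_on Om p" and uc: "continuous_on Om u"
    using p C1_deriv_continuous[OF p] by (auto simp: C1_deriv_def intro: continuous_on_subset)
  have "AE z in lebesgue_on Om. k z = ?K z"
  proof -
    have "AE z in lebesgue_on Om. - \<sigma> * k z = - 1 / (u z + 1) + l * g_sar \<sigma> u z \<and> wderiv u z = p z"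
      using eq up by (rule AE_conjI)
    then show ?thesis
    proof (rule lebesgue_on_mono)
      fix z assume "- \<sigma> * k z = - 1 / (u z + 1) + l * g_sar \<sigma> u z \<and> wderiv u z = p z"
      then have "\<sigma> * k z = 1 / (u z + 1) - l * G_sar \<sigma> (u z) (p z)"
        by (auto simp: g_sar_def G_sar_def)
      then show "k z = ?K z" using \<sigma> by (simp add: field_simps)
    qed
  qed
  then have kK: "AE z in lebesgue_on {a..b}. k z = ?K z"
    using ab by (auto simp: AE_restrict_space_iff elim!: eventually_mono)
  have sub: "{a..b} \<subseteq> Om" using ab by auto
  have "u z + 1 \<noteq> 0" if "z \<in> {a..b}" for z using bd[of z] that sub by force
  then show Kc: "continuous_on {a..b} ?K"
    using bd sub \<sigma> by (intro continuous_intros G_sar_continuous continuous_on_subset[OF uc sub] continuous_on_subset[OF pc sub]) auto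
  have w: "has_weak_deriv (\<lambda>z. arctan (\<sigma> * wderiv u z)) k"
    unfolding k_def by (rule has_weak_deriv_wderiv[OF wd])
  have ki: "integrable (lebesgue_on {a..b}) k"
    using w ab by (auto simp: has_weak_deriv_def intro: locally_integrable_Icc)
  have Ki: "integrable (lebesgue_on {a..b}) ?K" by (rule continuous_imp_integrable_real[OF Kc])
  have "arctan (\<sigma> * p b) - arctan (\<sigma> * p a) = (LINT x|lebesgue_on {a..b}. k x)"
  proof (rule weak_deriv_increment[OF w _ _ ab, where p = "\<lambda>z. arctan (\<sigma> * p z)"])
    show "AE x in lebesgue_on Om. arctan (\<sigma> * wderiv u x) = arctan (\<sigma> * p x)"
      using up by (rule lebesgue_on_mono) simp
  qed (intro continuous_intros pc)
  also have "\<dots> = (LINT x|lebesgue_on {a..b}. ?K x)"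
    by (intro integral_cong_AE borel_measurable_integrable ki Ki kK)
  also have "\<dots> = integral {a..b} ?K" by (rule lebesgue_integral_eq_integral[OF Ki]) simp
  finally show "arctan (\<sigma> * p b) - arctan (\<sigma> * p a) = integral {a..b} ?K" .
qed

section \<open>Linearization at the inner catenoid\<close>

lemma difference_quotient_limit:
  fixes f :: "real \<Rightarrow> real"
  assumes f: "(f has_real_derivative D) (at a)" and X: "X \<longlonglongrightarrow> 0" "\<And>n. X n \<noteq> 0"
    and q: "(\<lambda>n. (b n - a) / X n) \<longlonglongrightarrow> s"
  shows "(\<lambda>n. (f (b n) - f a) / X n) \<longlonglongrightarrow> D * s"
proof -
  obtain g where g: "\<And>z. f z - f a = g z * (z - a)" "isCont g a" "g a = D"
    using f unfolding CARAT_DERIV by blast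
  have "(\<lambda>n. (b n - a) / X n * X n + a) \<longlonglongrightarrow> s * 0 + a" by (intro tendsto_intros q X)
  then have "b \<longlonglongrightarrow> a" using X(2) by simp
  then have "(\<lambda>n. g (b n)) \<longlonglongrightarrow> D" using isCont_tendsto_compose[OF g(2)] g(3) by metis
  then have "(\<lambda>n. g (b n) * ((b n - a) / X n)) \<longlonglongrightarrow> D * s" by (intro tendsto_mult q)
  then show ?thesis by (simp add: g(1))
qed

text \<open>For the inner catenoid \<open>u + 1 = cosh (c z) / cosh c\<close>, so this is \<open>ln (2 / (u + 1))\<close>.\<close>

definition log_gap :: "real \<Rightarrow> real \<Rightarrow> real" where
  "log_gap c z = ln (2 * cosh c / cosh (c * z))"

definition lin_forcing :: "real \<Rightarrow> real \<Rightarrow> real" where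
  "lin_forcing c z = cosh (c * z) / (log_gap c z)\<^sup>2"

lemma cosh_mult_le: "z \<in> {-1..1} \<Longrightarrow> cosh (c * z) \<le> cosh (c :: real)"
proof -
  assume "z \<in> {-1..1}"
  then have "\<bar>c * z\<bar> \<le> \<bar>c\<bar>" by (simp add: abs_mult mult_left_le abs_le_iff)
  then show ?thesis using cosh_real_nonneg_le_iff[of "\<bar>c * z\<bar>" "\<bar>c\<bar>"] by simp
qed

lemma log_gap_ge: "z \<in> {-1..1} \<Longrightarrow> ln 2 \<le> log_gap c z"
  unfolding log_gap_def using cosh_mult_le[of z c] by (intro ln_mono) (auto simp: field_simps)

lemma log_gap_pos: "z \<in> {-1..1} \<Longrightarrow> 0 < log_gap c z"
  using log_gap_ge[of z c] ln_gt_zero[of "2::real"] by linarith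

lemma log_gap_continuous: "continuous_on A (log_gap c)"
  unfolding log_gap_def[abs_def] by (intro continuous_intros) (auto simp: less_imp_neq[OF cosh_real_pos, symmetric])

text \<open>Subtract the integrated equations for the parameters \<open>l\<close> and \<open>0\<close>, divide by \<open>l\<close> and let \<open>l\<close> tend to \<open>0\<close>.
At the catenoid \<open>\<sigma> * u' = sinh (c z)\<close>, so differentiating \<open>arctan (\<sigma> * u')\<close> produces the weight
\<open>1 / cosh\<^sup>2\<close>. Dominated convergence needs \<open>u l\<close> to stay away from the singular values \<open>-1\<close> and \<open>1\<close>,
uniformly in \<open>l\<close>; this is what the constants \<open>m\<close> and \<open>\<delta>1\<close> provide.\<close>

lemma linearized_equation:
  assumes q: "1 \<le> q" and c: "0 < c" and \<sigma>: "\<sigma> = cosh c / c" and \<delta>: "0 < \<delta>"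
    and u0: "\<And>z. z \<in> {-1..1} \<Longrightarrow> u 0 z = cosh (c * z) / cosh c - 1"
    and P: "\<And>l. 0 \<le> l \<Longrightarrow> l < \<delta> \<Longrightarrow> C1_deriv (u l) (P l)"
    and sol: "\<And>l. 0 \<le> l \<Longrightarrow> l < \<delta> \<Longrightarrow> solves_SAR q \<sigma> l (u l)"
    and v: "C1_deriv v v'" and C: "0 \<le> C"
    and eu: "\<And>l x. 0 < l \<Longrightarrow> l < \<delta> \<Longrightarrow> x \<in> {-1..1} \<Longrightarrow> \<bar>u l x - u 0 x - l * v x\<bar> \<le> C * l * l"
    and eP: "\<And>l x. 0 < l \<Longrightarrow> l < \<delta> \<Longrightarrow> x \<in> {-1..1} \<Longrightarrow> \<bar>P l x - P 0 x - l * v' x\<bar> \<le> C * l * l"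
    and z: "z \<in> Om"
  shows "((\<lambda>z. v' z / (cosh (c * z))\<^sup>2) has_real_derivative
      - c\<^sup>2 / (cosh (c * z))\<^sup>2 * (v z + lin_forcing c z)) (at z)"
proof -
  have cc: "0 < cosh c" "1 \<le> cosh c" by (auto simp: cosh_real_ge_1)
  have \<sigma>0: "0 < \<sigma>" using c by (simp add: \<sigma>)
  have P0: "\<sigma> * P 0 x = sinh (c * x)" if "x \<in> {-1..1}" for x
  proof -
    have "C1_deriv (u 0) (\<lambda>z. c * sinh (c * z) / cosh c)"
      unfolding C1_deriv_def
    proof (intro conjI ballI)
      show "continuous_on {-1..1} (\<lambda>z. c * sinh (c * z) / cosh c)"
        by (intro continuous_intros) (use cc in auto)
      fix y :: real assume y: "y \<in> {-1..1}"
      have "((\<lambda>z. cosh (c * z) / cosh c - 1) has_real_derivative c * sinh (c * y) / cosh c) (at y within {-1..1})"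
        by (auto intro!: derivative_eq_intros)
      then show "(u 0 has_real_derivative c * sinh (c * y) / cosh c) (at y within {-1..1})"
        by (rule has_field_derivative_transform_within[OF _ zero_less_one y]) (simp add: u0)
    qed
    from C1_deriv_unique[OF P[of 0] this that] \<delta> show ?thesis using c cc by (simp add: \<sigma>)
  qed
  have bd: "\<exists>B. \<forall>x\<in>{-1..1}. \<bar>f x\<bar> \<le> B" if "continuous_on {-1..1} f" for f :: "real \<Rightarrow> real"
    using compact_imp_bounded[OF compact_continuous_image[OF that compact_Icc]] by (auto simp: bounded_iff)
  obtain V1 where V1: "\<And>x. x \<in> {-1..1} \<Longrightarrow> \<bar>v x\<bar> \<le> V1" using bd[OF C1_deriv_continuous[OF v]] by blast
  obtain V2 where V2: "\<And>x. x \<in> {-1..1} \<Longrightarrow> \<bar>v' x\<bar> \<le> V2" using bd[of v'] v unfolding C1_deriv_def by blast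
  obtain V3 where V3: "\<And>x. x \<in> {-1..1} \<Longrightarrow> \<bar>P 0 x\<bar> \<le> V3" 
    using bd[of "P 0"] P[OF order_refl \<delta>] unfolding C1_deriv_def by blast
  define W where "W = max V1 V2 + C"
  have W0: "0 \<le> W" using V1[of 0] C by (auto simp: W_def)
  (* half of the minimum of u 0 + 1, attained at z = 0 *)
  define m where "m = 1 / (2 * cosh c)"
  have m: "0 < m" "m \<le> 1/2" using cc by (auto simp: m_def field_simps)
  (* up to \<delta>1, u l stays within m of u 0 *)
  define \<delta>1 where "\<delta>1 = min (min \<delta> 1) (m / (W + 1))"
  have \<delta>1: "0 < \<delta>1" "\<delta>1 \<le> \<delta>" "\<delta>1 \<le> 1" "\<delta>1 * W \<le> m"
  proof -
    show "0 < \<delta>1" "\<delta>1 \<le> \<delta>" "\<delta>1 \<le> 1" using \<delta> m W0 by (auto simp: \<delta>1_def)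
    have "\<delta>1 * W \<le> (m / (W + 1)) * (W + 1)"
      using W0 m by (intro mult_mono) (auto simp: \<delta>1_def)
    then show "\<delta>1 * W \<le> m" using W0 by simp
  qed
  have du: "\<bar>u l x - u 0 x\<bar> \<le> l * W" and dP: "\<bar>P l x - P 0 x\<bar> \<le> l * W"
    if l: "0 < l" "l < \<delta>1" and x: "x \<in> {-1..1}" for l x
  proof -
    have "C * l * l \<le> l * C" using l \<delta>1 C by (simp add: mult_left_le mult.commute mult_mono)
    moreover have "\<bar>l * v x\<bar> \<le> l * max V1 V2" "\<bar>l * v' x\<bar> \<le> l * max V1 V2"
      unfolding abs_mult using l V1[OF x] V2[OF x] by (auto intro!: mult_mono)
    moreover have "\<bar>u l x - u 0 x - l * v x\<bar> \<le> C * l * l" "\<bar>P l x - P 0 x - l * v' x\<bar> \<le> C * l * l"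
      using eu[of l x] eP[of l x] l x \<delta>1 by auto
    moreover have "l * W = l * max V1 V2 + l * C" by (simp add: W_def algebra_simps)
    ultimately show "\<bar>u l x - u 0 x\<bar> \<le> l * W" "\<bar>P l x - P 0 x\<bar> \<le> l * W" by linarith+
  qed
  have u0r: "2 * m \<le> u 0 x + 1" "u 0 x + 1 \<le> 1" if "x \<in> {-1..1}" for x
  proof -
    have e: "u 0 x + 1 = cosh (c * x) / cosh c" using u0[OF that] by simp
    show "2 * m \<le> u 0 x + 1" "u 0 x + 1 \<le> 1" unfolding e m_def
      using cosh_mult_le[OF that, of c] cosh_real_ge_1[of "c * x"] cc by (simp_all add: field_simps)
  qed
  have ur: "m \<le> u l x + 1" "u l x + 1 \<le> 3/2" if l: "0 < l" "l < \<delta>1" and x: "x \<in> {-1..1}" for l x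
  proof -
    have "l * W \<le> m" using l \<delta>1 W0 by (meson less_imp_le mult_right_mono order_trans)
    then show "m \<le> u l x + 1" "u l x + 1 \<le> 3/2" using du[OF l x] u0r[OF x] m by linarith+
  qed
  define GB where "GB = (1 + \<sigma>\<^sup>2 * (V3 + W)\<^sup>2) powr (1/2) * (1 / (m\<^sup>2 * (ln (4/3))\<^sup>2))"
  have Gb: "\<bar>G_sar \<sigma> (u l x) (P l x)\<bar> \<le> GB" if l: "0 < l" "l < \<delta>1" and x: "x \<in> {-1..1}" for l x
  proof -
    have "l * W \<le> 1 * W" using l \<delta>1 W0 by (intro mult_right_mono) auto
    then have p: "\<bar>P l x\<bar> \<le> \<bar>V3 + W\<bar>" using dP[OF l x] V3[OF x] by linarith
    have "(4/3::real) \<le> 2 / (u l x + 1)" using ur[OF l x] m by (simp add: field_simps)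
    then have ln: "ln (4/3) \<le> ln (2 / (u l x + 1))" by (intro ln_mono) auto
    have l43: "0 < ln (4/3::real)" by simp
    have "(P l x)\<^sup>2 \<le> (V3 + W)\<^sup>2" using p by (simp add: abs_le_square_iff)
    then have 1: "(1 + \<sigma>\<^sup>2 * (P l x)\<^sup>2) powr (1/2) \<le> (1 + \<sigma>\<^sup>2 * (V3 + W)\<^sup>2) powr (1/2)"
      by (intro powr_mono2 add_left_mono mult_left_mono) auto
    have "m\<^sup>2 * (ln (4/3))\<^sup>2 \<le> (u l x + 1)\<^sup>2 * (ln (2 / (u l x + 1)))\<^sup>2"
      using ur[OF l x] m ln l43 by (intro mult_mono power_mono) auto
    then have 2: "1 / ((u l x + 1)\<^sup>2 * (ln (2 / (u l x + 1)))\<^sup>2) \<le> 1 / (m\<^sup>2 * (ln (4/3))\<^sup>2)"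
      using m l43 by (intro frac_le) auto
    have "\<bar>G_sar \<sigma> (u l x) (P l x)\<bar> = G_sar \<sigma> (u l x) (P l x)"
      by (simp add: G_sar_def)
    also have "\<dots> \<le> GB" unfolding G_sar_def GB_def by (intro mult_mono 1 2) auto
    finally show ?thesis .
  qed
  define X where "X n = \<delta>1 / (real n + 2)" for n
  have X12: "0 < X n" "X n < \<delta>1" for n
  proof -
    show "0 < X n" using \<delta>1 by (simp add: X_def)
    have "\<delta>1 * 1 < \<delta>1 * (real n + 2)" using \<delta>1 by (intro mult_strict_left_mono) auto
    then show "X n < \<delta>1" by (simp add: X_def pos_divide_less_eq)
  qed
  then have X: "0 < X n" "X n < \<delta>1" "X n < \<delta>" for n using \<delta>1(2) by (auto intro: order.strict_trans2)
  have Xlim: "X \<longlonglongrightarrow> 0" 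
    using tendsto_mult_right_zero[OF LIMSEQ_Suc[OF LIMSEQ_inverse_real_of_nat], of \<delta>1]
    by (simp add: X_def[abs_def] divide_inverse add.commute)
  have qlim: "(\<lambda>n. (f (X n) - f 0) / X n) \<longlonglongrightarrow> d"
    if "\<And>n. \<bar>f (X n) - f 0 - X n * d\<bar> \<le> C * X n * X n" for f :: "real \<Rightarrow> real" and d
  proof -
    have "\<bar>(f (X n) - f 0) / X n - d\<bar> \<le> C * X n" for n
    proof -
      have "(f (X n) - f 0) / X n - d = (f (X n) - f 0 - X n * d) / X n"
        using X(1)[of n] by (simp add: diff_divide_distrib)
      also have "\<bar>\<dots>\<bar> \<le> C * X n * X n / X n"
        unfolding abs_divide using that[of n] X(1)[of n] by (simp add: pos_divide_le_eq)
      finally show ?thesis using X(1)[of n] by simp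
    qed
    moreover have "(\<lambda>n. C * X n) \<longlonglongrightarrow> 0" using tendsto_mult_right_zero[OF Xlim] .
    ultimately have "(\<lambda>n. (f (X n) - f 0) / X n - d) \<longlonglongrightarrow> 0"
      by (intro Lim_null_comparison[where f = "\<lambda>n. (f (X n) - f 0) / X n - d" and g = "\<lambda>n. C * X n"] always_eventually allI)
         (simp_all only: real_norm_def)
    then show ?thesis by (simp add: LIM_zero_iff)
  qed
  have ulim: "(\<lambda>n. (u (X n) x - u 0 x) / X n) \<longlonglongrightarrow> v x" and Plim: "(\<lambda>n. (P (X n) x - P 0 x) / X n) \<longlonglongrightarrow> v' x"
    if "x \<in> {-1..1}" for x
    using qlim[of "\<lambda>l. u l x" "v x"] qlim[of "\<lambda>l. P l x" "v' x"] eu[of "X _" x] eP[of "X _" x] X that by auto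
  define k where "k x = - c\<^sup>2 / (cosh (c * x))\<^sup>2 * (v x + lin_forcing c x)" for x
  have kc: "continuous_on {-1..1} k"
    unfolding k_def lin_forcing_def
    by (intro continuous_intros C1_deriv_continuous[OF v] log_gap_continuous)
       (use log_gap_pos[of _ c] in \<open>force+\<close>)
  have inc: "v' y / (cosh (c * y))\<^sup>2 - v' x / (cosh (c * x))\<^sup>2 = integral {x..y} k"
    if xy: "-1 < x" "x < y" "y < 1" for x y
  proof -
    define K where "K l t = (1 / (u l t + 1) - l * G_sar \<sigma> (u l t) (P l t)) / \<sigma>" for l t
    have form: "arctan (\<sigma> * P l y) - arctan (\<sigma> * P l x) = integral {x..y} (K l)" and Kc: "continuous_on {x..y} (K l)"
      if "0 \<le> l" "l < \<delta>" for l
      using SAR_integral_form[OF q \<sigma>0 sol[OF that] P[OF that] xy] by (simp_all add: K_def[abs_def])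
    have alg: "((a - x * g) / \<sigma> - (b - 0 * g0) / \<sigma>) / x = ((a - b) / x - g) / \<sigma>" if "0 < x" for a b g g0 x
      using \<sigma>0 that by (simp add: field_simps)
    define f where "f n t = (K (X n) t - K 0 t) / X n" for n t
    have fi: "f n integrable_on {x..y}" for n
      unfolding f_def using X(1,3)[of n] \<delta>
      by (intro integrable_continuous_real continuous_intros Kc) auto
    have "(arctan (\<sigma> * P (X n) y) - arctan (\<sigma> * P 0 y)) / X n - (arctan (\<sigma> * P (X n) x) - arctan (\<sigma> * P 0 x)) / X n
      = integral {x..y} (f n)" for n
    proof -
      have "integral {x..y} (f n) = (integral {x..y} (K (X n)) - integral {x..y} (K 0)) / X n"
        unfolding f_def using X(1,3)[of n] \<delta>
        by (simp add: Henstock_Kurzweil_Integration.integral_diff integrable_continuous_real Kc)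
      also have "integral {x..y} (K (X n)) = arctan (\<sigma> * P (X n) y) - arctan (\<sigma> * P (X n) x)"
        using form[of "X n"] X(1,3)[of n] by simp
      also have "integral {x..y} (K 0) = arctan (\<sigma> * P 0 y) - arctan (\<sigma> * P 0 x)"
        using form[of 0] \<delta> by simp
      finally show ?thesis by (simp add: diff_divide_distrib)
    qed
    moreover have "(\<lambda>n. (arctan (\<sigma> * P (X n) t) - arctan (\<sigma> * P 0 t)) / X n) \<longlonglongrightarrow> \<sigma> * (v' t / (cosh (c * t))\<^sup>2)"
      if t: "t \<in> {-1..1}" for t
    proof -
      have "(\<lambda>n. \<sigma> * ((P (X n) t - P 0 t) / X n)) \<longlonglongrightarrow> \<sigma> * v' t" by (intro tendsto_intros Plim t)
      then have "(\<lambda>n. (\<sigma> * P (X n) t - \<sigma> * P 0 t) / X n) \<longlonglongrightarrow> \<sigma> * v' t"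
        by (simp add: right_diff_distrib)
      from difference_quotient_limit[OF DERIV_arctan Xlim _ this]
      have "(\<lambda>n. (arctan (\<sigma> * P (X n) t) - arctan (\<sigma> * P 0 t)) / X n) \<longlonglongrightarrow> inverse (1 + (\<sigma> * P 0 t)\<^sup>2) * (\<sigma> * v' t)"
        using X(1) by (metis less_irrefl)
      then show ?thesis
        unfolding P0[OF t] using cosh_square_eq[of "c * t"] by (simp add: field_simps)
    qed
    ultimately have L: "(\<lambda>n. integral {x..y} (f n)) \<longlonglongrightarrow> \<sigma> * (v' y / (cosh (c * y))\<^sup>2) - \<sigma> * (v' x / (cosh (c * x))\<^sup>2)"
      using tendsto_diff[of "\<lambda>n. (arctan (\<sigma> * P (X n) y) - arctan (\<sigma> * P 0 y)) / X n" _ sequentially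
        "\<lambda>n. (arctan (\<sigma> * P (X n) x) - arctan (\<sigma> * P 0 x)) / X n"] xy by simp
    define B where "B = (W / (m * m) + GB) / \<sigma>"
    have "(\<lambda>n. integral {x..y} (f n)) \<longlonglongrightarrow> integral {x..y} (\<lambda>t. \<sigma> * k t)"
    proof (rule dominated_convergence(2)[OF fi])
      show "(\<lambda>_. B) integrable_on {x..y}" by (rule integrable_const_ivl)
      fix n t assume "t \<in> {x..y}"
      then have t: "t \<in> {-1..1}" using xy by auto
      have a: "m \<le> u (X n) t + 1" "m \<le> u 0 t + 1"
        using ur[OF X(1,2) t, of n] u0r[OF t] m by auto
      have fe: "f n t = (- ((u (X n) t - u 0 t) / X n) / ((u (X n) t + 1) * (u 0 t + 1)) - G_sar \<sigma> (u (X n) t) (P (X n) t)) / \<sigma>"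
      proof -
        have alg2: "(1 / p - 1 / r) / x = - ((p - r) / x) / (p * r)" if "0 < p" "0 < r" "0 < x" for p r x :: real
          using that by (simp add: field_simps)
        have "(1 / (u (X n) t + 1) - 1 / (u 0 t + 1)) / X n = - ((u (X n) t - u 0 t) / X n) / ((u (X n) t + 1) * (u 0 t + 1))"
          using alg2[of "u (X n) t + 1" "u 0 t + 1" "X n"] a m X(1)[of n] by simp
        then show ?thesis unfolding f_def K_def alg[OF X(1)[of n]] by (simp only:)
      qed
      have "\<bar>(u (X n) t - u 0 t) / X n\<bar> \<le> W"
        using du[OF X(1,2) t, of n] X(1)[of n] by (simp add: field_simps)
      moreover have "m * m \<le> (u (X n) t + 1) * (u 0 t + 1)" using a m by (intro mult_mono) auto
      ultimately have "\<bar>- ((u (X n) t - u 0 t) / X n) / ((u (X n) t + 1) * (u 0 t + 1))\<bar> \<le> W / (m * m)"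
        using m a W0 unfolding abs_divide abs_minus by (intro frac_le) auto
      then have "\<bar>- ((u (X n) t - u 0 t) / X n) / ((u (X n) t + 1) * (u 0 t + 1)) - G_sar \<sigma> (u (X n) t) (P (X n) t)\<bar> \<le> W / (m * m) + GB"
        using Gb[OF X(1,2) t, of n] by linarith
      then show "norm (f n t) \<le> B"
        unfolding fe B_def real_norm_def abs_divide using \<sigma>0 by (simp add: divide_right_mono)
    next
      fix t assume "t \<in> {x..y}"
      then have t: "t \<in> {-1..1}" using xy by auto
      have a: "0 < u 0 t + 1" using u0r[OF t] m by simp
      have "((\<lambda>s. 1 / (s + 1)) has_real_derivative - 1 / (u 0 t + 1)\<^sup>2) (at (u 0 t))"
        using a by (auto intro!: derivative_eq_intros simp: power2_eq_square)
      from difference_quotient_limit[OF this Xlim _ ulim[OF t]]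
      have 1: "(\<lambda>n. (1 / (u (X n) t + 1) - 1 / (u 0 t + 1)) / X n) \<longlonglongrightarrow> - 1 / (u 0 t + 1)\<^sup>2 * v t"
        using X(1) by (metis less_irrefl)
      have un: "(\<lambda>n. u (X n) t) \<longlonglongrightarrow> u 0 t"
      proof -
        have "(\<lambda>n. (u (X n) t - u 0 t) / X n * X n + u 0 t) \<longlonglongrightarrow> v t * 0 + u 0 t" by (intro tendsto_intros ulim t Xlim)
        then show ?thesis using less_imp_neq[OF X(1)] by simp
      qed
      have Pn: "(\<lambda>n. P (X n) t) \<longlonglongrightarrow> P 0 t"
      proof -
        have "(\<lambda>n. (P (X n) t - P 0 t) / X n * X n + P 0 t) \<longlonglongrightarrow> v' t * 0 + P 0 t" by (intro tendsto_intros Plim t Xlim)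
        then show ?thesis using less_imp_neq[OF X(1)] by simp
      qed
      have lg: "0 < ln (2 / (u 0 t + 1))" using u0r[OF t] a by simp
      have pos: "0 < 1 + \<sigma>\<^sup>2 * (P 0 t)\<^sup>2" by (simp add: add_pos_nonneg)
      have 2: "(\<lambda>n. G_sar \<sigma> (u (X n) t) (P (X n) t)) \<longlonglongrightarrow> G_sar \<sigma> (u 0 t) (P 0 t)"
        unfolding G_sar_def using a lg pos
        by (intro tendsto_intros un Pn) auto
      have fe: "f n t = ((1 / (u (X n) t + 1) - 1 / (u 0 t + 1)) / X n - G_sar \<sigma> (u (X n) t) (P (X n) t)) / \<sigma>" for n
        unfolding f_def K_def alg[OF X(1)[of n]] ..
      have "(\<lambda>n. f n t) \<longlonglongrightarrow> (- 1 / (u 0 t + 1)\<^sup>2 * v t - G_sar \<sigma> (u 0 t) (P 0 t)) / \<sigma>"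
        unfolding fe using \<sigma>0 by (intro tendsto_intros 1 2) auto
      also have "(- 1 / (u 0 t + 1)\<^sup>2 * v t - G_sar \<sigma> (u 0 t) (P 0 t)) / \<sigma> = \<sigma> * k t"
      proof -
        have ut: "u 0 t + 1 = cosh (c * t) / cosh c" using u0[OF t] by simp
        have ct: "0 < cosh (c * t)" by simp
        have "\<sigma>\<^sup>2 * (P 0 t)\<^sup>2 = (sinh (c * t))\<^sup>2" using P0[OF t] by (metis power_mult_distrib)
        then have "1 + \<sigma>\<^sup>2 * (P 0 t)\<^sup>2 = (cosh (c * t))\<^sup>2" by (simp add: cosh_square_eq)
        then have "(1 + \<sigma>\<^sup>2 * (P 0 t)\<^sup>2) powr (1/2) = cosh (c * t)" by (simp add: powr_half_sqrt)
        then have G: "G_sar \<sigma> (u 0 t) (P 0 t) = cosh (c * t) * (1 / ((cosh (c * t) / cosh c)\<^sup>2 * (log_gap c t)\<^sup>2))"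
          unfolding G_sar_def ut by (simp add: log_gap_def)
        have lp: "0 < log_gap c t" by (rule log_gap_pos[OF t])
        show ?thesis unfolding G ut k_def lin_forcing_def unfolding \<sigma>
          using cc c ct lp by (simp add: field_simps power2_eq_square)
      qed
      finally show "(\<lambda>n. f n t) \<longlonglongrightarrow> \<sigma> * k t" .
    qed
    from LIMSEQ_unique[OF L this] have "\<sigma> * (v' y / (cosh (c * y))\<^sup>2 - v' x / (cosh (c * x))\<^sup>2) = \<sigma> * integral {x..y} k"
      by (simp add: right_diff_distrib)
    then show ?thesis using \<sigma>0 by simp
  qed
  define x where "x = (z - 1) / 2"
  define y where "y = (z + 1) / 2"
  have xy: "-1 < x" "x < z" "z < y" "y < 1" using z by (auto simp: x_def y_def field_simps)
  have "((\<lambda>t. v' x / (cosh (c * x))\<^sup>2 + integral {x..t} k) has_real_derivative k z) (at z within {x..y})"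
    using integral_has_real_derivative[of x y k z] continuous_on_subset[OF kc, of "{x..y}"] xy
    by (auto intro!: derivative_eq_intros)
  then have "((\<lambda>t. v' t / (cosh (c * t))\<^sup>2) has_real_derivative k z) (at z within {x..y})"
  proof (rule has_field_derivative_transform_within[OF _ zero_less_one])
    show "z \<in> {x..y}" using xy by simp
    fix t assume "t \<in> {x..y}"
    then show "v' x / (cosh (c * x))\<^sup>2 + integral {x..t} k = v' t / (cosh (c * t))\<^sup>2"
      using inc[of x t] xy by (cases "t = x") auto
  qed
  then show ?thesis using xy by (simp add: at_within_Icc_at k_def)
qed

section \<open>The sign of the linearized solution\<close>

text \<open>The forcing \<open>1 / L\<^sup>2\<close> times the even solution \<open>1 - x tanh x\<close> of the homogeneous equation, \<open>x = c z\<close>.\<close>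

definition stability_integrand :: "real \<Rightarrow> real \<Rightarrow> real" where
  "stability_integrand c z = (1 - c * z * tanh (c * z)) / (log_gap c z)\<^sup>2"

locale linearized =
  fixes c :: real and v v' :: "real \<Rightarrow> real"
  assumes c: "0 < c" and C1: "C1_deriv v v'" and bc: "v (-1) = 0" "v 1 = 0"
    and ode: "z \<in> Om \<Longrightarrow> ((\<lambda>z. v' z / (cosh (c * z))\<^sup>2) has_real_derivative
      - c\<^sup>2 / (cosh (c * z))\<^sup>2 * (v z + lin_forcing c z)) (at z)"
begin

text \<open>The solutions of the homogeneous equation for \<open>v\<close> are \<open>sinh (c z)\<close> and \<open>cosh (c z) - c z sinh (c z)\<close>. The next
two functions are the Wronskians of \<open>v\<close> with them, multiplied by \<open>1 / cosh\<^sup>2\<close>, the weight that makes the equation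
self-adjoint. The names refer to the parity of the homogeneous solution.\<close>

definition wronskian_odd :: "real \<Rightarrow> real" where
  "wronskian_odd z = v' z / (cosh (c * z))\<^sup>2 * sinh (c * z) - c * v z / cosh (c * z)"

definition wronskian_even :: "real \<Rightarrow> real" where
  "wronskian_even z = v' z / (cosh (c * z))\<^sup>2 * (cosh (c * z) - c * z * sinh (c * z)) + c\<^sup>2 * z * v z / cosh (c * z)"

lemma cosh_nz [simp]: "cosh (x :: real) \<noteq> 0"
  by (metis cosh_real_pos less_irrefl)

lemma v_deriv: "z \<in> Om \<Longrightarrow> (v has_real_derivative v' z) (at z)"
  by (rule C1_deriv_interior[OF C1])

lemma v_continuous: "continuous_on {-1..1} v" and v'_continuous: "continuous_on {-1..1} v'"
  using C1_deriv_continuous[OF C1] C1 by (auto simp: C1_deriv_def)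

lemma wronskian_odd_deriv:
  assumes z: "z \<in> Om"
  shows "(wronskian_odd has_real_derivative - c\<^sup>2 * tanh (c * z) / (log_gap c z)\<^sup>2) (at z)"
proof -
  have L: "log_gap c z \<noteq> 0" using log_gap_pos[of z c] z by auto
  have s: "((\<lambda>z. sinh (c * z)) has_real_derivative cosh (c * z) * c) (at z)"
    by (auto intro!: derivative_eq_intros)
  have t: "((\<lambda>z. c * v z / cosh (c * z)) has_real_derivative
      (c * v' z * cosh (c * z) - c * v z * (sinh (c * z) * c)) / (cosh (c * z) * cosh (c * z))) (at z)"
    by (rule derivative_eq_intros v_deriv z refl | simp)+
  show ?thesis
    by (rule DERIV_cong[OF DERIV_diff[OF DERIV_mult[OF ode[OF z] s] t, folded wronskian_odd_def]])
       (use L in \<open>simp add: lin_forcing_def tanh_def field_simps power2_eq_square\<close>)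
qed

lemma wronskian_even_deriv:
  assumes z: "z \<in> Om"
  shows "(wronskian_even has_real_derivative - c\<^sup>2 * stability_integrand c z) (at z)"
proof -
  have L: "log_gap c z \<noteq> 0" using log_gap_pos[of z c] z by auto
  have s: "((\<lambda>z. cosh (c * z) - c * z * sinh (c * z)) has_real_derivative - c\<^sup>2 * z * cosh (c * z)) (at z)"
    by (auto intro!: derivative_eq_intros simp: algebra_simps power2_eq_square)
  have t: "((\<lambda>z. c\<^sup>2 * z * v z / cosh (c * z)) has_real_derivative
      ((c\<^sup>2 * v z + c\<^sup>2 * z * v' z) * cosh (c * z) - c\<^sup>2 * z * v z * (sinh (c * z) * c)) / (cosh (c * z) * cosh (c * z))) (at z)"
    by (rule derivative_eq_intros v_deriv z refl | simp)+
  show ?thesis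
    by (rule DERIV_cong[OF DERIV_add[OF DERIV_mult[OF ode[OF z] s] t, folded wronskian_even_def]])
       (use L in \<open>simp add: lin_forcing_def tanh_def stability_integrand_def field_simps power2_eq_square\<close>)
qed

lemma wronskian_continuous: "continuous_on {-1..1} wronskian_odd" "continuous_on {-1..1} wronskian_even"
  unfolding wronskian_odd_def[abs_def] wronskian_even_def[abs_def]
  by (intro continuous_intros v_continuous v'_continuous; simp)+

lemma wronskian_odd_even: "z \<in> {-1..1} \<Longrightarrow> wronskian_odd (- z) = wronskian_odd z"
proof -
  define f where "f z = wronskian_odd z - wronskian_odd (- z)" for z
  have d: "(f has_real_derivative 0) (at z)" if "-1 < z" "z < 1" for z
  proof -
    have "((\<lambda>z. wronskian_odd (- z)) has_real_derivative (- c\<^sup>2 * tanh (c * - z) / (log_gap c (- z))\<^sup>2) * (- 1)) (at z)"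
      by (rule DERIV_chain2[OF wronskian_odd_deriv]) (use that in \<open>auto intro!: derivative_eq_intros\<close>)
    then have "(f has_real_derivative - c\<^sup>2 * tanh (c * z) / (log_gap c z)\<^sup>2
        - (- c\<^sup>2 * tanh (c * - z) / (log_gap c (- z))\<^sup>2) * (- 1)) (at z)"
      unfolding f_def[abs_def] using that by (intro DERIV_diff wronskian_odd_deriv) auto
    then show ?thesis by (simp add: log_gap_def)
  qed
  have fc: "continuous_on {-1..1} f" unfolding f_def[abs_def]
    by (intro continuous_intros wronskian_continuous continuous_on_compose2[OF wronskian_continuous(1)]) auto
  have const: "f z = f (- 1)" if "z \<in> {-1..1}" for z
    by (rule DERIV_isconst2[OF _ fc d, of z]) (use that in auto)
  assume "z \<in> {-1..1}"
  then have "f z = 0" using const[of z] const[of 0] by (simp add: f_def)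
  then show "wronskian_odd (- z) = wronskian_odd z" by (simp add: f_def)
qed

lemma quotient_deriv:
  assumes z: "0 < z" "z < 1"
  shows "((\<lambda>z. v z / sinh (c * z)) has_real_derivative wronskian_odd z * (cosh (c * z))\<^sup>2 / (sinh (c * z))\<^sup>2) (at z)"
proof -
  have s: "sinh (c * z) \<noteq> 0" using c z by simp
  have "((\<lambda>z. v z / sinh (c * z)) has_real_derivative
      (v' z * sinh (c * z) - v z * (cosh (c * z) * c)) / (sinh (c * z) * sinh (c * z))) (at z)"
    using z by (rule_tac derivative_eq_intros v_deriv refl s | simp)+
  also have "(v' z * sinh (c * z) - v z * (cosh (c * z) * c)) / (sinh (c * z) * sinh (c * z)) =
      wronskian_odd z * (cosh (c * z))\<^sup>2 / (sinh (c * z))\<^sup>2"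
    using s unfolding wronskian_odd_def by (simp add: field_simps power2_eq_square)
  finally show ?thesis .
qed

text \<open>The derivative of \<open>wronskian_odd\<close> is odd, so \<open>wronskian_odd\<close> itself is even. Hence the Wronskian of the odd part of \<open>v\<close> with
\<open>sinh (c z)\<close> vanishes, the odd part is a multiple of \<open>sinh (c z)\<close>, and the boundary condition at \<open>1\<close> makes
it zero.\<close>

lemma v_even: "z \<in> {-1..1} \<Longrightarrow> v (- z) = v z"
proof -
  define h where "h z = (v z - v (- z)) / sinh (c * z)" for z
  have main: "v (- z) = v z" if z: "0 < z" "z < 1" for z
  proof -
    have d: "(h has_real_derivative 0) (at x)" if "z < x" "x < 1" for x
    proof -
      have x: "0 < x" "x < 1" using z that by auto
      have s: "sinh (c * x) \<noteq> 0" using c x by simp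
      have "((\<lambda>z. v (- z)) has_real_derivative v' (- x) * (- 1)) (at x)"
        by (rule DERIV_chain2[OF v_deriv]) (use x in \<open>auto intro!: derivative_eq_intros\<close>)
      then have "(h has_real_derivative ((v' x - v' (- x) * (- 1)) * sinh (c * x) - (v x - v (- x)) * (cosh (c * x) * c))
          / (sinh (c * x) * sinh (c * x))) (at x)"
        unfolding h_def[abs_def] using x s
        by (intro DERIV_divide DERIV_diff v_deriv) (auto intro!: derivative_eq_intros)
      moreover have "(v' x - v' (- x) * (- 1)) * sinh (c * x) - (v x - v (- x)) * (cosh (c * x) * c)
          = (wronskian_odd x - wronskian_odd (- x)) * (cosh (c * x))\<^sup>2"
        unfolding wronskian_odd_def by (simp add: field_simps power2_eq_square)
      ultimately show ?thesis using wronskian_odd_even[of x] x by simp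
    qed
    have hc: "continuous_on {z..1} h" unfolding h_def[abs_def] using z c
      by (intro continuous_intros continuous_on_compose2[OF v_continuous]) auto
    have "h 1 = h z" by (rule DERIV_isconst2[OF z(2) hc d]) (use z in auto)
    then show ?thesis using bc c z by (simp add: h_def)
  qed
  assume "z \<in> {-1..1}"
  then consider "z = 0" | "z = 1" | "z = -1" | "0 < z \<and> z < 1" | "0 < - z \<and> - z < 1" by fastforce
  then show "v (- z) = v z" using main[of z] main[of "- z"] bc by cases auto
qed

lemma v'_odd: "z \<in> {-1..1} \<Longrightarrow> v' (- z) = - v' z"
proof -
  assume z: "z \<in> {-1..1}"
  have "C1_deriv v (\<lambda>x. - v' (- x))"
    by (rule C1_deriv_cong[OF C1_deriv_mirror[OF C1]]) (rule v_even)
  from C1_deriv_unique[OF this C1 z] show "v' (- z) = - v' z" by simp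
qed

lemma wronskian_even_increment:
  assumes "0 \<le> b" "b \<le> 1"
  shows "wronskian_even b = - c\<^sup>2 * integral {0..b} (stability_integrand c)"
proof -
  have "((\<lambda>z. - c\<^sup>2 * stability_integrand c z) has_integral wronskian_even b - wronskian_even 0) {0..b}"
  proof (rule fundamental_theorem_of_calculus_interior)
    show "continuous_on {0..b} wronskian_even" by (rule continuous_on_subset[OF wronskian_continuous(2)]) (use assms in auto)
    show "(wronskian_even has_vector_derivative - c\<^sup>2 * stability_integrand c z) (at z)" if "z \<in> {0<..<b}" for z
      using wronskian_even_deriv[of z] that assms by (simp add: has_real_derivative_iff_has_vector_derivative)
  qed (use assms in simp)
  then have "integral {0..b} (\<lambda>z. - c\<^sup>2 * stability_integrand c z) = wronskian_even b - wronskian_even 0" by (rule integral_unique)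
  moreover have "wronskian_even 0 = 0" using v'_odd[of 0] by (simp add: wronskian_even_def)
  ultimately show ?thesis by simp
qed

text \<open>At \<open>1\<close> the Wronskian with the even homogeneous solution only contains the slope of \<open>v\<close>, and at \<open>0\<close> it
vanishes because \<open>v\<close> is even.\<close>

lemma boundary_slope:
  "v' 1 * (c * sinh c - cosh c) = c\<^sup>2 * (cosh c)\<^sup>2 * integral {0..1} (stability_integrand c)"
  using wronskian_even_increment[of 1] bc by (simp add: wronskian_even_def field_simps)

lemma wronskian_odd_strict_decreasing:
  assumes "0 \<le> x" "x < y" "y \<le> 1"
  shows "wronskian_odd y < wronskian_odd x"
proof (rule DERIV_neg_imp_decreasing_open[OF assms(2)])
  show "continuous_on {x..y} wronskian_odd" by (rule continuous_on_subset[OF wronskian_continuous(1)]) (use assms in auto)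
  fix z assume z: "x < z" "z < y"
  have "0 < log_gap c z" by (rule log_gap_pos) (use z assms in auto)
  then have "- c\<^sup>2 * tanh (c * z) / (log_gap c z)\<^sup>2 < 0"
    using c z assms by (simp add: divide_neg_pos)
  then show "\<exists>y. (wronskian_odd has_real_derivative y) (at z) \<and> y < 0"
    using wronskian_odd_deriv[of z] z assms by auto
qed

lemma quotient_continuous: "0 < x \<Longrightarrow> continuous_on {x..1} (\<lambda>z. v z / sinh (c * z))"
  using c by (intro continuous_intros continuous_on_subset[OF v_continuous]) auto

text \<open>The derivative of \<open>v / sinh (c z)\<close> has the sign of \<open>wronskian_odd\<close>, which strictly decreases on \<open>[0,1]\<close>.\<close>

lemma quotient_increasing:
  assumes "0 < x" "x < y" "y \<le> 1" "0 \<le> wronskian_odd y"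
  shows "v x / sinh (c * x) < v y / sinh (c * y)"
proof (rule DERIV_pos_imp_increasing_open[OF assms(2)])
  show "continuous_on {x..y} (\<lambda>z. v z / sinh (c * z))"
    by (rule continuous_on_subset[OF quotient_continuous[OF assms(1)]]) (use assms in auto)
  fix z assume z: "x < z" "z < y"
  have "0 < wronskian_odd z" using wronskian_odd_strict_decreasing[of z y] z assms by simp
  moreover have "0 < sinh (c * z)" using c z assms by simp
  ultimately have "0 < wronskian_odd z * (cosh (c * z))\<^sup>2 / (sinh (c * z))\<^sup>2"
    by (intro divide_pos_pos mult_pos_pos zero_less_power cosh_real_pos)
  then show "\<exists>y. ((\<lambda>z. v z / sinh (c * z)) has_real_derivative y) (at z) \<and> 0 < y"
    using quotient_deriv[of z] z assms by auto
qed

lemma quotient_decreasing: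
  assumes "0 < x" "x < y" "y \<le> 1" "wronskian_odd x \<le> 0"
  shows "v y / sinh (c * y) < v x / sinh (c * x)"
proof (rule DERIV_neg_imp_decreasing_open[OF assms(2)])
  show "continuous_on {x..y} (\<lambda>z. v z / sinh (c * z))"
    by (rule continuous_on_subset[OF quotient_continuous[OF assms(1)]]) (use assms in auto)
  fix z assume z: "x < z" "z < y"
  have "wronskian_odd z < 0" using wronskian_odd_strict_decreasing[of x z] z assms by simp
  moreover have "0 < sinh (c * z)" using c z assms by simp
  ultimately have "wronskian_odd z * (cosh (c * z))\<^sup>2 / (sinh (c * z))\<^sup>2 < 0"
    by (intro divide_neg_pos mult_neg_pos zero_less_power cosh_real_pos)
  then show "\<exists>y. ((\<lambda>z. v z / sinh (c * z)) has_real_derivative y) (at z) \<and> y < 0"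
    using quotient_deriv[of z] z assms by auto
qed

lemma sign_of_quotient:
  assumes "0 < z"
  shows "v z / sinh (c * z) < 0 \<longleftrightarrow> v z < 0" "0 < v z / sinh (c * z) \<longleftrightarrow> 0 < v z"
proof -
  have "0 < sinh (c * z)" using assms c by simp
  then show "v z / sinh (c * z) < 0 \<longleftrightarrow> v z < 0" "0 < v z / sinh (c * z) \<longleftrightarrow> 0 < v z"
    by (auto simp: divide_less_0_iff zero_less_divide_iff)
qed

lemma wronskian_odd_1: "wronskian_odd 1 = v' 1 * sinh c / (cosh c)\<^sup>2" and wronskian_odd_0: "wronskian_odd 0 = - c * v 0"
  using bc by (auto simp: wronskian_odd_def)

lemma negative_if_slope_pos:
  assumes s: "0 < v' 1" and z: "0 \<le> z" "z < 1"
  shows "v z < 0"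
proof (cases "z = 0")
  case True
  have "0 < wronskian_odd 1" unfolding wronskian_odd_1 using s c by simp
  then have "0 < wronskian_odd 0" using wronskian_odd_strict_decreasing[of 0 1] by simp
  then show ?thesis using True c unfolding wronskian_odd_0 by (simp add: mult_less_0_iff)
next
  case False
  have "0 \<le> wronskian_odd 1" unfolding wronskian_odd_1 using s c by simp
  then show ?thesis using quotient_increasing[of z 1] sign_of_quotient(1)[of z] False z bc by simp
qed

text \<open>The number \<open>k\<close> is the first zero of the even homogeneous solution. At \<open>\<zeta> = k / c\<close> the Wronskian with that solution
only contains the value of \<open>v\<close>, which is therefore negative. A nonnegative \<open>v 0\<close> would make
\<open>v / sinh (c z)\<close> decrease to \<open>0\<close> on \<open>(0,1]\<close>, contradicting this; so \<open>wronskian_odd\<close> is positive at \<open>0\<close> and,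
by the assumption on the slope, negative at \<open>1\<close>. The quotient \<open>v / sinh (c z)\<close> then increases from negative
values up to the zero \<open>m\<close> of \<open>wronskian_odd\<close> and decreases to \<open>0\<close> afterwards, which leaves one zero, on the
increasing branch and hence simple.\<close>

lemma one_crossing_if_slope_neg:
  assumes s: "v' 1 < 0" and k: "0 < k" "k < c" "k * sinh k = cosh k" "\<And>x. 0 < x \<Longrightarrow> x < k \<Longrightarrow> x * sinh x < cosh x"
  obtains z0 where "0 < z0" "z0 < 1" "v z0 = 0" "0 < v' z0"
    "\<And>z. 0 \<le> z \<Longrightarrow> z < z0 \<Longrightarrow> v z < 0" "\<And>z. z0 < z \<Longrightarrow> z < 1 \<Longrightarrow> 0 < v z"
proof -
  define \<zeta> where "\<zeta> = k / c"
  have \<zeta>: "0 < \<zeta>" "\<zeta> < 1" "c * \<zeta> = k" using k c by (auto simp: \<zeta>_def)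
  have "wronskian_even \<zeta> < wronskian_even 0"
  proof (rule DERIV_neg_imp_decreasing_open[OF \<zeta>(1)])
    show "continuous_on {0..\<zeta>} wronskian_even" by (rule continuous_on_subset[OF wronskian_continuous(2)]) (use \<zeta> in auto)
    fix z assume z: "0 < z" "z < \<zeta>"
    have "c * z < k" using z \<zeta> c by (metis mult_strict_left_mono)
    then have "c * z * sinh (c * z) < cosh (c * z)" using k(4)[of "c * z"] z c by simp
    then have "0 < 1 - c * z * tanh (c * z)" by (simp add: tanh_def field_simps)
    moreover have "0 < log_gap c z" by (rule log_gap_pos) (use z \<zeta> in auto)
    ultimately have "- c\<^sup>2 * stability_integrand c z < 0" using c by (simp add: stability_integrand_def)
    then show "\<exists>y. (wronskian_even has_real_derivative y) (at z) \<and> y < 0"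
      using wronskian_even_deriv[of z] z \<zeta> by auto
  qed
  moreover have "wronskian_even 0 = 0" using v'_odd[of 0] by (simp add: wronskian_even_def)
  moreover have "wronskian_even \<zeta> = c\<^sup>2 * \<zeta> * v \<zeta> / cosh k"
    using k(3) by (simp add: wronskian_even_def \<zeta>(3))
  ultimately have "c\<^sup>2 * \<zeta> * v \<zeta> / cosh k < 0" by simp
  moreover have "0 < c\<^sup>2 * \<zeta>" "0 < cosh k" using c \<zeta> by auto
  ultimately have v\<zeta>: "v \<zeta> < 0" by (metis divide_less_0_iff mult_less_0_iff order_less_asym)
  have w1: "wronskian_odd 1 < 0" unfolding wronskian_odd_1 using s c by (simp add: divide_neg_pos mult_neg_pos)
  have w0: "0 < wronskian_odd 0"
  proof (rule ccontr)
    assume "\<not> 0 < wronskian_odd 0"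
    then have "wronskian_odd \<zeta> \<le> 0" using wronskian_odd_strict_decreasing[of 0 \<zeta>] \<zeta> by simp
    then show False using quotient_decreasing[of \<zeta> 1] sign_of_quotient(2)[of \<zeta>] \<zeta> bc v\<zeta> by simp
  qed
  then have v0: "v 0 < 0" using c unfolding wronskian_odd_0 by (simp add: mult_less_0_iff)
  have "\<exists>m\<ge>0. m \<le> 1 \<and> wronskian_odd m = 0"
    by (rule IVT2') (use w0 w1 continuous_on_subset[OF wronskian_continuous(1), of "{0..1}"] in auto)
  then obtain m where m: "0 < m" "m < 1" "wronskian_odd m = 0"
    using w0 w1 by (metis less_eq_real_def less_irrefl)
  have vm: "0 < v z" if "m \<le> z" "z < 1" for z
  proof -
    have "wronskian_odd z \<le> 0" using wronskian_odd_strict_decreasing[of m z] m that by (cases "z = m") auto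
    then show ?thesis using quotient_decreasing[of z 1] sign_of_quotient(2)[of z] that m bc by simp
  qed
  have "\<exists>z0\<ge>0. z0 \<le> m \<and> v z0 = 0"
    by (rule IVT') (use v0 vm[of m] m continuous_on_subset[OF v_continuous, of "{0..m}"] in auto)
  then obtain z0 where z0: "0 < z0" "z0 < m" "v z0 = 0"
    using v0 vm[of m] m by (metis less_eq_real_def less_irrefl)
  have w: "0 < wronskian_odd z0" using wronskian_odd_strict_decreasing[of z0 m] z0 m by simp
  show ?thesis
  proof (rule that[of z0])
    show "0 < z0" "z0 < 1" "v z0 = 0" using z0 m by auto
    have "0 < v' z0 * sinh (c * z0) / (cosh (c * z0))\<^sup>2" using w z0 by (simp add: wronskian_odd_def)
    moreover have "0 < sinh (c * z0)" using c z0 by simp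
    ultimately show "0 < v' z0"
      by (metis zero_less_divide_iff zero_less_mult_iff order_less_asym cosh_real_pos zero_less_power)
    show "v z < 0" if "0 \<le> z" "z < z0" for z
    proof (cases "z = 0")
      case False
      then show ?thesis using quotient_increasing[of z z0] sign_of_quotient(1)[of z] that z0 m w by simp
    qed (use v0 in simp)
    show "0 < v z" if "z0 < z" "z < 1" for z
    proof (cases "m \<le> z")
      case False
      then have "0 \<le> wronskian_odd z" using wronskian_odd_strict_decreasing[of z m] m z0 that by simp
      then show ?thesis using quotient_increasing[of z0 z] sign_of_quotient(2)[of z] that z0 by simp
    qed (use vm that in simp)
  qed
qed

end

section \<open>Critical catenoid and the sign of the stability integral\<close>

lemma catenoid_gap_strict_mono:
  assumes "0 \<le> x" "x < y"
  shows "x * sinh x - cosh x < y * sinh y - cosh (y::real)"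
proof (rule DERIV_pos_imp_increasing_open[OF assms(2)])
  show "continuous_on {x..y} (\<lambda>x. x * sinh x - cosh x)" by (intro continuous_intros)
  fix t assume t: "x < t" "t < y"
  have "((\<lambda>x. x * sinh x - cosh x) has_real_derivative t * cosh t) (at t)"
    by (auto intro!: derivative_eq_intros simp: algebra_simps)
  moreover have "0 < t * cosh t" using t assms by simp
  ultimately show "\<exists>y. ((\<lambda>x. x * sinh x - cosh x) has_real_derivative y) (at t) \<and> 0 < y" by blast
qed

lemma c_crit: "0 < c_crit" "c_crit * sinh c_crit = cosh c_crit"
proof -
  have "\<exists>x\<ge>0. x \<le> 2 \<and> x * sinh x - cosh x = (0::real)"
  proof (rule IVT')
    have eq: "2 * sinh 2 - cosh (2::real) = (exp 2 - 3 * exp (-2)) / 2"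
      by (simp add: sinh_def cosh_def field_simps)
    have "3 * exp (-2) \<le> 3 * (1::real)" by (intro mult_left_mono) simp_all
    also have "\<dots> \<le> exp 2" using exp_ge_add_one_self[of "2::real"] by simp
    finally show "0 \<le> 2 * sinh 2 - cosh (2::real)" unfolding eq by simp
  qed (auto intro!: continuous_intros)
  then obtain x :: real where x: "0 \<le> x" "x * sinh x = cosh x" by auto
  then have x0: "0 < x" by (cases "x = 0") auto
  have "\<exists>!c. 0 < c \<and> c * sinh c = cosh (c::real)"
  proof (rule ex1I[of _ x])
    show "y = x" if "0 < y \<and> y * sinh y = cosh y" for y
      using catenoid_gap_strict_mono[of x y] catenoid_gap_strict_mono[of y x] that x x0
      by (cases x y rule: linorder_cases) auto
  qed (use x x0 in simp)
  from theI'[OF this] show "0 < c_crit" "c_crit * sinh c_crit = cosh c_crit"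
    by (auto simp: c_crit_def)
qed

lemma below_c_crit: "0 \<le> x \<Longrightarrow> x < c_crit \<Longrightarrow> x * sinh x < cosh x"
  using catenoid_gap_strict_mono[of x c_crit] c_crit by simp

lemma above_c_crit: "c_crit < x \<Longrightarrow> cosh x < x * sinh x"
  using catenoid_gap_strict_mono[of c_crit x] c_crit by simp

text \<open>The derivative of \<open>cosh x / x\<close> has the sign of \<open>x sinh x - cosh x\<close>, which is positive beyond \<open>c_crit\<close>. The
parameter \<open>c_in \<sigma>\<close> of the inner catenoid is thus an increasing function of \<open>\<sigma>\<close>.\<close>

lemma aspect_ratio_strict_mono:
  assumes "c_crit \<le> x" "x < y"
  shows "cosh x / x < cosh y / y"
proof (rule DERIV_pos_imp_increasing_open[OF assms(2)])
  have x0: "0 < x" using c_crit assms by linarith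
  show "continuous_on {x..y} (\<lambda>x. cosh x / x)" using x0 by (intro continuous_intros) auto
  fix t assume t: "x < t" "t < y"
  have "((\<lambda>x. cosh x / x) has_real_derivative (sinh t * t - cosh t) / (t * t)) (at t)"
    using t x0 by (auto intro!: derivative_eq_intros)
  moreover have "0 < (sinh t * t - cosh t) / (t * t)"
    using above_c_crit[of t] t assms x0 by (simp add: mult.commute)
  ultimately show "\<exists>y. ((\<lambda>x. cosh x / x) has_real_derivative y) (at t) \<and> 0 < y" by blast
qed

lemma cosh_over_ge: "0 < x \<Longrightarrow> x / 4 \<le> cosh x / (x :: real)"
proof -
  assume x: "0 < x"
  have "1 + x + x\<^sup>2 / 2 \<le> exp x" using exp_lower_Taylor_quadratic[of x] x by simp
  then have "x\<^sup>2 / 2 \<le> exp x + exp (- x)" using x by (smt (verit) exp_gt_zero)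
  then have "x\<^sup>2 / 4 \<le> cosh x" by (simp add: cosh_def)
  then show ?thesis using x by (simp add: field_simps power2_eq_square)
qed

lemma c_in:
  assumes "sigma_crit < \<sigma>"
  shows "c_crit < c_in \<sigma>" "\<sigma> = cosh (c_in \<sigma>) / c_in \<sigma>"
proof -
  note k = c_crit
  have s0: "0 < \<sigma>" using assms k unfolding sigma_crit_def
    by (meson cosh_real_pos divide_pos_pos less_trans)
  (* cosh x / x is at least x / 4, hence at least \<sigma> at this point *)
  define b where "b = c_crit + 4 * \<sigma>"
  have b: "c_crit < b" "\<sigma> \<le> b / 4" "0 < b" using s0 k by (auto simp: b_def)
  from cosh_over_ge[OF b(3)] b(2) have b2: "\<sigma> \<le> cosh b / b" by (rule order_trans[rotated])
  have "\<exists>x\<ge>c_crit. x \<le> b \<and> cosh x / x = \<sigma>"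
    by (rule IVT') (use assms b b2 k in \<open>auto simp: sigma_crit_def intro!: continuous_intros\<close>)
  then obtain x where x: "c_crit \<le> x" "cosh x / x = \<sigma>" by blast
  then have x1: "c_crit < x" using assms by (cases "x = c_crit") (auto simp: sigma_crit_def)
  have "\<exists>!c. c_crit < c \<and> \<sigma> = cosh c / c"
  proof (rule ex1I[of _ x])
    show "y = x" if "c_crit < y \<and> \<sigma> = cosh y / y" for y
      using aspect_ratio_strict_mono[of x y] aspect_ratio_strict_mono[of y x] that x x1
      by (cases x y rule: linorder_cases) auto
  qed (use x x1 in simp)
  from theI'[OF this] show "c_crit < c_in \<sigma>" "\<sigma> = cosh (c_in \<sigma>) / c_in \<sigma>"
    by (auto simp: c_in_def)
qed

lemma stability_integrand_continuous:
  assumes "A \<subseteq> {-1..1}" shows "continuous_on A (stability_integrand c)"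
proof -
  have "log_gap c z \<noteq> 0" if "z \<in> A" for z using log_gap_pos[of z c] that assms by auto
  then show ?thesis unfolding stability_integrand_def[abs_def] tanh_def
    by (intro continuous_intros log_gap_continuous) (auto simp: less_imp_neq[OF cosh_real_pos, symmetric])
qed

lemma stability_integrable: "0 \<le> a \<Longrightarrow> b \<le> 1 \<Longrightarrow> stability_integrand c integrable_on {a..b}"
  by (intro integrable_continuous_real stability_integrand_continuous) auto

lemma integral_ge_const:
  fixes f :: "real \<Rightarrow> real"
  assumes "f integrable_on {a..b}" "\<And>x. x \<in> {a..b} \<Longrightarrow> m \<le> f x" "a \<le> b"
  shows "m * (b - a) \<le> integral {a..b} f"
  using integral_le[of "\<lambda>_. m" "{a..b}" f] assms by (simp add: mult.commute integrable_const_ivl)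

lemma integral_le_const:
  fixes f :: "real \<Rightarrow> real"
  assumes "f integrable_on {a..b}" "\<And>x. x \<in> {a..b} \<Longrightarrow> f x \<le> m" "a \<le> b"
  shows "integral {a..b} f \<le> m * (b - a)"
  using integral_le[of f "{a..b}" "\<lambda>_. m"] assms by (simp add: mult.commute integrable_const_ivl)

lemma stability_integral_split:
  assumes "0 \<le> a" "a \<le> b" "b \<le> 1"
  shows "integral {0..1} (stability_integrand c) =
    integral {0..a} (stability_integrand c) + integral {a..b} (stability_integrand c) + integral {b..1} (stability_integrand c)"
  using Henstock_Kurzweil_Integration.integral_combine[of 0 a 1 "stability_integrand c"]
    Henstock_Kurzweil_Integration.integral_combine[of a b 1 "stability_integrand c"]
    stability_integrable[of 0 1 c] stability_integrable[of a 1 c] assms by simp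

lemma mult_tanh_mono: "0 \<le> x \<Longrightarrow> x \<le> y \<Longrightarrow> x * tanh x \<le> y * tanh (y::real)"
  by (intro mult_mono) auto

lemma c_crit_tanh: "c_crit * tanh c_crit = 1"
  using c_crit by (simp add: tanh_def less_imp_neq[OF cosh_real_pos, symmetric])

text \<open>The integrand is nonnegative up to \<open>\<zeta> = k / c\<close> and bounded below by a fixed positive constant on \<open>[0, \<zeta> / 2]\<close>.
On the remaining piece it is bounded, and the length \<open>1 - \<zeta>\<close> of that piece tends to \<open>0\<close> as \<open>c\<close> decreases
to \<open>k\<close>.\<close>

lemma stability_integral_pos_near_c_crit:
  obtains c1 where "c_crit < c1" "\<And>c. c_crit < c \<Longrightarrow> c < c1 \<Longrightarrow> 0 < integral {0..1} (stability_integrand c)"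
proof -
  define k where "k = c_crit"
  have k: "0 < k" "k * tanh k = 1" using c_crit c_crit_tanh by (auto simp: k_def)
  define \<Lambda> where "\<Lambda> = ln (2 * cosh (k + 1))"
  have \<Lambda>: "0 < \<Lambda>" unfolding \<Lambda>_def using cosh_real_ge_1[of "k + 1"] by (intro ln_gt_zero) linarith
  define a where "a = 1 - k / 2 * tanh (k / 2)"
  have "k / 2 * tanh (k / 2) \<le> k / 2 * tanh k" using k by (intro mult_left_mono) auto
  then have a: "0 < a" using k by (simp add: a_def)
  (* A bounds the gain on [0, k / (2 c)] from below and B * (c - k) the loss on [k / c, 1] from above *)
  define A where "A = a / \<Lambda>\<^sup>2 * (k / (2 * (k + 1)))"
  have A: "0 < A" using a \<Lambda> k by (simp add: A_def)
  define B where "B = (k + 1) / (ln 2)\<^sup>2 / k"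
  have B: "0 < B" using k by (simp add: B_def)
  define c1 where "c1 = min (k + 1) (k + A / B)"
  show ?thesis
  proof (rule that[of c1])
    show "c_crit < c1" using A B by (simp add: c1_def k_def)
    fix c assume c: "c_crit < c" "c < c1"
    have ck: "0 < c" "k < c" "c < k + 1" "B * (c - k) < A"
      using c k B by (auto simp: c1_def k_def field_simps)
    define \<zeta> where "\<zeta> = k / c"
    have \<zeta>: "0 < \<zeta>" "\<zeta> < 1" "c * \<zeta> = k" using ck k by (auto simp: \<zeta>_def)
    have cz: "c * z \<le> k \<longleftrightarrow> z \<le> \<zeta>" for z using ck by (simp add: \<zeta>_def field_simps)
    have 1: "a / \<Lambda>\<^sup>2 * (\<zeta> / 2 - 0) \<le> integral {0..\<zeta> / 2} (stability_integrand c)"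
    proof (rule integral_ge_const[OF stability_integrable])
      fix z assume z: "z \<in> {0..\<zeta> / 2}"
      then have "c * z \<le> c * (\<zeta> / 2)" using ck by (intro mult_left_mono) auto
      then have "c * z \<le> k / 2" using \<zeta> by simp
      then have "c * z * tanh (c * z) \<le> k / 2 * tanh (k / 2)" using z ck by (intro mult_tanh_mono) auto
      then have n: "a \<le> 1 - c * z * tanh (c * z)" by (simp add: a_def)
      have zz: "z \<in> {-1..1}" using z \<zeta> by auto
      have "2 * cosh c / cosh (c * z) \<le> 2 * cosh (k + 1)"
      proof -
        have "cosh c \<le> cosh (k + 1)" using ck k by (subst cosh_real_nonneg_le_iff) auto
        then have "2 * cosh c \<le> 2 * cosh (k + 1) * 1" by simp
        also have "\<dots> \<le> 2 * cosh (k + 1) * cosh (c * z)" by (intro mult_left_mono cosh_real_ge_1) simp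
        finally show ?thesis by (simp add: divide_le_eq)
      qed
      then have "log_gap c z \<le> \<Lambda>" unfolding log_gap_def \<Lambda>_def by (intro ln_mono) auto
      then have "(log_gap c z)\<^sup>2 \<le> \<Lambda>\<^sup>2" using log_gap_pos[OF zz, of c] by (intro power_mono) auto
      then show "a / \<Lambda>\<^sup>2 \<le> stability_integrand c z"
        unfolding stability_integrand_def using n a log_gap_pos[OF zz, of c] by (intro frac_le) auto
    qed (use \<zeta> in auto)
    have 2: "0 * (\<zeta> - \<zeta> / 2) \<le> integral {\<zeta> / 2..\<zeta>} (stability_integrand c)"
    proof (rule integral_ge_const[OF stability_integrable])
      fix z assume z: "z \<in> {\<zeta> / 2..\<zeta>}"
      then have "c * z * tanh (c * z) \<le> k * tanh k" using cz \<zeta> ck by (intro mult_tanh_mono) auto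
      then show "0 \<le> stability_integrand c z" using k by (simp add: stability_integrand_def)
    qed (use \<zeta> in auto)
    have 3: "- ((k + 1) / (ln 2)\<^sup>2) * (1 - \<zeta>) \<le> integral {\<zeta>..1} (stability_integrand c)"
    proof (rule integral_ge_const[OF stability_integrable])
      fix z assume z: "z \<in> {\<zeta>..1}"
      then have zz: "z \<in> {-1..1}" using \<zeta> by auto
      have "c * z \<le> c * 1" using z ck by (intro mult_left_mono) auto
      then have "c * z \<le> c" by simp
      also have "c \<le> k + 1" using ck by simp
      finally have cz: "c * z \<le> k + 1" .
      have cz0: "0 \<le> c * z" using z \<zeta> ck by simp
      have "c * z * tanh (c * z) \<le> (k + 1) * 1" using cz cz0 by (intro mult_mono) (auto simp: less_imp_le[OF tanh_real_lt_1])
      then have "- (k + 1) \<le> 1 - c * z * tanh (c * z)" by simp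
      then have "- (k + 1) / (log_gap c z)\<^sup>2 \<le> stability_integrand c z"
        unfolding stability_integrand_def by (intro divide_right_mono) auto
      moreover have "(ln 2)\<^sup>2 \<le> (log_gap c z)\<^sup>2" using log_gap_ge[OF zz, of c] by (intro power_mono) auto
      then have "(k + 1) / (log_gap c z)\<^sup>2 \<le> (k + 1) / (ln 2)\<^sup>2" using k by (intro frac_le) auto
      moreover have "- ((k + 1) / (log_gap c z)\<^sup>2) = - (k + 1) / (log_gap c z)\<^sup>2" by (rule minus_divide_left)
      ultimately show "- ((k + 1) / (ln 2)\<^sup>2) \<le> stability_integrand c z" by linarith
    qed (use \<zeta> in auto)
    have "A \<le> a / \<Lambda>\<^sup>2 * (\<zeta> / 2 - 0)"
    proof -
      have "k / (k + 1) \<le> \<zeta>" using ck k by (simp add: \<zeta>_def frac_le)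
      moreover have "k / (2 * (k + 1)) = k / (k + 1) / 2" by (simp only: divide_divide_eq_left mult.commute)
      ultimately have "k / (2 * (k + 1)) \<le> \<zeta> / 2 - 0" by (simp only: diff_zero divide_right_mono)
      then show ?thesis unfolding A_def using a by (intro mult_left_mono) auto
    qed
    moreover have "(k + 1) / (ln 2)\<^sup>2 * (1 - \<zeta>) \<le> B * (c - k)"
    proof -
      have "1 - \<zeta> = (c - k) / c" using ck by (simp add: \<zeta>_def diff_divide_distrib)
      also have "\<dots> \<le> (c - k) / k" using ck k by (intro frac_le) auto
      finally have "(k + 1) / (ln 2)\<^sup>2 * (1 - \<zeta>) \<le> (k + 1) / (ln 2)\<^sup>2 * ((c - k) / k)"
        using k by (intro mult_left_mono) auto
      then show ?thesis by (simp add: B_def)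
    qed
    ultimately show "0 < integral {0..1} (stability_integrand c)"
      using stability_integral_split[of "\<zeta> / 2" \<zeta> c] 1 2 3 ck(4) \<zeta> by simp
  qed
qed

text \<open>On \<open>[0, k / c]\<close> the integrand is at most \<open>1 / (ln 2)\<^sup>2\<close>, then it is nonpositive, and on the last piece of length
\<open>1 / c\<close> the logarithm is at most \<open>ln 2 + 1\<close> while \<open>1 - c z tanh (c z)\<close> is below a quantity that tends to
minus infinity with \<open>c\<close>. The first and the last piece both have a length proportional to \<open>1 / c\<close>, so the
last one wins.\<close>

lemma stability_integral_neg_for_large_c:
  obtains c2 where "\<And>c. c2 < c \<Longrightarrow> integral {0..1} (stability_integrand c) < 0"
proof -
  define k where "k = c_crit"
  have k: "0 < k" "k * tanh k = 1" using c_crit c_crit_tanh by (auto simp: k_def)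
  define E where "E = (ln 2 + 1 :: real)\<^sup>2"
  have E: "0 < E" by (simp add: E_def) (metis add_pos_pos ln_gt_zero less_irrefl one_less_numeral_iff semiring_norm(76) zero_less_one)
  have t1: "0 < tanh (1::real)" by simp
  (* large enough for (c - 1) * tanh 1 to exceed k / (ln 2)^2 * E + 1 *)
  define c2 where "c2 = k + 2 + (k / (ln 2)\<^sup>2 * E + 1) / tanh 1"
  show ?thesis
  proof (rule that[of c2])
    fix c assume c: "c2 < c"
    have "0 \<le> (k / (ln 2)\<^sup>2 * E + 1) / tanh 1" using k E t1 by auto
    then have ck: "0 < c" "k < c - 1" "2 \<le> c" using c k by (auto simp: c2_def)
    have big: "k / (ln 2)\<^sup>2 * E + 1 < (c - 1) * tanh (c - 1)"
    proof -
      have "(k / (ln 2)\<^sup>2 * E + 1) / tanh 1 < c - 1" using c k by (simp add: c2_def)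
      then have "k / (ln 2)\<^sup>2 * E + 1 < (c - 1) * tanh 1" using t1 by (simp add: pos_divide_less_eq)
      also have "\<dots> \<le> (c - 1) * tanh (c - 1)" using ck by (intro mult_left_mono) auto
      finally show ?thesis .
    qed
    define \<zeta> where "\<zeta> = k / c"
    define s where "s = 1 - 1 / c"
    have \<zeta>: "0 < \<zeta>" "\<zeta> \<le> s" "c * \<zeta> = k" and s: "s < 1" "c * s = c - 1"
      using ck k by (auto simp: \<zeta>_def s_def field_simps)
    have 1: "integral {0..\<zeta>} (stability_integrand c) \<le> 1 / (ln 2)\<^sup>2 * (\<zeta> - 0)"
    proof (rule integral_le_const[OF stability_integrable])
      fix z assume z: "z \<in> {0..\<zeta>}"
      then have zz: "z \<in> {-1..1}" using \<zeta> s by auto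
      have "(ln 2)\<^sup>2 \<le> (log_gap c z)\<^sup>2" using log_gap_ge[OF zz, of c] by (intro power_mono) auto
      moreover have "c * z * tanh (c * z) \<ge> 0" using z ck by simp
      moreover have "c * z * tanh (c * z) \<le> k * tanh k"
        using z ck \<zeta> mult_left_mono[of z \<zeta> c] by (intro mult_tanh_mono) auto
      ultimately show "stability_integrand c z \<le> 1 / (ln 2)\<^sup>2"
        unfolding stability_integrand_def using k by (intro frac_le) auto
    qed (use \<zeta> s in auto)
    have 2: "integral {\<zeta>..s} (stability_integrand c) \<le> 0 * (s - \<zeta>)"
    proof (rule integral_le_const[OF stability_integrable])
      fix z assume z: "z \<in> {\<zeta>..s}"
      then have "k * tanh k \<le> c * z * tanh (c * z)"
        using ck \<zeta> k mult_left_mono[of \<zeta> z c] by (intro mult_tanh_mono) auto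
      then show "stability_integrand c z \<le> 0" using k by (simp add: stability_integrand_def divide_nonpos_nonneg)
    qed (use \<zeta> s in auto)
    have 3: "integral {s..1} (stability_integrand c) \<le> (1 - (c - 1) * tanh (c - 1)) / E * (1 - s)"
    proof (rule integral_le_const[OF stability_integrable])
      fix z assume z: "z \<in> {s..1}"
      then have zz: "z \<in> {-1..1}" using \<zeta> s by auto
      have cz: "c - 1 \<le> c * z" "c * z \<le> c" using z ck s mult_left_mono[of s z c] mult_left_le[of z c] by auto
      have n: "(c - 1) * tanh (c - 1) \<le> c * z * tanh (c * z)" using cz ck by (intro mult_tanh_mono) auto
      have "2 * cosh c / cosh (c * z) \<le> 2 * exp 1"
      proof -
        have "cosh c \<le> exp (c - c * z) * cosh (c * z)"
        proof -
          have "exp (c - c * z) * cosh (c * z) = (exp c + exp (c - 2 * (c * z))) / 2"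
            by (simp add: cosh_def distrib_left exp_add[symmetric])
          moreover have "exp (- c) \<le> exp (c - 2 * (c * z))" using cz by simp
          ultimately show ?thesis by (simp add: cosh_def)
        qed
        also have "\<dots> \<le> exp 1 * cosh (c * z)" using cz by (intro mult_right_mono) auto
        finally show ?thesis by (simp add: divide_le_eq)
      qed
      then have "log_gap c z \<le> ln (2 * exp 1)" unfolding log_gap_def by (intro ln_mono) auto
      also have "\<dots> = ln 2 + 1" by (simp add: ln_mult)
      finally have "(log_gap c z)\<^sup>2 \<le> E" unfolding E_def using log_gap_pos[OF zz, of c] by (intro power_mono) auto
      moreover have "1 - (c - 1) * tanh (c - 1) \<le> 0" 
        using big k E by (smt (verit) divide_nonneg_nonneg mult_nonneg_nonneg zero_le_power2)
      ultimately have "(1 - (c - 1) * tanh (c - 1)) / (log_gap c z)\<^sup>2 \<le> (1 - (c - 1) * tanh (c - 1)) / E"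
        using log_gap_pos[OF zz, of c] E by (intro divide_left_mono_neg) auto
      moreover have "stability_integrand c z \<le> (1 - (c - 1) * tanh (c - 1)) / (log_gap c z)\<^sup>2"
        unfolding stability_integrand_def using n by (intro divide_right_mono) auto
      ultimately show "stability_integrand c z \<le> (1 - (c - 1) * tanh (c - 1)) / E" by linarith
    qed (use \<zeta> s in auto)
    have "integral {0..1} (stability_integrand c) \<le> 1 / (ln 2)\<^sup>2 * \<zeta> + (1 - (c - 1) * tanh (c - 1)) / E * (1 - s)"
      using stability_integral_split[of \<zeta> s c] 1 2 3 \<zeta> s by simp
    also have "\<dots> = (k / (ln 2)\<^sup>2 + (1 - (c - 1) * tanh (c - 1)) / E) / c"
      by (simp add: \<zeta>_def s_def add_divide_distrib)
    also have "\<dots> < 0"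
    proof (rule divide_neg_pos)
      have "(1 - (c - 1) * tanh (c - 1)) / E < - (k / (ln 2)\<^sup>2)"
        using big E by (simp add: pos_divide_less_eq)
      then show "k / (ln 2)\<^sup>2 + (1 - (c - 1) * tanh (c - 1)) / E < 0" by simp
    qed (rule ck(1))
    finally show "integral {0..1} (stability_integrand c) < 0" .
  qed
qed

section \<open>Persistence of sign patterns\<close>

definition C1_close :: "real \<Rightarrow> real set \<Rightarrow> (real \<Rightarrow> real) \<Rightarrow> (real \<Rightarrow> real) \<Rightarrow> (real \<Rightarrow> real) \<Rightarrow> (real \<Rightarrow> real) \<Rightarrow> bool" where
  "C1_close \<epsilon> A f f' d d' \<longleftrightarrow>
     (\<forall>x\<in>A. (d has_real_derivative d' x) (at x within A) \<and> \<bar>d x - f x\<bar> < \<epsilon> \<and> \<bar>d' x - f' x\<bar> < \<epsilon>)"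

lemma C1_close_subset:
  "C1_close \<epsilon> A f f' d d' \<Longrightarrow> B \<subseteq> A \<Longrightarrow> \<epsilon> \<le> \<epsilon>' \<Longrightarrow> C1_close \<epsilon>' B f f' d d'"
  unfolding C1_close_def by (meson DERIV_subset less_le_trans subsetD)

lemma C1_close_minus:
  "C1_close \<epsilon> A f f' d d' \<Longrightarrow> C1_close \<epsilon> A (\<lambda>x. - f x) (\<lambda>x. - f' x) (\<lambda>x. - d x) (\<lambda>x. - d' x)"
  unfolding C1_close_def by (auto intro!: DERIV_minus simp: abs_minus_commute)

lemma C1_close_mirror:
  assumes d: "C1_deriv d d'" and close: "C1_close \<epsilon> {-1..1} f f' d d'"
    and even: "\<And>x. x \<in> {-1..1} \<Longrightarrow> f (- x) = f x" "\<And>x. x \<in> {-1..1} \<Longrightarrow> f' (- x) = - f' x"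
  shows "C1_close \<epsilon> {-1..1} f f' (\<lambda>x. d (- x)) (\<lambda>x. - d' (- x))"
  unfolding C1_close_def
proof (intro ballI conjI)
  fix x :: real assume x: "x \<in> {-1..1}"
  then have mx: "- x \<in> {-1..1}" by auto
  show "((\<lambda>x. d (- x)) has_real_derivative - d' (- x)) (at x within {-1..1})"
    using C1_deriv_mirror[OF d] x by (simp add: C1_deriv_def)
  have "\<bar>d (- x) - f (- x)\<bar> < \<epsilon>" "\<bar>d' (- x) - f' (- x)\<bar> < \<epsilon>"
    using close mx unfolding C1_close_def by blast+
  then show "\<bar>d (- x) - f x\<bar> < \<epsilon>" "\<bar>- d' (- x) - f' x\<bar> < \<epsilon>"
    unfolding even[OF x] by linarith+
qed

lemma C1_close_increasing:
  assumes d: "C1_close \<epsilon> {a..b} f f' d d'" and f': "\<And>x. x \<in> {a..b} \<Longrightarrow> \<epsilon> \<le> f' x"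
    and xy: "a \<le> x" "x < y" "y \<le> b"
  shows "d x < d y"
proof (rule DERIV_pos_imp_increasing_open[OF xy(2)])
  have D: "(d has_real_derivative d' t) (at t within {a..b})" "0 < d' t" if "t \<in> {a..b}" for t
    using d f'[OF that] that unfolding C1_close_def by (fastforce simp: abs_less_iff)+
  have "continuous_on {a..b} d" using D(1) by (meson DERIV_continuous continuous_on_eq_continuous_within)
  then show "continuous_on {x..y} d" by (rule continuous_on_subset) (use xy in auto)
  fix t assume t: "x < t" "t < y"
  then have "(d has_real_derivative d' t) (at t)" using D(1)[of t] xy by (simp add: at_within_Icc_at)
  then show "\<exists>y. (d has_real_derivative y) (at t) \<and> 0 < y" using D(2)[of t] t xy by auto
qed

lemma positive_slope_nearby:
  fixes f' :: "real \<Rightarrow> real"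
  assumes "continuous_on {a..b} f'" "z \<in> {a..b}" "0 < f' z"
  obtains \<rho> where "0 < \<rho>" "\<And>x. x \<in> {a..b} \<Longrightarrow> \<bar>x - z\<bar> \<le> \<rho> \<Longrightarrow> f' z / 2 \<le> f' x"
proof -
  obtain \<rho> where \<rho>: "0 < \<rho>" "\<And>x. x \<in> {a..b} \<Longrightarrow> \<bar>x - z\<bar> < \<rho> \<Longrightarrow> \<bar>f' x - f' z\<bar> < f' z / 2"
    using assms unfolding continuous_on_iff dist_real_def by (metis half_gt_zero)
  show ?thesis
  proof (rule that[of "\<rho> / 2"])
    fix x assume "x \<in> {a..b}" "\<bar>x - z\<bar> \<le> \<rho> / 2"
    then have "\<bar>f' x - f' z\<bar> < f' z / 2" using \<rho> by auto
    then show "f' z / 2 \<le> f' x" by linarith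
  qed (use \<rho> in simp)
qed

lemma negative_bounded_away:
  fixes f :: "real \<Rightarrow> real"
  assumes "continuous_on {a..b} f" "\<And>x. x \<in> {a..b} \<Longrightarrow> f x < 0"
  obtains m where "0 < m" "\<And>x. x \<in> {a..b} \<Longrightarrow> f x \<le> - m"
proof (cases "a \<le> b")
  case True
  then obtain x0 where "x0 \<in> {a..b}" "\<And>x. x \<in> {a..b} \<Longrightarrow> f x \<le> f x0"
    using continuous_attains_sup[OF compact_Icc _ assms(1)] by force
  then show ?thesis using that[of "- f x0"] assms(2) by force
qed (use that[of 1] in auto)

text \<open>Near \<open>b\<close> the slope is bounded below and forces \<open>d\<close> to increase to \<open>d b = 0\<close>; elsewhere \<open>f\<close> is bounded away
from \<open>0\<close>.\<close>

lemma stable_negativity: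
  fixes f f' :: "real \<Rightarrow> real"
  assumes ab: "a < b" and f: "continuous_on {a..b} f" and f': "continuous_on {a..b} f'"
    and neg: "\<And>x. a \<le> x \<Longrightarrow> x < b \<Longrightarrow> f x < 0" and s: "0 < f' b"
  shows "\<exists>\<epsilon>>0. \<forall>d d'. C1_close \<epsilon> {a..b} f f' d d' \<longrightarrow> d b = 0 \<longrightarrow> (\<forall>x. a \<le> x \<longrightarrow> x < b \<longrightarrow> d x < 0)"
proof -
  obtain \<rho> where \<rho>: "0 < \<rho>" "\<And>x. x \<in> {a..b} \<Longrightarrow> \<bar>x - b\<bar> \<le> \<rho> \<Longrightarrow> f' b / 2 \<le> f' x"
    using positive_slope_nearby[OF f' _ s] ab by auto
  obtain m where m: "0 < m" "\<And>x. x \<in> {a..b-\<rho>} \<Longrightarrow> f x \<le> - m"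
  proof (rule negative_bounded_away[of a "b - \<rho>" f])
    show "continuous_on {a..b-\<rho>} f" by (rule continuous_on_subset[OF f]) (use \<rho> in auto)
    show "f x < 0" if "x \<in> {a..b-\<rho>}" for x using neg[of x] that \<rho> by simp
  qed (rule that; assumption)
  define \<epsilon> where "\<epsilon> = min (f' b / 2) m"
  have \<epsilon>: "0 < \<epsilon>" "\<epsilon> \<le> f' b / 2" "\<epsilon> \<le> m" using s m by (auto simp: \<epsilon>_def)
  have "d x < 0" if d: "C1_close \<epsilon> {a..b} f f' d d'" and db: "d b = 0" and x: "a \<le> x" "x < b" for d d' x
  proof (cases "x \<le> b - \<rho>")
    case True
    then have "\<bar>d x - f x\<bar> < \<epsilon>" "f x \<le> - m" using d m x by (auto simp: C1_close_def)
    then show ?thesis using \<epsilon> by linarith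
  next
    case False
    define a' where "a' = max a (b - \<rho>)"
    have "d x < d b"
    proof (rule C1_close_increasing[where d = d and a = a' and b = b])
      show "C1_close \<epsilon> {a'..b} f f' d d'" by (rule C1_close_subset[OF d]) (auto simp: a'_def)
      show "\<epsilon> \<le> f' y" if "y \<in> {a'..b}" for y
        using \<rho>(2)[of y] that \<epsilon> by (auto simp: a'_def intro: order_trans)
    qed (use x False in \<open>auto simp: a'_def\<close>)
    then show ?thesis using db by simp
  qed
  then show ?thesis using \<epsilon>(1) by blast
qed

text \<open>Near \<open>z\<close> the perturbed function is strictly increasing and has exactly one zero; away from \<open>z\<close> it keeps the sign
of \<open>f\<close>.\<close>

lemma stable_simple_zero:
  fixes f f' :: "real \<Rightarrow> real"
  assumes z: "a < z" "z < b" and f: "continuous_on {a..b} f" and f': "continuous_on {a..b} f'"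
    and neg: "\<And>x. a \<le> x \<Longrightarrow> x < z \<Longrightarrow> f x < 0" and pos: "\<And>x. z < x \<Longrightarrow> x \<le> b \<Longrightarrow> 0 < f x" and s: "0 < f' z"
  shows "\<exists>\<epsilon>>0. \<forall>d d'. C1_close \<epsilon> {a..b} f f' d d' \<longrightarrow> (\<exists>y. {x \<in> {a..b}. d x = 0} = {y} \<and> a < y \<and> y < b)"
proof -
  obtain \<rho>0 where \<rho>0: "0 < \<rho>0" "\<And>x. x \<in> {a..b} \<Longrightarrow> \<bar>x - z\<bar> \<le> \<rho>0 \<Longrightarrow> f' z / 2 \<le> f' x"
    using positive_slope_nearby[OF f' _ s] z by auto
  define \<rho> where "\<rho> = min \<rho>0 (min (z - a) (b - z))"
  have \<rho>: "0 < \<rho>" "\<rho> \<le> \<rho>0" "a \<le> z - \<rho>" "z + \<rho> \<le> b" using \<rho>0 z by (auto simp: \<rho>_def)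
  obtain m1 where m1: "0 < m1" "\<And>x. x \<in> {a..z-\<rho>} \<Longrightarrow> f x \<le> - m1"
  proof (rule negative_bounded_away[of a "z - \<rho>" f])
    show "continuous_on {a..z-\<rho>} f" by (rule continuous_on_subset[OF f]) (use \<rho> z in auto)
    show "f x < 0" if "x \<in> {a..z-\<rho>}" for x using neg[of x] that \<rho> by simp
  qed (rule that; assumption)
  obtain m2 where m2: "0 < m2" "\<And>x. x \<in> {z+\<rho>..b} \<Longrightarrow> - f x \<le> - m2"
  proof (rule negative_bounded_away[of "z + \<rho>" b "\<lambda>x. - f x"])
    show "continuous_on {z+\<rho>..b} (\<lambda>x. - f x)"
      by (intro continuous_on_minus continuous_on_subset[OF f]) (use \<rho> z in auto)
    show "- f x < 0" if "x \<in> {z+\<rho>..b}" for x using pos[of x] that \<rho> by simp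
  qed (rule that; assumption)
  define \<epsilon> where "\<epsilon> = min (f' z / 2) (min m1 m2)"
  have \<epsilon>: "0 < \<epsilon>" "\<epsilon> \<le> f' z / 2" "\<epsilon> \<le> m1" "\<epsilon> \<le> m2" using s m1 m2 by (auto simp: \<epsilon>_def)
  have "\<exists>y. {x \<in> {a..b}. d x = 0} = {y} \<and> a < y \<and> y < b" if d: "C1_close \<epsilon> {a..b} f f' d d'" for d d'
  proof -
    have close: "\<bar>d x - f x\<bar> < \<epsilon>" if "x \<in> {a..b}" for x using d that by (simp add: C1_close_def)
    have dneg: "d x < 0" if "x \<in> {a..z-\<rho>}" for x
      using close[of x] m1(2)[OF that] \<epsilon> that \<rho> z by auto
    have dpos: "0 < d x" if "x \<in> {z+\<rho>..b}" for x
      using close[of x] m2(2)[OF that] \<epsilon> that \<rho> z by auto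
    have inc: "d x < d y" if "z - \<rho> \<le> x" "x < y" "y \<le> z + \<rho>" for x y
    proof (rule C1_close_increasing[where d = d and a = "z - \<rho>" and b = "z + \<rho>"])
      show "C1_close \<epsilon> {z-\<rho>..z+\<rho>} f f' d d'" by (rule C1_close_subset[OF d]) (use \<rho> in auto)
      show "\<epsilon> \<le> f' y" if "y \<in> {z-\<rho>..z+\<rho>}" for y
      proof -
        have "\<bar>y - z\<bar> \<le> \<rho>0" using that \<rho> by (simp add: abs_le_iff)
        then show ?thesis using \<rho>0(2)[of y] that \<epsilon> \<rho> by auto
      qed
    qed (use that in auto)
    have dc: "continuous_on {a..b} d"
      using d unfolding C1_close_def by (meson DERIV_continuous continuous_on_eq_continuous_within)
    have "\<exists>y\<ge>z-\<rho>. y \<le> z + \<rho> \<and> d y = 0"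
      by (rule IVT') (use dneg[of "z - \<rho>"] dpos[of "z + \<rho>"] \<rho> continuous_on_subset[OF dc, of "{z-\<rho>..z+\<rho>}"] in auto)
    then obtain y where y: "z - \<rho> \<le> y" "y \<le> z + \<rho>" "d y = 0" by blast
    have "y \<noteq> a" "y \<noteq> b" using y dneg[of a] dpos[of b] \<rho> by auto
    then have yab: "a < y" "y < b" using y \<rho> by auto
    have "x = y" if "x \<in> {a..b}" "d x = 0" for x
    proof -
      have "z - \<rho> \<le> x" "x \<le> z + \<rho>" using that dneg[of x] dpos[of x] by force+
      then show ?thesis using inc[of x y] inc[of y x] y that by (cases x y rule: linorder_cases) auto
    qed
    then have "{x \<in> {a..b}. d x = 0} = {y}" using y yab by auto
    then show ?thesis using yab by blast
  qed
  then show ?thesis using \<epsilon>(1) by blast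
qed

lemma stable_single_zero_on_half:
  fixes f f' :: "real \<Rightarrow> real"
  assumes f: "continuous_on {0..1} f" and f': "continuous_on {0..1} f'"
    and z: "0 < z" "z < 1" and neg: "\<And>x. 0 \<le> x \<Longrightarrow> x < z \<Longrightarrow> f x < 0"
    and pos: "\<And>x. z < x \<Longrightarrow> x < 1 \<Longrightarrow> 0 < f x" and s: "0 < f' z" "f' 1 < 0"
  shows "\<exists>\<epsilon>>0. \<forall>d d'. C1_close \<epsilon> {0..1} f f' d d' \<longrightarrow> d 1 = 0 \<longrightarrow>
    (\<exists>y. {x. 0 \<le> x \<and> x < 1 \<and> d x = 0} = {y} \<and> 0 < y \<and> y < 1)"
proof -
  (* any point between z and 1 separates the simple zero from the boundary zero *)
  define m where "m = (z + 1) / 2"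
  have m: "z < m" "m < 1" "0 < m" using z by (auto simp: m_def)
  have c: "continuous_on {0..m} f" "continuous_on {0..m} f'" "continuous_on {m..1} f" "continuous_on {m..1} f'"
    using m by (auto intro: continuous_on_subset[OF f] continuous_on_subset[OF f'])
  have "\<exists>\<epsilon>>0. \<forall>d d'. C1_close \<epsilon> {0..m} f f' d d' \<longrightarrow> (\<exists>y. {x \<in> {0..m}. d x = 0} = {y} \<and> 0 < y \<and> y < m)"
  proof (rule stable_simple_zero[OF z(1) m(1) c(1,2) neg _ s(1)])
    show "0 < f x" if "z < x" "x \<le> m" for x using pos[of x] that m by simp
  qed
  then obtain \<epsilon>1 where \<epsilon>1: "0 < \<epsilon>1" "\<And>d d'. C1_close \<epsilon>1 {0..m} f f' d d' \<Longrightarrow>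
      \<exists>y. {x \<in> {0..m}. d x = 0} = {y} \<and> 0 < y \<and> y < m"
    by blast
  have "\<exists>\<epsilon>>0. \<forall>d d'. C1_close \<epsilon> {m..1} (\<lambda>x. - f x) (\<lambda>x. - f' x) d d' \<longrightarrow> d 1 = 0 \<longrightarrow>
      (\<forall>x. m \<le> x \<longrightarrow> x < 1 \<longrightarrow> d x < 0)"
  proof (rule stable_negativity[OF m(2) continuous_on_minus[OF c(3)] continuous_on_minus[OF c(4)]])
    show "- f x < 0" if "m \<le> x" "x < 1" for x using pos[of x] that m by simp
    show "0 < - f' 1" using s by simp
  qed
  then obtain \<epsilon>2 where \<epsilon>2: "0 < \<epsilon>2" "\<And>d d'. C1_close \<epsilon>2 {m..1} (\<lambda>x. - f x) (\<lambda>x. - f' x) d d' \<Longrightarrow> d 1 = 0 \<Longrightarrow>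
      (\<forall>x. m \<le> x \<longrightarrow> x < 1 \<longrightarrow> d x < 0)"
    by blast
  define \<epsilon> where "\<epsilon> = min \<epsilon>1 \<epsilon>2"
  have "\<exists>y. {x. 0 \<le> x \<and> x < 1 \<and> d x = 0} = {y} \<and> 0 < y \<and> y < 1"
    if d: "C1_close \<epsilon> {0..1} f f' d d'" and d1: "d 1 = 0" for d d'
  proof -
    have "C1_close \<epsilon>1 {0..m} f f' d d'" "C1_close \<epsilon>2 {m..1} f f' d d'"
      using m by (auto intro!: C1_close_subset[OF d] simp: \<epsilon>_def)
    note close = this
    obtain y where y: "{x \<in> {0..m}. d x = 0} = {y}" "0 < y" "y < m"
      using \<epsilon>1(2)[OF close(1)] by blast
    have p: "- d x < 0" if "m \<le> x" "x < 1" for x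
      using \<epsilon>2(2)[OF C1_close_minus[OF close(2)]] d1 that by simp
    have "{x. 0 \<le> x \<and> x < 1 \<and> d x = 0} = {x \<in> {0..m}. d x = 0}"
    proof (intro equalityI subsetI)
      fix x assume "x \<in> {x. 0 \<le> x \<and> x < 1 \<and> d x = 0}"
      then show "x \<in> {x \<in> {0..m}. d x = 0}" using p[of x] by (cases "m \<le> x") auto
    qed (use m in auto)
    then show ?thesis using y m by auto
  qed
  then show ?thesis using \<epsilon>1(1) \<epsilon>2(1) by (intro exI[of _ \<epsilon>]) (auto simp: \<epsilon>_def)
qed

section \<open>Comparison along the solution curve\<close>

definition secant :: "(real \<Rightarrow> real \<Rightarrow> real) \<Rightarrow> real \<Rightarrow> real \<Rightarrow> real \<Rightarrow> real" where
  "secant u l' l x = (u l x - u l' x) / (l - l')"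

text \<open>The property \<open>Q\<close> holds in a \<open>C\<^sup>1\<close> neighbourhood of \<open>v\<close> within the functions vanishing at \<open>-1\<close> and \<open>1\<close>.\<close>

definition holds_C1_near ::
    "(real \<Rightarrow> real) \<Rightarrow> (real \<Rightarrow> real) \<Rightarrow> ((real \<Rightarrow> real) \<Rightarrow> bool) \<Rightarrow> bool" where
  "holds_C1_near v v' Q \<longleftrightarrow> (\<exists>\<epsilon>>0. \<forall>d d'. C1_deriv d d' \<longrightarrow>
     C1_close \<epsilon> {-1..1} v v' d d' \<longrightarrow> d (-1) = 0 \<longrightarrow> d 1 = 0 \<longrightarrow> Q d)"

text \<open>The secants of the curve are \<open>C\<^sup>1\<close>-close to \<open>v\<close>, uniformly for \<open>0 \<le> l' < l < \<delta>\<close>; so they have every property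
that is stable near \<open>v\<close>.\<close>

lemma inner_curve_linearization:
  assumes q: "1 \<le> q" and \<sigma>: "sigma_crit < \<sigma>" and \<delta>0: "0 < \<delta>0" and u: "inner_solution_curve q \<sigma> \<delta>0 u"
  obtains v v' where "linearized (c_in \<sigma>) v v'"
    "\<And>Q. holds_C1_near v v' Q \<Longrightarrow>
      \<exists>\<delta>>0. \<delta> \<le> \<delta>0 \<and> (\<forall>l' l. 0 \<le> l' \<and> l' < l \<and> l < \<delta> \<longrightarrow> Q (secant u l' l))"
proof -
  define c where "c = c_in \<sigma>"
  have c: "0 < c" "\<sigma> = cosh c / c" using c_in[OF \<sigma>] c_crit by (auto simp: c_def)
  have an: "analytic_W2qD q {0..<\<delta>0} u" and u0: "\<And>z. z \<in> {-1..1} \<Longrightarrow> u 0 z = cosh (c * z) / cosh c - 1"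
    and sol: "\<And>l. 0 \<le> l \<Longrightarrow> l < \<delta>0 \<Longrightarrow> solves_SAR q \<sigma> l (u l)"
    using u by (auto simp: inner_solution_curve_def u_in_def c_def)
  obtain P v v' C \<delta>1 where \<delta>1: "0 < \<delta>1" "\<delta>1 \<le> \<delta>0" and C: "0 \<le> C"
    and P: "\<And>l. 0 \<le> l \<Longrightarrow> l < \<delta>1 \<Longrightarrow> C1_deriv (u l) (P l)"
    and v: "C1_deriv v v'" "v (-1) = 0" "v 1 = 0"
    and eu: "\<And>l l' x. 0 \<le> l' \<Longrightarrow> l' < l \<Longrightarrow> l < \<delta>1 \<Longrightarrow> x \<in> {-1..1} \<Longrightarrow>
       \<bar>u l x - u l' x - (l - l') * v x\<bar> \<le> C * l * (l - l')"
    and eP: "\<And>l l' x. 0 \<le> l' \<Longrightarrow> l' < l \<Longrightarrow> l < \<delta>1 \<Longrightarrow> x \<in> {-1..1} \<Longrightarrow>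
       \<bar>P l x - P l' x - (l - l') * v' x\<bar> \<le> C * l * (l - l')"
    by (rule analytic_curve_C1_expansion[OF q \<delta>0 an]) (rule that; assumption)
  have lin: "linearized c v v'"
  proof
    fix z assume z: "z \<in> Om"
    show "((\<lambda>z. v' z / (cosh (c * z))\<^sup>2) has_real_derivative
      - c\<^sup>2 / (cosh (c * z))\<^sup>2 * (v z + lin_forcing c z)) (at z)"
    proof (rule linearized_equation[where u = u and P = P and C = C and \<delta> = \<delta>1, OF q c \<delta>1(1) u0 P _ v(1) C _ _ z])
      show "solves_SAR q \<sigma> l (u l)" if "0 \<le> l" "l < \<delta>1" for l using sol that \<delta>1 by simp
      show "\<bar>u l x - u 0 x - l * v x\<bar> \<le> C * l * l" "\<bar>P l x - P 0 x - l * v' x\<bar> \<le> C * l * l"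
        if "0 < l" "l < \<delta>1" "x \<in> {-1..1}" for l x
        using eu[of 0 l x] eP[of 0 l x] that by auto
    qed
  qed (use c v in auto)
  show ?thesis
  proof (rule that[of v v'])
    show "linearized (c_in \<sigma>) v v'" using lin by (simp add: c_def)
    fix Q assume "holds_C1_near v v' Q"
    then obtain \<epsilon> where \<epsilon>: "0 < \<epsilon>" and Q: "\<forall>d d'. C1_deriv d d' \<longrightarrow>
        C1_close \<epsilon> {-1..1} v v' d d' \<longrightarrow> d (-1) = 0 \<longrightarrow> d 1 = 0 \<longrightarrow> Q d"
      unfolding holds_C1_near_def by (elim exE conjE)
    (* C + 1 instead of C because C may vanish *)
    define \<delta> where "\<delta> = min \<delta>1 (\<epsilon> / (C + 1))"
    have \<delta>: "0 < \<delta>" "\<delta> \<le> \<delta>0" using \<delta>1 \<epsilon> C by (auto simp: \<delta>_def)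
    have "Q (secant u l' l)" if l: "0 \<le> l'" "l' < l" "l < \<delta>" for l l'
    proof -
      let ?d = "secant u l' l" and ?d' = "\<lambda>x. (P l x - P l' x) / (l - l')"
      have l1: "l < \<delta>1" using l by (simp add: \<delta>_def)
      have "C1_deriv (\<lambda>x. 1 / (l - l') * u l x + (- 1 / (l - l')) * u l' x) (\<lambda>x. 1 / (l - l') * P l x + (- 1 / (l - l')) * P l' x)"
        using l l1 by (intro C1_deriv_linear P) auto
      then have C1: "C1_deriv ?d ?d'" by (simp add: secant_def[abs_def] diff_divide_distrib)
      have "C * l < \<epsilon>"
      proof -
        have "C * l \<le> (C + 1) * l" using l by (intro mult_right_mono) auto
        also have "(C + 1) * l < \<epsilon>" using l C by (simp add: \<delta>_def field_simps)
        finally show ?thesis .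
      qed
      moreover have "\<bar>a / (l - l') - b\<bar> \<le> C * l" if "\<bar>a - (l - l') * b\<bar> \<le> C * l * (l - l')" for a b
      proof -
        have "a / (l - l') - b = (a - (l - l') * b) / (l - l')" using l by (simp add: diff_divide_distrib)
        then show ?thesis using that l by (simp add: pos_divide_le_eq)
      qed
      ultimately have lt: "\<bar>a / (l - l') - b\<bar> < \<epsilon>" if "\<bar>a - (l - l') * b\<bar> \<le> C * l * (l - l')" for a b
        using that by (rule_tac le_less_trans)
      have close: "C1_close \<epsilon> {-1..1} v v' ?d ?d'"
        unfolding C1_close_def
      proof (intro ballI conjI)
        fix x :: real assume x: "x \<in> {-1..1}"
        show "(?d has_real_derivative ?d' x) (at x within {-1..1})"
          using C1 x unfolding C1_deriv_def by blast
        show "\<bar>?d x - v x\<bar> < \<epsilon>" "\<bar>?d' x - v' x\<bar> < \<epsilon>"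
          unfolding secant_def by (rule lt[OF eu[OF l(1,2) l1 x]], rule lt[OF eP[OF l(1,2) l1 x]])
      qed
      have "u y (-1) = 0 \<and> u y 1 = 0" if "0 \<le> y" "y < \<delta>0" for y
        using sol[OF that] by (simp add: solves_SAR_def W2qD_def)
      from this[of l] this[of l'] show ?thesis
        by (intro Q[rule_format, OF C1 close]) (use l \<delta>(2) in \<open>simp_all add: secant_def\<close>)
    qed
    then show "\<exists>\<delta>>0. \<delta> \<le> \<delta>0 \<and> (\<forall>l' l. 0 \<le> l' \<and> l' < l \<and> l < \<delta> \<longrightarrow> Q (secant u l' l))"
      using \<delta> by blast
  qed
qed

context linearized
begin

lemma half_continuous: "continuous_on {0..1} v" "continuous_on {0..1} v'"
  using v_continuous v'_continuous by (auto intro: continuous_on_subset)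

text \<open>Since \<open>v\<close> is even, the reflection of a function close to \<open>v\<close> is also close to \<open>v\<close>. This reduces statements on
\<open>[-1,1]\<close> to statements on \<open>[0,1]\<close>.\<close>

lemma close_halves:
  assumes "C1_deriv d d'" "C1_close \<epsilon> {-1..1} v v' d d'"
  shows "C1_close \<epsilon> {0..1} v v' d d'" "C1_close \<epsilon> {0..1} v v' (\<lambda>x. d (- x)) (\<lambda>x. - d' (- x))"
  by (rule C1_close_subset[OF assms(2)], auto)
     (rule C1_close_subset[OF C1_close_mirror[OF assms v_even v'_odd]], auto)

lemma nearby_negative:
  assumes s: "0 < v' 1"
  shows "holds_C1_near v v' (\<lambda>d. \<forall>x\<in>Om. d x < 0)"
proof -
  have "\<exists>\<epsilon>>0. \<forall>d d'. C1_close \<epsilon> {0..1} v v' d d' \<longrightarrow> d 1 = 0 \<longrightarrow> (\<forall>x. 0 \<le> x \<longrightarrow> x < 1 \<longrightarrow> d x < 0)"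
    by (rule stable_negativity[OF zero_less_one half_continuous negative_if_slope_pos[OF s] s])
  then obtain \<epsilon> where \<epsilon>: "0 < \<epsilon>"
    and half: "\<forall>d d'. C1_close \<epsilon> {0..1} v v' d d' \<longrightarrow> d 1 = 0 \<longrightarrow> (\<forall>x. 0 \<le> x \<longrightarrow> x < 1 \<longrightarrow> d x < 0)"
    by (elim exE conjE)
  have "d x < 0" if d: "C1_deriv d d'" "C1_close \<epsilon> {-1..1} v v' d d'" and b: "d (-1) = 0" "d 1 = 0" and x: "x \<in> Om" for d d' x
    using half[rule_format, OF close_halves(1)[OF d] b(2), of x] half[rule_format, OF close_halves(2)[OF d], of "- x"] b x
    by (cases "0 \<le> x") auto
  then show ?thesis unfolding holds_C1_near_def using \<epsilon> by (intro exI[of _ \<epsilon>]) simp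
qed

lemma nearby_two_zeros:
  assumes s: "v' 1 < 0" and k: "c_crit < c"
  shows "holds_C1_near v v' (\<lambda>d. card {x \<in> Om. d x = 0} = 2)"
proof -
  have "x * sinh x < cosh x" if "0 < x" "x < c_crit" for x using below_c_crit[of x] that by simp
  note crossing = one_crossing_if_slope_neg[OF s c_crit(1) k c_crit(2) this]
  obtain z0 where z0: "0 < z0" "z0 < 1" "v z0 = 0" "0 < v' z0"
    "\<And>z. 0 \<le> z \<Longrightarrow> z < z0 \<Longrightarrow> v z < 0" "\<And>z. z0 < z \<Longrightarrow> z < 1 \<Longrightarrow> 0 < v z"
    by (rule crossing) (assumption | rule that; assumption)+
  have "\<exists>\<epsilon>>0. \<forall>d d'. C1_close \<epsilon> {0..1} v v' d d' \<longrightarrow> d 1 = 0 \<longrightarrow>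
      (\<exists>y. {x. 0 \<le> x \<and> x < 1 \<and> d x = 0} = {y} \<and> 0 < y \<and> y < 1)"
    by (rule stable_single_zero_on_half[OF half_continuous z0(1,2,5,6,4) s])
  then obtain \<epsilon> where \<epsilon>: "0 < \<epsilon>" and half: "\<forall>d d'. C1_close \<epsilon> {0..1} v v' d d' \<longrightarrow> d 1 = 0 \<longrightarrow>
      (\<exists>y. {x. 0 \<le> x \<and> x < 1 \<and> d x = 0} = {y} \<and> 0 < y \<and> y < 1)"
    by (elim exE conjE)
  have "card {x \<in> Om. d x = 0} = 2" if d: "C1_deriv d d'" "C1_close \<epsilon> {-1..1} v v' d d'" and b: "d (-1) = 0" "d 1 = 0" for d d'
  proof -
    obtain y1 where y1: "{x. 0 \<le> x \<and> x < 1 \<and> d x = 0} = {y1}" "0 < y1" "y1 < 1"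
      using half[rule_format, OF close_halves(1)[OF d] b(2)] by blast
    obtain y2 where y2: "{x. 0 \<le> x \<and> x < 1 \<and> d (- x) = 0} = {y2}" "0 < y2" "y2 < 1"
      using half[rule_format, OF close_halves(2)[OF d]] b(1) by auto
    have "{x \<in> Om. d x = 0} = {y1, - y2}"
    proof (intro equalityI subsetI)
      fix x assume x: "x \<in> {x \<in> Om. d x = 0}"
      show "x \<in> {y1, - y2}"
      proof (cases "0 \<le> x")
        case True
        then have "x \<in> {x. 0 \<le> x \<and> x < 1 \<and> d x = 0}" using x by auto
        then show ?thesis unfolding y1 by simp
      next
        case False
        then have "- x \<in> {x. 0 \<le> x \<and> x < 1 \<and> d (- x) = 0}" using x by auto
        then show ?thesis unfolding y2 by auto
      qed
    next
      fix x assume x: "x \<in> {y1, - y2}"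
      have "y1 \<in> {x. 0 \<le> x \<and> x < 1 \<and> d x = 0}" "y2 \<in> {x. 0 \<le> x \<and> x < 1 \<and> d (- x) = 0}"
        using y1(1) y2(1) by auto
      then show "x \<in> {x \<in> Om. d x = 0}" using x by auto
    qed
    then show ?thesis using y1(2) y2(2) by (simp add: card_insert_if)
  qed
  then show ?thesis unfolding holds_C1_near_def using \<epsilon> by (intro exI[of _ \<epsilon>]) simp
qed

text \<open>Beyond \<open>c_crit\<close> the factor \<open>c sinh c - cosh c\<close> in \<open>boundary_slope\<close> is positive.\<close>

lemma slope_sign:
  assumes "c_crit < c"
  shows "0 < v' 1 \<longleftrightarrow> 0 < integral {0..1} (stability_integrand c)"
    and "v' 1 < 0 \<longleftrightarrow> integral {0..1} (stability_integrand c) < 0"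
proof -
  have p: "0 < c * sinh c - cosh c" "0 < c\<^sup>2 * (cosh c)\<^sup>2" using above_c_crit[OF assms] c by auto
  show "0 < v' 1 \<longleftrightarrow> 0 < integral {0..1} (stability_integrand c)"
    using zero_less_mult_iff[of "v' 1" "c * sinh c - cosh c"] zero_less_mult_iff[of "c\<^sup>2 * (cosh c)\<^sup>2"]
      boundary_slope p by (metis order_less_asym)
  show "v' 1 < 0 \<longleftrightarrow> integral {0..1} (stability_integrand c) < 0"
    using mult_less_0_iff[of "v' 1" "c * sinh c - cosh c"] mult_less_0_iff[of "c\<^sup>2 * (cosh c)\<^sup>2"]
      boundary_slope p by (metis order_less_asym)
qed

end

lemma inner_curve_decreasing:
  assumes q: "1 \<le> q" and \<sigma>: "sigma_crit < \<sigma>" and \<delta>0: "0 < \<delta>0" and u: "inner_solution_curve q \<sigma> \<delta>0 u"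
    and J: "0 < integral {0..1} (stability_integrand (c_in \<sigma>))"
  shows "\<exists>\<delta>>0. \<delta> \<le> \<delta>0 \<and> (\<forall>l' l. 0 \<le> l' \<and> l' < l \<and> l < \<delta> \<longrightarrow> (\<forall>z\<in>{-1<..<1}. u l' z > u l z))"
proof (rule inner_curve_linearization[OF q \<sigma> \<delta>0 u])
  fix v v'
  assume "linearized (c_in \<sigma>) v v'" and transfer: "\<And>Q. holds_C1_near v v' Q \<Longrightarrow>
      \<exists>\<delta>>0. \<delta> \<le> \<delta>0 \<and> (\<forall>l' l. 0 \<le> l' \<and> l' < l \<and> l < \<delta> \<longrightarrow> Q (secant u l' l))"
  then interpret linearized "c_in \<sigma>" v v' by simp
  have "0 < v' 1" using slope_sign(1) c_in(1)[OF \<sigma>] J by simp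
  from transfer[OF nearby_negative[OF this]] obtain \<delta> where \<delta>: "0 < \<delta>" "\<delta> \<le> \<delta>0"
    and neg: "\<forall>l' l. 0 \<le> l' \<and> l' < l \<and> l < \<delta> \<longrightarrow> (\<forall>z\<in>Om. secant u l' l z < 0)"
    by (elim exE conjE)
  have "u l z < u l' z" if "0 \<le> l'" "l' < l" "l < \<delta>" "z \<in> Om" for l l' z
  proof -
    have "secant u l' l z < 0" using neg that by blast
    then show ?thesis using that by (simp add: secant_def divide_less_0_iff)
  qed
  then show ?thesis using \<delta> by blast
qed

lemma inner_curve_two_intersections:
  assumes q: "1 \<le> q" and \<sigma>: "sigma_crit < \<sigma>" and \<delta>0: "0 < \<delta>0" and u: "inner_solution_curve q \<sigma> \<delta>0 u"
    and J: "integral {0..1} (stability_integrand (c_in \<sigma>)) < 0"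
  shows "\<exists>\<delta>>0. \<delta> \<le> \<delta>0 \<and> (\<forall>l' l. 0 \<le> l' \<and> l' < l \<and> l < \<delta> \<longrightarrow> card {z \<in> {-1<..<1}. u l' z = u l z} = 2)"
proof (rule inner_curve_linearization[OF q \<sigma> \<delta>0 u])
  fix v v'
  assume "linearized (c_in \<sigma>) v v'" and transfer: "\<And>Q. holds_C1_near v v' Q \<Longrightarrow>
      \<exists>\<delta>>0. \<delta> \<le> \<delta>0 \<and> (\<forall>l' l. 0 \<le> l' \<and> l' < l \<and> l < \<delta> \<longrightarrow> Q (secant u l' l))"
  then interpret linearized "c_in \<sigma>" v v' by simp
  have "v' 1 < 0" using slope_sign(2) c_in(1)[OF \<sigma>] J by simp
  from transfer[OF nearby_two_zeros[OF this c_in(1)[OF \<sigma>]]] obtain \<delta> where \<delta>: "0 < \<delta>" "\<delta> \<le> \<delta>0"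
    and two: "\<forall>l' l. 0 \<le> l' \<and> l' < l \<and> l < \<delta> \<longrightarrow> card {z \<in> Om. secant u l' l z = 0} = 2"
    by (elim exE conjE)
  have "{z \<in> Om. secant u l' l z = 0} = {z \<in> Om. u l' z = u l z}" if "l' < l" for l l'
    using that by (auto simp: secant_def)
  with two have "\<forall>l' l. 0 \<le> l' \<and> l' < l \<and> l < \<delta> \<longrightarrow> card {z \<in> Om. u l' z = u l z} = 2" by simp
  then show ?thesis using \<delta> by blast
qed

theorem theorem1p4:
  fixes q :: real
  assumes "2 < q"
  shows "\<exists>\<sigma>l \<sigma>u. sigma_crit < \<sigma>l \<and> \<sigma>l \<le> \<sigma>u \<and>
    (\<forall>\<sigma> > sigma_crit. \<forall>\<delta>\<^sub>0 > 0. \<forall>u. inner_solution_curve q \<sigma> \<delta>\<^sub>0 u \<longrightarrow>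
       (\<sigma> < \<sigma>l \<longrightarrow>
          (\<exists>\<delta>>0. \<delta> \<le> \<delta>\<^sub>0 \<and>
             (\<forall>l' l. 0 \<le> l' \<and> l' < l \<and> l < \<delta> \<longrightarrow> (\<forall>z\<in>{-1<..<1}. u l' z > u l z)))) \<and>
       (\<sigma> > \<sigma>u \<longrightarrow>
          (\<exists>\<delta>>0. \<delta> \<le> \<delta>\<^sub>0 \<and>
             (\<forall>l' l. 0 \<le> l' \<and> l' < l \<and> l < \<delta> \<longrightarrow>
                card {z \<in> {-1<..<1}. u l' z = u l z} = 2))))"
proof -
  have q: "1 \<le> q" using assms by simp
  obtain c1 where c1: "c_crit < c1" "\<And>c. c_crit < c \<Longrightarrow> c < c1 \<Longrightarrow> 0 < integral {0..1} (stability_integrand c)"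
    by (rule stability_integral_pos_near_c_crit) (rule that; assumption)
  obtain c2 where c2: "\<And>c. c2 < c \<Longrightarrow> integral {0..1} (stability_integrand c) < 0"
    by (rule stability_integral_neg_for_large_c) (rule that; assumption)
  define b where "b = max c1 c2"
  have mono: "c < c'" if "cosh c / c < cosh c' / c'" "c_crit < c" "c_crit < c'" for c c'
    using aspect_ratio_strict_mono[of c' c] that by (cases c c' rule: linorder_cases) auto
  have le: "cosh c1 / c1 \<le> cosh b / b"
  proof (cases "c1 = b")
    case False
    then have "c1 < b" by (simp add: b_def)
    then show ?thesis using aspect_ratio_strict_mono[of c1 b] c1(1) by simp
  qed simp
  have crit: "sigma_crit < cosh c1 / c1"
    unfolding sigma_crit_def by (rule aspect_ratio_strict_mono[OF order_refl c1(1)])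
  have small: "0 < integral {0..1} (stability_integrand (c_in \<sigma>))" if "sigma_crit < \<sigma>" "\<sigma> < cosh c1 / c1" for \<sigma>
  proof -
    have "cosh (c_in \<sigma>) / c_in \<sigma> = \<sigma>" using c_in(2)[OF that(1)] by (rule sym)
    then have "c_in \<sigma> < c1" using mono[of "c_in \<sigma>" c1] that(2) c1(1) c_in(1)[OF that(1)] by simp
    then show ?thesis by (intro c1(2) c_in(1)[OF that(1)])
  qed
  have large: "integral {0..1} (stability_integrand (c_in \<sigma>)) < 0" if "sigma_crit < \<sigma>" "cosh b / b < \<sigma>" for \<sigma>
  proof -
    have "c_crit < b" using c1(1) by (simp add: b_def)
    moreover have "cosh (c_in \<sigma>) / c_in \<sigma> = \<sigma>" using c_in(2)[OF that(1)] by (rule sym)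
    ultimately have "b < c_in \<sigma>" using mono[of b "c_in \<sigma>"] that(2) c_in(1)[OF that(1)] by simp
    then show ?thesis by (intro c2) (simp add: b_def)
  qed
  show ?thesis
  proof (rule exI[of _ "cosh c1 / c1"], rule exI[of _ "cosh b / b"], intro conjI allI impI)
    fix \<sigma> \<delta>\<^sub>0 :: real and u
    assume \<sigma>: "sigma_crit < \<sigma>" and \<delta>0: "0 < \<delta>\<^sub>0" and u: "inner_solution_curve q \<sigma> \<delta>\<^sub>0 u"
    show "\<exists>\<delta>>0. \<delta> \<le> \<delta>\<^sub>0 \<and> (\<forall>l' l. 0 \<le> l' \<and> l' < l \<and> l < \<delta> \<longrightarrow> (\<forall>z\<in>{-1<..<1}. u l' z > u l z))"
      if "\<sigma> < cosh c1 / c1"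
      by (rule inner_curve_decreasing[OF q \<sigma> \<delta>0 u small[OF \<sigma> that]])
    show "\<exists>\<delta>>0. \<delta> \<le> \<delta>\<^sub>0 \<and> (\<forall>l' l. 0 \<le> l' \<and> l' < l \<and> l < \<delta> \<longrightarrow> card {z \<in> {-1<..<1}. u l' z = u l z} = 2)"
      if "\<sigma> > cosh b / b"
      by (rule inner_curve_two_intersections[OF q \<sigma> \<delta>0 u large[OF \<sigma> that]])
  qed (rule crit le)+
qed

end
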